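(* Let $n$ be a positive integer and let $E_{(n)}$ be the elliptic curve $y^2 = x^3 - n^2 x$. Then over $\mathbb{C}$, $$E_{(n)} \cong \mathbb{C}\big/\left(\tfrac{\pi}{\sqrt{n}}\, G\, \mathbb{Z}[i]\right),$$ where $G = 1/M(\sqrt{2},1)\approx 0.8346268\ldots$ is Gauss's constant.
   Context: $M(x,y)$ denotes the arithmetic–geometric mean of positive reals $x,y$. The isomorphism $\mathbb{C}/\Lambda\to E$ is the Weierstrass map $z\mapsto(\wp_\Lambda(z),\wp_\Lambda'(z))$ (and $z\in\Lambda\mapsto\infty$). *)

theory Defs
  imports "HOL-Analysis.Analysis" "HOL-Algebra.Coset"
begin

section \<open>The arithmetic--geometric mean and Gauss's constant\<close>

primrec agm_iter :: "real \<Rightarrow> real \<Rightarrow> nat \<Rightarrow> real \<times> real" where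
  "agm_iter x y 0 = (x, y)"
| "agm_iter x y (Suc k) =
     (case agm_iter x y k of (a, b) \<Rightarrow> ((a + b) / 2, sqrt (a * b)))"

text \<open>For positive arguments both components converge to the same limit.\<close>

definition agm :: "real \<Rightarrow> real \<Rightarrow> real" where
  "agm x y = lim (\<lambda>k. fst (agm_iter x y k))"

definition gauss_constant :: real where
  "gauss_constant = 1 / agm (sqrt 2) 1"

definition gaussian_integers :: "complex set" where
  "gaussian_integers = {of_int a + \<i> * of_int b | a b. True}"


section \<open>Riemann surfaces with a group law\<close>

definition quotient_topology :: "'a topology \<Rightarrow> ('a \<Rightarrow> 'b) \<Rightarrow> 'b topology" where
  "quotient_topology X q =
     topology (\<lambda>W. W \<subseteq> q ` topspace X \<and> openin X {x \<in> topspace X. q x \<in> W})"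

lemma openin_quotient_topology:
  "openin (quotient_topology X q) W \<longleftrightarrow>
     W \<subseteq> q ` topspace X \<and> openin X {x \<in> topspace X. q x \<in> W}"
proof -
  have "istopology (\<lambda>W. W \<subseteq> q ` topspace X \<and> openin X {x \<in> topspace X. q x \<in> W})"
    unfolding istopology_def
  proof (intro conjI allI impI)
    fix S T
    assume S: "S \<subseteq> q ` topspace X \<and> openin X {x \<in> topspace X. q x \<in> S}"
      and T: "T \<subseteq> q ` topspace X \<and> openin X {x \<in> topspace X. q x \<in> T}"
    show "S \<inter> T \<subseteq> q ` topspace X" using S by blast
    have "{x \<in> topspace X. q x \<in> S \<inter> T}
        = {x \<in> topspace X. q x \<in> S} \<inter> {x \<in> topspace X. q x \<in> T}" by blast
    then show "openin X {x \<in> topspace X. q x \<in> S \<inter> T}" using S T by (simp add: openin_Int)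
  next
    fix K
    assume K: "\<forall>S\<in>K. S \<subseteq> q ` topspace X \<and> openin X {x \<in> topspace X. q x \<in> S}"
    show "\<Union>K \<subseteq> q ` topspace X" using K by blast
    have "{x \<in> topspace X. q x \<in> \<Union>K} = (\<Union>S\<in>K. {x \<in> topspace X. q x \<in> S})" by blast
    then show "openin X {x \<in> topspace X. q x \<in> \<Union>K}" using K by auto
  qed
  then show ?thesis by (simp add: quotient_topology_def)
qed

lemma topspace_quotient_topology: "topspace (quotient_topology X q) = q ` topspace X"
proof -
  have "{x \<in> topspace X. q x \<in> q ` topspace X} = topspace X" by blast
  then have "openin (quotient_topology X q) (q ` topspace X)"
    by (simp add: openin_quotient_topology)
  then show ?thesis
    by (meson openin_quotient_topology openin_subset openin_topspace subset_antisym)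
qed

definition complex_chart :: "'a topology \<Rightarrow> 'a set \<Rightarrow> ('a \<Rightarrow> complex) \<Rightarrow> bool" where
  "complex_chart X U \<phi> \<longleftrightarrow>
     openin X U \<and> open (\<phi> ` U) \<and>
     homeomorphic_map (subtopology X U) (top_of_set (\<phi> ` U)) \<phi>"

definition riemann_surface :: "'a topology \<Rightarrow> ('a set \<times> ('a \<Rightarrow> complex)) set \<Rightarrow> bool" where
  "riemann_surface X A \<longleftrightarrow>
     Hausdorff_space X \<and> connected_space X \<and>
     (\<forall>(U, \<phi>)\<in>A. complex_chart X U \<phi>) \<and>
     (\<Union>(U, \<phi>)\<in>A. U) = topspace X \<and>
     (\<forall>(U, \<phi>)\<in>A. \<forall>(V, \<psi>)\<in>A. (\<psi> \<circ> inv_into U \<phi>) holomorphic_on \<phi> ` (U \<inter> V))"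

definition holomorphic_map ::
  "'a topology \<Rightarrow> ('a set \<times> ('a \<Rightarrow> complex)) set \<Rightarrow>
   'b topology \<Rightarrow> ('b set \<times> ('b \<Rightarrow> complex)) set \<Rightarrow> ('a \<Rightarrow> 'b) \<Rightarrow> bool" where
  "holomorphic_map X A Y B f \<longleftrightarrow>
     continuous_map X Y f \<and>
     (\<forall>(U, \<phi>)\<in>A. \<forall>(V, \<psi>)\<in>B.
        (\<psi> \<circ> f \<circ> inv_into U \<phi>) holomorphic_on \<phi> ` {p \<in> U. f p \<in> V})"

record 'a complex_curve_group = "'a monoid" +
  curve_topology :: "'a topology"
  curve_atlas :: "('a set \<times> ('a \<Rightarrow> complex)) set"

text \<open>
  Isomorphism of one-dimensional complex Lie groups: a group isomorphism that is biholomorphic.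
  That both sides are Riemann surfaces on their carriers is part of the notion.
\<close>

definition complex_lie_iso ::
  "'a complex_curve_group \<Rightarrow> 'b complex_curve_group \<Rightarrow> ('a \<Rightarrow> 'b) \<Rightarrow> bool" where
  "complex_lie_iso G H f \<longleftrightarrow>
     group G \<and> topspace (curve_topology G) = carrier G \<and>
     riemann_surface (curve_topology G) (curve_atlas G) \<and>
     group H \<and> topspace (curve_topology H) = carrier H \<and>
     riemann_surface (curve_topology H) (curve_atlas H) \<and>
     f \<in> iso G H \<and>
     holomorphic_map (curve_topology G) (curve_atlas G) (curve_topology H) (curve_atlas H) f \<and>
     holomorphic_map (curve_topology H) (curve_atlas H) (curve_topology G) (curve_atlas G)
       (inv_into (carrier G) f)"


section \<open>The complex torus\<close>

definition complex_add_group :: "complex monoid" where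
  "complex_add_group = \<lparr>carrier = UNIV, mult = (+), one = 0\<rparr>"

definition torus_proj :: "complex set \<Rightarrow> complex \<Rightarrow> complex set" where
  "torus_proj \<Lambda> z = \<Lambda> #>\<^bsub>complex_add_group\<^esub> z"

text \<open>The charts are the local inverses of the projection \<open>\<complex> \<rightarrow> \<complex>/\<Lambda>\<close>.\<close>

definition complex_torus :: "complex set \<Rightarrow> complex set complex_curve_group" where
  "complex_torus \<Lambda> =
     monoid.extend (complex_add_group Mod \<Lambda>)
       \<lparr>curve_topology = quotient_topology euclidean (torus_proj \<Lambda>),
        curve_atlas = {(torus_proj \<Lambda> ` D, inv_into D (torus_proj \<Lambda>)) | D.
                         open D \<and> inj_on (torus_proj \<Lambda>) D}\<rparr>"


section \<open>The elliptic curve \<open>y\<^sup>2 = x\<^sup>3 + a x + b\<close> over the complex numbers\<close>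

text \<open>\<open>None\<close> is the point at infinity \<open>[0 : 1 : 0]\<close>, and \<open>Some (x, y)\<close> is \<open>[x : y : 1]\<close>.\<close>

type_synonym ec_point = "(complex \<times> complex) option"

definition ec_points :: "complex \<Rightarrow> complex \<Rightarrow> ec_point set" where
  "ec_points a b = insert None {Some (x, y) | x y. y ^ 2 = x ^ 3 + a * x + b}"

text \<open>Chord--tangent addition.\<close>

fun ec_add :: "complex \<Rightarrow> ec_point \<Rightarrow> ec_point \<Rightarrow> ec_point" where
  "ec_add a None Q = Q"
| "ec_add a P None = P"
| "ec_add a (Some (x1, y1)) (Some (x2, y2)) =
     (if x1 = x2 \<and> y1 = - y2 then None
      else let m = (if x1 = x2 then (3 * x1 ^ 2 + a) / (2 * y1) else (y2 - y1) / (x2 - x1));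
               x3 = m ^ 2 - x1 - x2
           in Some (x3, m * (x1 - x3) - y1))"

text \<open>
  The punctured affine cone over the projective closure \<open>Y\<^sup>2 Z = X\<^sup>3 + a X Z\<^sup>2 + b Z\<^sup>3\<close>, and the
  projection \<open>(X, Y, Z) \<mapsto> [X : Y : Z]\<close> from it onto the curve (on the cone, \<open>Z = 0\<close> forces
  \<open>X = 0\<close>).  The quotient topology under this projection is the subspace topology from the
  complex projective plane.
\<close>

definition ec_cone :: "complex \<Rightarrow> complex \<Rightarrow> (complex \<times> complex \<times> complex) set" where
  "ec_cone a b = {(X, Y, Z). (X, Y, Z) \<noteq> (0, 0, 0) \<and>
                    Y ^ 2 * Z = X ^ 3 + a * X * Z ^ 2 + b * Z ^ 3}"

fun ec_proj :: "complex \<times> complex \<times> complex \<Rightarrow> ec_point" where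
  "ec_proj (X, Y, Z) = (if Z = 0 then None else Some (X / Z, Y / Z))"

definition ec_topology :: "complex \<Rightarrow> complex \<Rightarrow> ec_point topology" where
  "ec_topology a b = quotient_topology (top_of_set (ec_cone a b)) ec_proj"

lemma topspace_ec_topology: "topspace (ec_topology a b) = ec_points a b"
proof -
  have "ec_proj p \<in> ec_points a b" if "p \<in> ec_cone a b" for p
  proof -
    obtain X Y Z where p: "p = (X, Y, Z)" by (cases p)
    show ?thesis
    proof (cases "Z = 0")
      case False
      have eq: "Y ^ 2 * Z = X ^ 3 + a * X * Z ^ 2 + b * Z ^ 3"
        using that by (simp add: p ec_cone_def)
      have "(Y / Z) ^ 2 = Y ^ 2 * Z / Z ^ 3"
        using False by (simp add: field_simps power2_eq_square power3_eq_cube)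
      also have "\<dots> = (X / Z) ^ 3 + a * (X / Z) + b"
        unfolding eq using False by (simp add: field_simps power2_eq_square power3_eq_cube)
      finally show ?thesis using False by (simp add: p ec_points_def)
    qed (simp add: p ec_points_def)
  qed
  moreover have "P \<in> ec_proj ` ec_cone a b" if P: "P \<in> ec_points a b" for P
  proof (cases P)
    case None
    have "(0, 1, 0) \<in> ec_cone a b" "ec_proj (0, 1, 0) = P"
      by (simp_all add: ec_cone_def None)
    then show ?thesis by blast
  next
    case (Some q)
    obtain x y where q: "q = (x, y)" by (cases q)
    have "(x, y, 1) \<in> ec_cone a b" "ec_proj (x, y, 1) = P"
      using P by (simp_all add: ec_cone_def ec_points_def Some q)
    then show ?thesis by blast
  qed
  ultimately show ?thesis by (auto simp: ec_topology_def topspace_quotient_topology)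
qed

fun ec_x :: "ec_point \<Rightarrow> complex" where
  "ec_x None = 0" | "ec_x (Some (x, y)) = x"

fun ec_y :: "ec_point \<Rightarrow> complex" where
  "ec_y None = 0" | "ec_y (Some (x, y)) = y"

fun ec_u :: "ec_point \<Rightarrow> complex" where
  "ec_u None = 0" | "ec_u (Some (x, y)) = x / y"

text \<open>
  The complex structure of a nonsingular curve as a submanifold of the projective plane: its
  charts are the affine coordinates \<open>x\<close>, \<open>y\<close> away from infinity and \<open>u = X / Y\<close> away from
  \<open>Y = 0\<close>, each on those open sets on which it is a homeomorphism onto an open set.
\<close>

definition ec_atlas :: "complex \<Rightarrow> complex \<Rightarrow> (ec_point set \<times> (ec_point \<Rightarrow> complex)) set" where
  "ec_atlas a b =
     {(U, \<phi>). complex_chart (ec_topology a b) U \<phi> \<and>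
        (\<phi> = ec_x \<and> None \<notin> U \<or> \<phi> = ec_y \<and> None \<notin> U \<or> \<phi> = ec_u \<and> (\<forall>x. Some (x, 0) \<notin> U))}"

definition elliptic_curve :: "complex \<Rightarrow> complex \<Rightarrow> ec_point complex_curve_group" where
  "elliptic_curve a b =
     \<lparr>carrier = ec_points a b, mult = ec_add a, one = None,
      curve_topology = ec_topology a b, curve_atlas = ec_atlas a b\<rparr>"


section \<open>The Weierstrass map\<close>

definition weierstrass_p :: "complex set \<Rightarrow> complex \<Rightarrow> complex" where
  "weierstrass_p \<Lambda> z =
     1 / z ^ 2 + (\<Sum>\<^sub>\<infinity>\<omega>\<in>\<Lambda> - {0}. 1 / (z - \<omega>) ^ 2 - 1 / \<omega> ^ 2)"

definition weierstrass_map :: "complex set \<Rightarrow> complex \<Rightarrow> ec_point" where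
  "weierstrass_map \<Lambda> z =
     (if z \<in> \<Lambda> then None else Some (weierstrass_p \<Lambda> z, deriv (weierstrass_p \<Lambda>) z))"

text \<open>
  The Weierstrass map takes values in a curve \<open>y\<^sup>2 = 4 x\<^sup>3 - g\<^sub>2 x - g\<^sub>3\<close>; the coordinate change
  \<open>y \<mapsto> y / 2\<close> carries that curve to the monic model \<open>y\<^sup>2 = x\<^sup>3 - (g\<^sub>2/4) x - g\<^sub>3/4\<close>.
\<close>

definition halve_y :: "ec_point \<Rightarrow> ec_point" where
  "halve_y = map_option (\<lambda>(x, y). (x, y / 2))"

text \<open>
  The induced map on cosets: \<open>the_elem\<close> picks the common value on the coset, and is
  unspecified unless the map is constant on it.
\<close>

definition weierstrass_torus_map :: "complex set \<Rightarrow> complex set \<Rightarrow> ec_point" where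
  "weierstrass_torus_map \<Lambda> Z = the_elem ((halve_y \<circ> weierstrass_map \<Lambda>) ` Z)"

end

theory Submission
  imports Defs "HOL-Complex_Analysis.Complex_Analysis" "HOL-Real_Asymp.Real_Asymp"
begin

text \<open>
  The arithmetic--geometric mean enters through the flow
  \<open>x' = c \<surd>((x\<^sup>2 + a\<^sup>2) (x\<^sup>2 + b\<^sup>2))\<close>. The Landen substitution \<open>u = (x - ab/x) / 2\<close> maps each of the
  two halves of a trajectory running from \<open>-\<infinity>\<close> to \<open>\<infinity>\<close> onto a full trajectory for the means of
  \<open>a\<close> and \<open>b\<close> with \<open>c\<close> doubled. A trajectory for \<open>a \<ge> b\<close> takes a time between \<open>\<pi>/(ca)\<close> and
  \<open>\<pi>/(cb)\<close>, so by iteration it takes exactly \<open>\<pi>/(c M(a, b))\<close>. No integrals are needed.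

  For a square lattice \<open>\<omega>\<int>[i]\<close> the symmetry \<open>\<wp>(iz) = -\<wp>(z)\<close> gives \<open>\<wp>'\<^sup>2 = 4\<wp>\<^sup>3 - 4e\<^sup>2\<wp>\<close> with
  \<open>e = \<wp>(\<omega>/2)\<close>. On \<open>(0, \<omega>/2)\<close> the function \<open>\<surd>(\<wp> - e)\<close> runs through half of such a trajectory,
  with \<open>a\<^sup>2 = 2e\<close> and \<open>b\<^sup>2 = e\<close>, whence \<open>\<omega>\<surd>e = \<pi>G\<close>; the given period forces \<open>e = n\<close>.

  Surjectivity of \<open>\<wp>\<close> comes from Liouville's theorem and injectivity of \<open>(\<wp>, \<wp>')\<close> from uniqueness for
  \<open>\<wp>'' = 6\<wp>\<^sup>2 - 2e\<^sup>2\<close>. The addition theorem is Euler's: along \<open>z + w = s\<close> the chord--tangent expression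
  is constant. Associativity on the curve is transported from the torus, and a continuous bijection
  from a compact space to a Hausdorff space is a homeomorphism.
\<close>

section \<open>The arithmetic--geometric mean as the period of a flow\<close>

text \<open>The cubic has the roots e, 0 and -e, so for x^2 = \<wp> - e the other two factors are
  x^2 + e and x^2 + 2e; this is the origin of the pair sqrt 2, 1 in Gauss's constant. That x covers
  only a half line is no obstacle: one Landen step already makes it a full trajectory on an interval
  of length \<omega>/2. Before square roots can be taken, e > 0 has to be shown; it comes from \<wp>
  being real on the real axis and decreasing from +infinity, with \<wp>' vanishing only at half
  periods. Zeros and poles of elliptic functions are never counted. Injectivity of (\<wp>, \<wp>')
  takes over that role, for instance in locating the zeros of \<wp>'. The only expansion at 0 is
  that \<wp>(z) - 1/z^2 is holomorphic there and vanishes to second order. On the geometric side the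
  torus and the curve are both images of the plane under locally injective maps. Charts are compared
  upstairs, so one lemma covers the transition maps, the isomorphism and its inverse.\<close>

lemma agm_iter_Suc_left: "agm_iter x y (Suc k) = agm_iter ((x + y) / 2) (sqrt (x * y)) k"
  by (induction k) (simp_all split: prod.split)

lemma agm_iter_scale:
  assumes "c \<ge> 0"
  shows "agm_iter (c * x) (c * y) k = (c * fst (agm_iter x y k), c * snd (agm_iter x y k))"
proof (induction k)
  case (Suc k)
  obtain a b where ab: "agm_iter x y k = (a, b)" by fastforce
  have "sqrt ((c * a) * (c * b)) = c * sqrt (a * b)"
  proof -
    have "(c * a) * (c * b) = c\<^sup>2 * (a * b)" by (simp add: power2_eq_square)
    then show ?thesis using assms by (simp only: real_sqrt_mult real_sqrt_abs abs_of_nonneg)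
  qed
  with Suc ab show ?case by (simp add: field_simps)
qed simp

lemma gm_le_am:
  fixes x y :: real
  assumes "0 < y" "y \<le> x"
  shows "y \<le> sqrt (x * y)" "sqrt (x * y) \<le> (x + y) / 2" "0 < sqrt (x * y)"
proof -
  show "y \<le> sqrt (x * y)" using assms by (intro real_le_rsqrt) (simp add: power2_eq_square)
  show "sqrt (x * y) \<le> (x + y) / 2" using assms arith_geo_mean_sqrt[of x y] by simp
  show "0 < sqrt (x * y)" using assms by simp
qed

lemma agm_iter_order:
  assumes "0 < y" "y \<le> x"
  shows "0 < snd (agm_iter x y k)" "snd (agm_iter x y k) \<le> fst (agm_iter x y k)"
    "y \<le> snd (agm_iter x y k)"
proof -
  have "0 < snd (agm_iter x y k) \<and> snd (agm_iter x y k) \<le> fst (agm_iter x y k) \<and>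
      y \<le> snd (agm_iter x y k)"
  proof (induction k)
    case (Suc k)
    obtain a b where ab: "agm_iter x y k = (a, b)" by fastforce
    with Suc gm_le_am[of b a] show ?case by simp
  qed (use assms in simp)
  then show "0 < snd (agm_iter x y k)" "snd (agm_iter x y k) \<le> fst (agm_iter x y k)"
    "y \<le> snd (agm_iter x y k)" by auto
qed

lemma agm_iter_mono:
  assumes "0 < y" "y \<le> x"
  shows "decseq (\<lambda>k. fst (agm_iter x y k))" "incseq (\<lambda>k. snd (agm_iter x y k))"
proof -
  have *: "fst (agm_iter x y (Suc k)) \<le> fst (agm_iter x y k) \<and>
        snd (agm_iter x y k) \<le> snd (agm_iter x y (Suc k))" for k
  proof -
    obtain a b where ab: "agm_iter x y k = (a, b)" by fastforce
    show ?thesis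
      using agm_iter_order[OF assms, of k] gm_le_am[of b a] by (simp add: ab)
  qed
  show "decseq (\<lambda>k. fst (agm_iter x y k))" "incseq (\<lambda>k. snd (agm_iter x y k))"
    using * by (auto intro: decseq_SucI incseq_SucI)
qed

text \<open>Monotone convergence is applied to the first component only. The second is b_k = 2
  a_(k+1) - a_k, so it tends to 2L - L = L.\<close>

lemma agm_iter_tendsto:
  assumes "0 < y" "y \<le> x"
  shows "(\<lambda>k. fst (agm_iter x y k)) \<longlonglongrightarrow> agm x y" "(\<lambda>k. snd (agm_iter x y k)) \<longlonglongrightarrow> agm x y"
proof -
  let ?a = "\<lambda>k. fst (agm_iter x y k)"
  have "y \<le> ?a k" for k
    using agm_iter_order(2,3)[OF assms, of k] by linarith
  then obtain L where L: "?a \<longlonglongrightarrow> L"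
    using decseq_convergent[OF agm_iter_mono(1)[OF assms], of y] by blast
  then show a: "?a \<longlonglongrightarrow> agm x y" by (simp add: agm_def limI)
  have "(\<lambda>k. 2 * ?a (Suc k) - ?a k) \<longlonglongrightarrow> 2 * agm x y - agm x y"
    by (intro tendsto_intros LIMSEQ_Suc a)
  moreover have "2 * ?a (Suc k) - ?a k = snd (agm_iter x y k)" for k
    by (simp add: field_simps split: prod.split)
  ultimately show "(\<lambda>k. snd (agm_iter x y k)) \<longlonglongrightarrow> agm x y" by simp
qed

lemma agm_bounds:
  assumes "0 < y" "y \<le> x"
  shows "snd (agm_iter x y k) \<le> agm x y" "agm x y \<le> fst (agm_iter x y k)"
  using incseq_le[OF agm_iter_mono(2)[OF assms] agm_iter_tendsto(2)[OF assms]]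
    decseq_ge[OF agm_iter_mono(1)[OF assms] agm_iter_tendsto(1)[OF assms]] by auto

lemma agm_pos:
  assumes "0 < y" "y \<le> x"
  shows "0 < agm x y"
  using agm_iter_order(1)[OF assms, of 0] agm_bounds(1)[OF assms, of 0] by linarith

lemma agm_scale:
  assumes "0 < y" "y \<le> x" "0 < c"
  shows "agm (c * x) (c * y) = c * agm x y"
proof -
  have "(\<lambda>k. fst (agm_iter (c * x) (c * y) k)) \<longlonglongrightarrow> agm (c * x) (c * y)"
    using assms by (intro agm_iter_tendsto) auto
  moreover have "(\<lambda>k. c * fst (agm_iter x y k)) \<longlonglongrightarrow> c * agm x y"
    by (intro tendsto_intros agm_iter_tendsto assms)
  ultimately show ?thesis
    using assms by (simp add: agm_iter_scale LIMSEQ_unique)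
qed

lemma agm_step: "agm x y = agm ((x + y) / 2) (sqrt (x * y))" if "0 < y" "y \<le> x"
proof -
  have "(\<lambda>k. fst (agm_iter x y (Suc k))) \<longlonglongrightarrow> agm x y"
    by (intro LIMSEQ_Suc agm_iter_tendsto that)
  moreover have "(\<lambda>k. fst (agm_iter ((x + y) / 2) (sqrt (x * y)) k)) \<longlonglongrightarrow> agm ((x + y) / 2) (sqrt (x * y))"
    using gm_le_am[OF that] by (intro agm_iter_tendsto) auto
  ultimately show ?thesis
    unfolding agm_iter_Suc_left by (rule LIMSEQ_unique)
qed

text \<open>The two components of every iterate bracket the mean, and convergence is quadratic, so
  three steps give the required digits. All decimals are rounded outwards; at the last step only the
  upper estimate of \<open>a3\<close> and the lower one of \<open>b3\<close> remain.\<close>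

lemma gauss_constant_bounds: "0.8346268 \<le> gauss_constant" "gauss_constant < 0.8346269"
proof -
  have s: "1.41421356237 \<le> sqrt 2" "sqrt 2 \<le> 1.41421356238"
    by (rule real_le_rsqrt real_le_lsqrt; simp add: power2_eq_square)+
  define a1 where "a1 = (sqrt 2 + 1) / 2"
  define b1 where "b1 = sqrt (sqrt 2 * 1)"
  define a2 where "a2 = (a1 + b1) / 2"
  define b2 where "b2 = sqrt (a1 * b1)"
  define a3 where "a3 = (a2 + b2) / 2"
  define b3 where "b3 = sqrt (a2 * b2)"
  have a1: "1.207106781185 \<le> a1" "a1 \<le> 1.20710678119"
    using s by (simp_all add: a1_def)
  have b1: "1.18920711499 \<le> b1" "b1 \<le> 1.18920711501"
    unfolding b1_def using s
    by (intro real_le_rsqrt, simp add: power2_eq_square, intro real_le_lsqrt, simp_all add: power2_eq_square)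
  have a2: "1.198156948 \<le> a2" "a2 \<le> 1.198156949"
    using a1 b1 by (simp_all add: a2_def)
  have ab1: "1.207106781185 * 1.18920711499 \<le> a1 * b1" "a1 * b1 \<le> 1.20710678119 * 1.18920711501"
    using a1 b1 by (intro mult_mono; simp)+
  have b2: "1.198123521 \<le> b2" "b2 \<le> 1.198123522"
    unfolding b2_def using ab1
    by (intro real_le_rsqrt, simp add: power2_eq_square, intro real_le_lsqrt, simp_all add: power2_eq_square)
  have a3: "a3 \<le> 1.1981402356"
    using a2 b2 by (simp add: a3_def)
  have ab2: "1.198156948 * 1.198123521 \<le> a2 * b2"
    using a2 b2 by (intro mult_mono; simp)
  have b3: "1.198140234 \<le> b3"
    unfolding b3_def using ab2
    by (intro real_le_rsqrt, simp add: power2_eq_square)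
  have s1: "0 < (1::real)" "1 \<le> sqrt 2" by simp_all
  have it: "agm_iter (sqrt 2) 1 3 = (a3, b3)"
    by (simp add: numeral_3_eq_3 a1_def b1_def a2_def b2_def a3_def b3_def)
  have "1.198140234 \<le> agm (sqrt 2) 1" "agm (sqrt 2) 1 \<le> 1.1981402356"
    using agm_bounds[OF s1, of 3] a3 b3 by (simp_all add: it)
  then show "0.8346268 \<le> gauss_constant" "gauss_constant < 0.8346269"
    by (simp_all add: gauss_constant_def field_simps)
qed

section \<open>Trajectories, their total time and the Landen step\<close>

text \<open>Stands for an improper integral: such a trajectory takes the time q - p = (1/c) times
  the integral of dx / sqrt((x^2 + a^2) (x^2 + b^2)) over the real line. The end conditions are
  one-sided limits because x blows up at p and q; c is carried along because each Landen step
  doubles it.\<close>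

definition agm_flow :: "real \<Rightarrow> real \<Rightarrow> real \<Rightarrow> (real \<Rightarrow> real) \<Rightarrow> real \<Rightarrow> real \<Rightarrow> bool" where
  "agm_flow a b c x p q \<longleftrightarrow> p < q \<and>
     (\<forall>t\<in>{p<..<q}. (x has_real_derivative c * sqrt (((x t)\<^sup>2 + a\<^sup>2) * ((x t)\<^sup>2 + b\<^sup>2))) (at t)) \<and>
     filterlim x at_bot (at_right p) \<and> filterlim x at_top (at_left q)"

text \<open>Comparison of a monotone function at the ends of an open interval where it has limits
  but no useful values.\<close>

lemma mono_limits_le:
  fixes g :: "real \<Rightarrow> real"
  assumes pq: "p < q"
    and g: "\<And>t. p < t \<Longrightarrow> t < q \<Longrightarrow> (g has_real_derivative g' t) (at t)"
    and g': "\<And>t. p < t \<Longrightarrow> t < q \<Longrightarrow> 0 \<le> g' t"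
    and l: "(g \<longlongrightarrow> l) (at_right p)" and m: "(g \<longlongrightarrow> m) (at_left q)"
  shows "l \<le> m"
proof -
  have mono: "g s \<le> g t" if "p < s" "s \<le> t" "t < q" for s t
    using that by (intro DERIV_nonneg_imp_nondecreasing[of s t g]) (auto intro!: exI[of _ "g' _"] g g')
  define r where "r = (p + q) / 2"
  have r: "p < r" "r < q" using pq by (auto simp: r_def)
  have "eventually (\<lambda>t. g t \<le> g r) (at_right p)"
    using r by (auto simp: eventually_at_right[OF r(1)] intro!: exI[of _ r] mono)
  then have "l \<le> g r" using l by (intro tendsto_upperbound) auto
  moreover have "eventually (\<lambda>t. g r \<le> g t) (at_left q)"
    using r by (auto simp: eventually_at_left[OF r(2)] intro!: exI[of _ r] mono)
  then have "g r \<le> m" using m by (intro tendsto_lowerbound) auto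
  ultimately show ?thesis by simp
qed

lemma tendsto_arctan_div_at_top:
  "(a::real) > 0 \<Longrightarrow> filterlim x at_top F \<Longrightarrow> ((\<lambda>t. arctan (x t / a) / a) \<longlongrightarrow> pi / (2 * a)) F"
proof -
  assume a: "a > 0" and x: "filterlim x at_top F"
  have "filterlim (\<lambda>t. x t / a) at_top F"
    using filterlim_at_top_mult_tendsto_pos[OF tendsto_const, of "1/a", OF _ x] a by simp
  from filterlim_compose[OF tendsto_arctan_at_top this]
  have "((\<lambda>t. arctan (x t / a)) \<longlongrightarrow> pi / 2) F" .
  from tendsto_divide[OF this tendsto_const, of a] a show ?thesis by (simp add: field_simps)
qed

lemma tendsto_arctan_div_at_bot:
  "(a::real) > 0 \<Longrightarrow> filterlim x at_bot F \<Longrightarrow> ((\<lambda>t. arctan (x t / a) / a) \<longlongrightarrow> - (pi / (2 * a))) F"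
  using tendsto_minus[OF tendsto_arctan_div_at_top[of a "\<lambda>t. - x t" F]]
  by (simp add: filterlim_uminus_at_bot arctan_minus)

text \<open>The square root lies between x^2 + b^2 and x^2 + a^2. Hence arctan(x/a)/a grows at a
  rate of at most c and arctan(x/b)/b at a rate of at least c, while their total increases are
  \<pi>/a and \<pi>/b.\<close>

lemma agm_flow_bounds:
  assumes flow: "agm_flow a b c x p q" and ab: "0 < b" "b \<le> a" and c: "0 < c"
  shows "pi / a \<le> c * (q - p)" "c * (q - p) \<le> pi / b"
proof -
  let ?S = "\<lambda>t. sqrt (((x t)\<^sup>2 + a\<^sup>2) * ((x t)\<^sup>2 + b\<^sup>2))"
  have pq: "p < q" and bot: "filterlim x at_bot (at_right p)" and top: "filterlim x at_top (at_left q)"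
    and der: "\<And>t. p < t \<Longrightarrow> t < q \<Longrightarrow> (x has_real_derivative c * ?S t) (at t)"
    using flow by (auto simp: agm_flow_def)
  have a: "0 < a" using ab by simp
  have pos: "0 < (x t)\<^sup>2 + b\<^sup>2" "0 < (x t)\<^sup>2 + a\<^sup>2" "(x t)\<^sup>2 + b\<^sup>2 \<le> (x t)\<^sup>2 + a\<^sup>2" for t
    using ab by (auto simp: sum_power2_gt_zero_iff power_mono)
  have D: "((\<lambda>t. arctan (x t / d) / d) has_real_derivative c * ?S t / ((x t)\<^sup>2 + d\<^sup>2)) (at t)"
    if "p < t" "t < q" "0 < d" for t d
  proof -
    have "((\<lambda>t. arctan (x t / d) / d) has_real_derivative
        inverse (1 + (x t / d)\<^sup>2) * (c * ?S t / d) / d) (at t)"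
      using that by (auto intro!: derivative_eq_intros der)
    moreover have "1 + (x t / d)\<^sup>2 = ((x t)\<^sup>2 + d\<^sup>2) / d\<^sup>2"
      using that by (simp add: power_divide add_divide_distrib)
    then have "inverse (1 + (x t / d)\<^sup>2) * (c * ?S t / d) / d = c * ?S t / ((x t)\<^sup>2 + d\<^sup>2)"
      using that by (simp add: power2_eq_square[of d])
    ultimately show ?thesis by simp
  qed
  have S1: "?S t \<le> (x t)\<^sup>2 + a\<^sup>2" for t
    by (rule real_le_lsqrt) (use pos[of t] in \<open>auto simp: power2_eq_square[of "_ + _"] intro!: mult_left_mono\<close>)
  have S2: "(x t)\<^sup>2 + b\<^sup>2 \<le> ?S t" for t
    by (rule real_le_rsqrt) (use pos[of t] in \<open>auto simp: power2_eq_square[of "_ + _"] intro!: mult_right_mono\<close>)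
  have idr: "((\<lambda>t. c * t) \<longlongrightarrow> c * r) (at r within A)" for r A
    by (intro tendsto_intros)
  have "c * p - (- (pi / (2 * a))) \<le> c * q - pi / (2 * a)"
  proof (rule mono_limits_le[OF pq, where g' = "\<lambda>t. c - c * ?S t / ((x t)\<^sup>2 + a\<^sup>2)"])
    show "((\<lambda>t. c * t - arctan (x t / a) / a) has_real_derivative c - c * ?S t / ((x t)\<^sup>2 + a\<^sup>2)) (at t)"
      if "p < t" "t < q" for t
      by (intro DERIV_diff DERIV_cmult_Id D that a)
    show "0 \<le> c - c * ?S t / ((x t)\<^sup>2 + a\<^sup>2)" if "p < t" "t < q" for t
      using mult_left_mono[OF S1[of t], of c] pos[of t] c by (simp add: pos_divide_le_eq)
  qed (intro tendsto_diff idr tendsto_arctan_div_at_bot tendsto_arctan_div_at_top bot top a)+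
  then show "pi / a \<le> c * (q - p)" by (simp add: algebra_simps)
  have "- (pi / (2 * b)) - c * p \<le> pi / (2 * b) - c * q"
  proof (rule mono_limits_le[OF pq, where g' = "\<lambda>t. c * ?S t / ((x t)\<^sup>2 + b\<^sup>2) - c"])
    show "((\<lambda>t. arctan (x t / b) / b - c * t) has_real_derivative c * ?S t / ((x t)\<^sup>2 + b\<^sup>2) - c) (at t)"
      if "p < t" "t < q" for t
      by (intro DERIV_diff DERIV_cmult_Id D that ab)
    show "0 \<le> c * ?S t / ((x t)\<^sup>2 + b\<^sup>2) - c" if "p < t" "t < q" for t
      using mult_left_mono[OF S2[of t], of c] pos[of t] c by (simp add: pos_le_divide_eq)
  qed (intro tendsto_diff idr tendsto_arctan_div_at_bot tendsto_arctan_div_at_top bot top ab)+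
  then show "c * (q - p) \<le> pi / b" by (simp add: algebra_simps)
qed

text \<open>The second factor for u is a perfect square, \<open>e2\<close>, and the first is the old
  product over (2x)^2, \<open>e1\<close>. So the new square root is S (x^2 + ab) / (4 x^2), and u' =
  c S (x^2 + ab) / (2 x^2) is exactly 2c times it. The sign of c is left open, so decreasing
  solutions are covered.\<close>

lemma landen_derivative:
  fixes x :: "real \<Rightarrow> real"
  assumes x: "(x has_real_derivative c * sqrt (((x t)\<^sup>2 + a\<^sup>2) * ((x t)\<^sup>2 + b\<^sup>2))) (at t)"
    and nz: "x t \<noteq> 0" and ab: "0 < a" "0 < b"
  defines "u \<equiv> \<lambda>t. (x t - a * b / x t) / 2"
  shows "(u has_real_derivative
    2 * c * sqrt (((u t)\<^sup>2 + ((a + b) / 2)\<^sup>2) * ((u t)\<^sup>2 + (sqrt (a * b))\<^sup>2))) (at t)"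
proof -
  define X where "X = x t"
  define S where "S = sqrt ((X\<^sup>2 + a\<^sup>2) * (X\<^sup>2 + b\<^sup>2))"
  have X: "X \<noteq> 0" using nz by (simp add: X_def)
  have u: "(u has_real_derivative (c * S - a * b * (- (c * S / X\<^sup>2))) / 2) (at t)"
    unfolding u_def S_def X_def using x nz
    by (auto intro!: derivative_eq_intros simp: power2_eq_square)
  have e1: "(u t)\<^sup>2 + ((a + b) / 2)\<^sup>2 = (X\<^sup>2 + a\<^sup>2) * (X\<^sup>2 + b\<^sup>2) / (2 * X)\<^sup>2"
    using X unfolding u_def X_def[symmetric] by (simp add: field_simps power2_eq_square)
  have e2: "(u t)\<^sup>2 + (sqrt (a * b))\<^sup>2 = ((X\<^sup>2 + a * b) / (2 * X))\<^sup>2"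
    using X ab unfolding u_def X_def[symmetric] by (simp add: field_simps power2_eq_square)
  have "sqrt (((u t)\<^sup>2 + ((a + b) / 2)\<^sup>2) * ((u t)\<^sup>2 + (sqrt (a * b))\<^sup>2)) =
      S / \<bar>2 * X\<bar> * \<bar>(X\<^sup>2 + a * b) / (2 * X)\<bar>"
    by (simp only: e1 e2) (simp only: real_sqrt_mult[of "_ / _"] real_sqrt_divide real_sqrt_abs S_def)
  also have "\<dots> = S * (X\<^sup>2 + a * b) / (4 * X\<^sup>2)"
  proof -
    have "0 < X\<^sup>2 + a * b" using ab by (simp add: add_nonneg_pos)
    then show ?thesis using X by (simp add: abs_mult power2_eq_square)
  qed
  finally have "2 * c * sqrt (((u t)\<^sup>2 + ((a + b) / 2)\<^sup>2) * ((u t)\<^sup>2 + (sqrt (a * b))\<^sup>2)) =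
     (c * S - a * b * (- (c * S / X\<^sup>2))) / 2"
    using X by (simp add: field_simps)
  then show ?thesis using u by (simp only:)
qed

text \<open>The pole of d/x at 0 is what opens a half line of x up into a full line of u.\<close>

lemma landen_limits:
  fixes x :: "real \<Rightarrow> real"
  assumes d: "0 < (d::real)"
  shows "filterlim x at_top F \<Longrightarrow> filterlim (\<lambda>t. (x t - d / x t) / 2) at_top F"
    and "filterlim x at_bot F \<Longrightarrow> filterlim (\<lambda>t. (x t - d / x t) / 2) at_bot F"
    and "filterlim x (at_right 0) F \<Longrightarrow> filterlim (\<lambda>t. (x t - d / x t) / 2) at_bot F"
    and "filterlim x (at_left 0) F \<Longrightarrow> filterlim (\<lambda>t. (x t - d / x t) / 2) at_top F"
proof -
  have 1: "filterlim (\<lambda>y. (y - d / y) / 2) at_top at_top"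
    "filterlim (\<lambda>y. (y - d / y) / 2) at_bot at_bot"
    "filterlim (\<lambda>y. (y - d / y) / 2) at_bot (at_right 0)"
    "filterlim (\<lambda>y. (y - d / y) / 2) at_top (at_left 0)"
    using d by real_asymp+
  show "filterlim x at_top F \<Longrightarrow> filterlim (\<lambda>t. (x t - d / x t) / 2) at_top F"
    and "filterlim x at_bot F \<Longrightarrow> filterlim (\<lambda>t. (x t - d / x t) / 2) at_bot F"
    and "filterlim x (at_right 0) F \<Longrightarrow> filterlim (\<lambda>t. (x t - d / x t) / 2) at_bot F"
    and "filterlim x (at_left 0) F \<Longrightarrow> filterlim (\<lambda>t. (x t - d / x t) / 2) at_top F"
    using 1[THEN filterlim_compose] by auto
qed

text \<open>The trajectory is strictly increasing and runs from -infinity to infinity, so it has a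
  single zero r. The same u serves on both sides of r.\<close>

lemma agm_flow_split:
  assumes flow: "agm_flow a b c x p q" and ab: "0 < b" "b \<le> a" and c: "0 < c"
  obtains u r where "agm_flow ((a + b) / 2) (sqrt (a * b)) (2 * c) u p r"
    "agm_flow ((a + b) / 2) (sqrt (a * b)) (2 * c) u r q"
proof -
  let ?S = "\<lambda>t. sqrt (((x t)\<^sup>2 + a\<^sup>2) * ((x t)\<^sup>2 + b\<^sup>2))"
  have pq: "p < q" and bot: "filterlim x at_bot (at_right p)" and top: "filterlim x at_top (at_left q)"
    and der: "\<And>t. p < t \<Longrightarrow> t < q \<Longrightarrow> (x has_real_derivative c * ?S t) (at t)"
    using flow by (auto simp: agm_flow_def)
  have pos: "0 < c * ?S t" for t
    using ab c by (auto intro!: mult_pos_pos simp: sum_power2_gt_zero_iff)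
  have mono: "x s < x t" if "p < s" "s < t" "t < q" for s t
    using that by (intro DERIV_pos_imp_increasing[of s t x]) (auto intro!: exI[of _ "c * ?S _"] der pos)
  define m where "m = (p + q) / 2"
  have m: "p < m" "m < q" using pq by (auto simp: m_def)
  obtain s where s: "p < s" "s < q" "x s < 0"
  proof -
    have "eventually (\<lambda>t. x t < 0) (at_right p)" using bot by (simp add: filterlim_at_bot_dense)
    then obtain e where "e > p" "\<forall>y>p. y < e \<longrightarrow> x y < 0"
      unfolding eventually_at_right[OF pq] by blast
    then show ?thesis using that[of "(p + min e q) / 2"] pq by (auto simp: min_def split: if_splits)
  qed
  obtain s' where s': "p < s'" "s' < q" "x s' > 0"
  proof -
    have "eventually (\<lambda>t. x t > 0) (at_left q)" using top by (simp add: filterlim_at_top_dense)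
    then obtain e where "e < q" "\<forall>y>e. y < q \<longrightarrow> x y > 0"
      unfolding eventually_at_left[OF pq] by blast
    then show ?thesis using that[of "(max e p + q) / 2"] pq by (auto simp: max_def split: if_splits)
  qed
  have ss: "s \<le> s'"
    using mono[of s' s] s s' by linarith
  have "\<exists>r\<ge>s. r \<le> s' \<and> x r = 0"
    using s s' ss by (intro IVT) (auto intro!: DERIV_isCont der)
  then obtain r where "s \<le> r" "r \<le> s'" "x r = 0" by blast
  then have r: "p < r" "r < q" "x r = 0" using s s' by simp_all
  have neg: "x t < 0" if "p < t" "t < r" for t using mono[of t r] that r by auto
  have ps: "x t > 0" if "r < t" "t < q" for t using mono[of r t] that r by auto
  have cont: "isCont x r" using der r by (blast intro: DERIV_isCont)
  then have lim: "(x \<longlongrightarrow> 0) (at r)" by (simp add: isCont_def r)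
  have "eventually (\<lambda>t. x t \<in> {0<..} \<and> x t \<noteq> 0) (at_right r)"
    unfolding eventually_at_right[OF r(2)] using ps r by (intro exI[of _ q]) force
  then have R: "filterlim x (at_right 0) (at_right r)"
    using tendsto_mono[OF at_le lim] by (simp add: filterlim_at)
  have "eventually (\<lambda>t. x t \<in> {..<0} \<and> x t \<noteq> 0) (at_left r)"
    unfolding eventually_at_left[OF r(1)] using neg r by (intro exI[of _ p]) force
  then have L: "filterlim x (at_left 0) (at_left r)"
    using tendsto_mono[OF at_le lim] by (simp add: filterlim_at)
  define u where "u = (\<lambda>t. (x t - a * b / x t) / 2)"
  have d: "0 < a * b" using ab by simp
  show ?thesis
  proof (rule that[of u r])
    have D: "(u has_real_derivative
      2 * c * sqrt (((u t)\<^sup>2 + ((a + b) / 2)\<^sup>2) * ((u t)\<^sup>2 + (sqrt (a * b))\<^sup>2))) (at t)"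
      if "p < t" "t < q" "t \<noteq> r" for t
      unfolding u_def
      by (intro landen_derivative der) (use that ab neg[of t] ps[of t] in \<open>auto simp: neq_iff\<close>)
    show "agm_flow ((a + b) / 2) (sqrt (a * b)) (2 * c) u p r"
      unfolding agm_flow_def using D r landen_limits[OF d] bot L by (auto simp: u_def)
    show "agm_flow ((a + b) / 2) (sqrt (a * b)) (2 * c) u r q"
      unfolding agm_flow_def using D r landen_limits[OF d] top R by (auto simp: u_def)
  qed
qed

text \<open>The quantities for the two halves, 2c(r - p) and 2c(q - r), have the average c(q - p).
  Both obey the bounds for the means, hence so does their average, wherever r lies.\<close>

lemma agm_flow_iter_bounds:
  assumes "agm_flow a b c x p q" "0 < b" "b \<le> a" "0 < c"
  shows "pi / fst (agm_iter a b k) \<le> c * (q - p) \<and> c * (q - p) \<le> pi / snd (agm_iter a b k)"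
  using assms
proof (induction k arbitrary: a b c x p q)
  case 0
  then show ?case using agm_flow_bounds[OF 0] by simp
next
  case (Suc k)
  obtain u r where u: "agm_flow ((a + b) / 2) (sqrt (a * b)) (2 * c) u p r"
    "agm_flow ((a + b) / 2) (sqrt (a * b)) (2 * c) u r q"
    using agm_flow_split[OF Suc.prems] by blast
  note g = gm_le_am[OF Suc.prems(2,3)]
  have "0 < 2 * c" using Suc.prems by simp
  from Suc.IH[OF u(1) g(3,2) this] Suc.IH[OF u(2) g(3,2) this]
  show ?case unfolding agm_iter_Suc_left by (auto simp: algebra_simps)
qed

theorem agm_flow_period:
  assumes "agm_flow a b c x p q" "0 < b" "b \<le> a" "0 < c"
  shows "c * (q - p) * agm a b = pi"
proof -
  note pos = agm_pos[OF assms(2,3)]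
  have "(\<lambda>k. pi / fst (agm_iter a b k)) \<longlonglongrightarrow> pi / agm a b"
    "(\<lambda>k. pi / snd (agm_iter a b k)) \<longlonglongrightarrow> pi / agm a b"
    using pos by (auto intro!: tendsto_intros agm_iter_tendsto assms)
  then have "pi / agm a b \<le> c * (q - p)" "c * (q - p) \<le> pi / agm a b"
    using agm_flow_iter_bounds[OF assms] by (auto intro: LIMSEQ_le_const LIMSEQ_le_const2)
  with pos show ?thesis by (simp add: field_simps)
qed

section \<open>Riemann surfaces uniformized by the plane\<close>

lemma complex_chartD:
  assumes "complex_chart X U \<phi>"
  shows "openin X U" "open (\<phi> ` U)" "inj_on \<phi> U" "U \<subseteq> topspace X"
proof -
  show "openin X U" "open (\<phi> ` U)" using assms by (auto simp: complex_chart_def)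
  then show "U \<subseteq> topspace X" by (simp add: openin_subset)
  then have "topspace (subtopology X U) = U" by auto
  then show "inj_on \<phi> U"
    using assms homeomorphic_imp_injective_map by (force simp: complex_chart_def)
qed

lemma open_preimage_continuous_map:
  assumes "continuous_map euclidean X q" "openin X U"
  shows "open {z. q z \<in> U}"
  using openin_continuous_map_preimage[OF assms] by simp

text \<open>Near a point the inverse of the chart \<open>\<phi>\<close> factors as \<open>q\<close>
  after a holomorphic function \<open>g\<close>. The open set \<open>O'\<close> allows the
  neighbourhood to be shrunk, later into the preimage of a second chart.\<close>

lemma locally_inj_inverse_holomorphic:
  assumes q: "continuous_map euclidean X q"
    and inj: "open D" "z0 \<in> D" "inj_on q D"
    and chart: "openin X U" "inj_on \<phi> U" "q z0 \<in> U"
    and hol: "(\<phi> \<circ> q) holomorphic_on {z. q z \<in> U}"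
    and O: "open O'" "z0 \<in> O'"
  obtains D' g where "open D'" "z0 \<in> D'" "D' \<subseteq> O'" "D' \<subseteq> {z. q z \<in> U}" "open (\<phi> ` q ` D')"
    "g holomorphic_on (\<phi> ` q ` D')" "\<And>z. z \<in> D' \<Longrightarrow> g (\<phi> (q z)) = z"
    "\<And>z. z \<in> D' \<Longrightarrow> inv_into U \<phi> (\<phi> (q z)) = q z"
proof -
  define D' where "D' = D \<inter> {z. q z \<in> U} \<inter> O'"
  have D': "open D'" "z0 \<in> D'" "D' \<subseteq> {z. q z \<in> U}" "D' \<subseteq> O'"
    using inj chart O open_preimage_continuous_map[OF q chart(1)] by (auto simp: D'_def)
  have hol': "(\<phi> \<circ> q) holomorphic_on D'"
    using hol D'(3) by (rule holomorphic_on_subset)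
  have inj': "inj_on (\<phi> \<circ> q) D'"
  proof (rule comp_inj_on)
    show "inj_on q D'" using inj(3) by (rule inj_on_subset) (auto simp: D'_def)
    show "inj_on \<phi> (q ` D')" using chart(2) by (rule inj_on_subset) (use D'(3) in auto)
  qed
  obtain g where g: "g holomorphic_on ((\<phi> \<circ> q) ` D')" "\<And>z. z \<in> D' \<Longrightarrow> g ((\<phi> \<circ> q) z) = z"
    using holomorphic_has_inverse[OF hol' D'(1) inj'] by metis
  have "open ((\<phi> \<circ> q) ` D')" by (rule open_mapping_thm3[OF hol' D'(1) inj'])
  then show thesis
  proof (intro that[OF D'(1,2,4,3), of g])
    show "inv_into U \<phi> (\<phi> (q z)) = q z" if "z \<in> D'" for z
      using that D'(3) by (intro inv_into_f_f chart) auto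
  qed (use g in \<open>simp_all add: image_comp\<close>)
qed

text \<open>Holomorphy in charts can be tested after pulling back along a locally injective
  covering of the surface by the plane.\<close>

lemma holomorphic_in_charts:
  assumes q: "continuous_map euclidean X q" "topspace X \<subseteq> range q"
    and inj: "\<And>z. \<exists>D. open D \<and> z \<in> D \<and> inj_on q D"
    and chart: "openin X U" "inj_on \<phi> U" "(\<phi> \<circ> q) holomorphic_on {z. q z \<in> U}"
    and r: "continuous_map euclidean Y r" "openin Y V" "(\<psi> \<circ> r) holomorphic_on {z. r z \<in> V}"
    and f: "\<And>z. f (q z) = r z"
  shows "(\<psi> \<circ> f \<circ> inv_into U \<phi>) holomorphic_on \<phi> ` {p \<in> U. f p \<in> V}"
  unfolding holomorphic_on_def
proof
  fix w assume "w \<in> \<phi> ` {p \<in> U. f p \<in> V}"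
  then obtain p where p: "p \<in> U" "f p \<in> V" "w = \<phi> p" by auto
  obtain z0 where z0: "p = q z0" using p(1) openin_subset[OF chart(1)] q(2) by auto
  obtain D where D: "open D" "z0 \<in> D" "inj_on q D" using inj by blast
  have V: "open {z. r z \<in> V}" by (rule open_preimage_continuous_map[OF r(1,2)])
  have "q z0 \<in> U" "z0 \<in> {z. r z \<in> V}" using p z0 f by auto
  then obtain D' g where D': "open D'" "z0 \<in> D'" "D' \<subseteq> {z. r z \<in> V}" "D' \<subseteq> {z. q z \<in> U}"
      "open (\<phi> ` q ` D')" "g holomorphic_on (\<phi> ` q ` D')" "\<And>z. z \<in> D' \<Longrightarrow> g (\<phi> (q z)) = z"
      "\<And>z. z \<in> D' \<Longrightarrow> inv_into U \<phi> (\<phi> (q z)) = q z"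
    by (rule locally_inj_inverse_holomorphic[OF q(1) D chart(1,2) _ chart(3) V]) (rule that)
  have "(\<psi> \<circ> r \<circ> g) holomorphic_on (\<phi> ` q ` D')"
    by (rule holomorphic_on_compose_gen[OF D'(6), of _ "D'"])
       (use D' holomorphic_on_subset[OF r(3)] in auto)
  moreover have "(\<psi> \<circ> f \<circ> inv_into U \<phi>) u = (\<psi> \<circ> r \<circ> g) u" if "u \<in> \<phi> ` q ` D'" for u
    using that D'(7,8) f by auto
  ultimately have "(\<psi> \<circ> f \<circ> inv_into U \<phi>) holomorphic_on (\<phi> ` q ` D')"
    by (simp cong: holomorphic_cong)
  moreover have "w \<in> \<phi> ` q ` D'" using p z0 D'(2) by auto
  ultimately have "(\<psi> \<circ> f \<circ> inv_into U \<phi>) field_differentiable at w"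
    using D'(5) holomorphic_on_imp_differentiable_at by blast
  then show "(\<psi> \<circ> f \<circ> inv_into U \<phi>) field_differentiable (at w within \<phi> ` {p \<in> U. f p \<in> V})"
    by (rule field_differentiable_at_within)
qed

text \<open>Continuity of \<open>\<phi>\<close> downstairs comes from openness of \<open>q\<close>,
  and its openness from the open mapping theorem for the composite \<open>\<phi> \<circ> q\<close>
  upstairs.\<close>

lemma complex_chart_of_holomorphic:
  assumes q: "continuous_map euclidean X q" "open_map euclidean X q"
    and D: "open D" "inj_on (\<phi> \<circ> q) D" "(\<phi> \<circ> q) holomorphic_on D"
  shows "complex_chart X (q ` D) \<phi>"
proof -
  have op: "openin X (q ` B)" if "open B" for B
    using q(2) that by (simp add: open_map_def)
  have sub: "q ` D \<subseteq> topspace X" using op[OF D(1)] by (rule openin_subset)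
  have opD: "open ((\<phi> \<circ> q) ` B)" if "open B" "B \<subseteq> D" for B
    using D that by (intro open_mapping_thm3[of _ B]) (auto intro: holomorphic_on_subset inj_on_subset)
  have inj: "inj_on \<phi> (q ` D)" using D(2) by (rule inj_on_imageI)
  have ts: "topspace (subtopology X (q ` D)) = q ` D" using sub by auto
  have "homeomorphic_map (subtopology X (q ` D)) (top_of_set (\<phi> ` q ` D)) \<phi>"
  proof (rule bijective_open_imp_homeomorphic_map)
    show "continuous_map (subtopology X (q ` D)) (top_of_set (\<phi> ` q ` D)) \<phi>"
    proof (intro continuous_map_into_subtopology)
      show "continuous_map (subtopology X (q ` D)) euclidean \<phi>"
        unfolding continuous_map_def
      proof (intro conjI allI impI)
        fix O' :: "complex set" assume "openin euclidean O'"
        then have "open O'" by simp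
        have "open {z \<in> D. (\<phi> \<circ> q) z \<in> O'}"
          using continuous_open_preimage[OF holomorphic_on_imp_continuous_on[OF D(3)] D(1) \<open>open O'\<close>]
          by (simp add: vimage_def Int_def)
        then have "openin X (q ` {z \<in> D. (\<phi> \<circ> q) z \<in> O'})" by (rule op)
        moreover have "q ` {z \<in> D. (\<phi> \<circ> q) z \<in> O'} = {x \<in> q ` D. \<phi> x \<in> O'}" by auto
        ultimately show "openin (subtopology X (q ` D)) {x \<in> topspace (subtopology X (q ` D)). \<phi> x \<in> O'}"
          unfolding ts by (metis (no_types, lifting) openin_subtopology Int_absorb2 mem_Collect_eq subsetI)
      qed auto
    qed (auto simp: ts)
    show "open_map (subtopology X (q ` D)) (top_of_set (\<phi> ` q ` D)) \<phi>"
      unfolding open_map_def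
    proof (intro allI impI)
      fix B assume "openin (subtopology X (q ` D)) B"
      then have B: "openin X B" "B \<subseteq> q ` D"
        using openin_open_subtopology[OF op[OF D(1)]] by auto
      have "open {z \<in> D. q z \<in> B}"
        using open_preimage_continuous_map[OF q(1) B(1)] D(1) by (auto simp: Collect_conj_eq)
      then have "open ((\<phi> \<circ> q) ` {z \<in> D. q z \<in> B})" by (rule opD) auto
      moreover have "(\<phi> \<circ> q) ` {z \<in> D. q z \<in> B} = \<phi> ` B" using B(2) by force
      ultimately show "openin (top_of_set (\<phi> ` q ` D)) (\<phi> ` B)"
        using B(2) by (intro open_subset) auto
    qed
  qed (use inj ts in auto)
  then show ?thesis
    using op[OF D(1)] opD[OF D(1)] by (simp add: complex_chart_def image_comp)
qed

text \<open>A plane model of an atlas: every chart becomes a holomorphic function on an open set of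
  the plane. If two surfaces have such models, any continuous map intertwining them is
  holomorphic.\<close>

definition uniformizes :: "(complex \<Rightarrow> 'a) \<Rightarrow> 'a topology \<Rightarrow> ('a set \<times> ('a \<Rightarrow> complex)) set \<Rightarrow> bool" where
  "uniformizes q X A \<longleftrightarrow>
     continuous_map euclidean X q \<and> topspace X = range q \<and>
     (\<forall>z. \<exists>D. open D \<and> z \<in> D \<and> inj_on q D) \<and>
     (\<forall>(U, \<phi>)\<in>A. complex_chart X U \<phi> \<and> (\<phi> \<circ> q) holomorphic_on {z. q z \<in> U})"

lemma holomorphic_map_uniformized:
  assumes q: "uniformizes q X A" and r: "uniformizes r Y B"
    and f: "continuous_map X Y f" "\<And>z. f (q z) = r z"
  shows "holomorphic_map X A Y B f"
  unfolding holomorphic_map_def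
proof (intro conjI f(1) ballI, safe)
  fix U \<phi> V \<psi> assume "(U, \<phi>) \<in> A" "(V, \<psi>) \<in> B"
  then have "complex_chart X U \<phi>" "(\<phi> \<circ> q) holomorphic_on {z. q z \<in> U}"
     "complex_chart Y V \<psi>" "(\<psi> \<circ> r) holomorphic_on {z. r z \<in> V}"
    using q r by (auto simp: uniformizes_def)
  then show "(\<psi> \<circ> f \<circ> inv_into U \<phi>) holomorphic_on \<phi> ` {p \<in> U. f p \<in> V}"
    using q r f(2)
    by (intro holomorphic_in_charts[where q = q and r = r and X = X and Y = Y])
       (auto simp: uniformizes_def complex_chartD)
qed

lemma riemann_surface_uniformized:
  assumes q: "uniformizes q X A" and haus: "Hausdorff_space X"
    and cover: "\<And>z. \<exists>(U, \<phi>)\<in>A. q z \<in> U"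
  shows "riemann_surface X A"
  unfolding riemann_surface_def
proof (intro conjI)
  have "connectedin X (q ` UNIV)"
    by (rule connectedin_continuous_map_image[of euclidean])
       (use q in \<open>auto simp: uniformizes_def connected_UNIV\<close>)
  then show "connected_space X" using q by (simp add: uniformizes_def connectedin_topspace[symmetric])
  have charts: "\<And>U \<phi>. (U, \<phi>) \<in> A \<Longrightarrow> complex_chart X U \<phi>"
    using q by (auto simp: uniformizes_def)
  then show "\<forall>(U, \<phi>)\<in>A. complex_chart X U \<phi>" by auto
  have "(\<Union>(U, \<phi>)\<in>A. U) \<subseteq> topspace X"
    using complex_chartD(4)[OF charts] by fastforce
  moreover have "topspace X \<subseteq> (\<Union>(U, \<phi>)\<in>A. U)"
    using q cover by (fastforce simp: uniformizes_def)
  ultimately show "(\<Union>(U, \<phi>)\<in>A. U) = topspace X" by blast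
  \<comment> \<open>Transition maps are the chart expressions of the identity map.\<close>
  have "holomorphic_map X A X A (\<lambda>x. x)"
    by (rule holomorphic_map_uniformized[OF q q]) auto
  then show "\<forall>(U, \<phi>)\<in>A. \<forall>(V, \<psi>)\<in>A. (\<psi> \<circ> inv_into U \<phi>) holomorphic_on \<phi> ` (U \<inter> V)"
    by (simp add: holomorphic_map_def o_def Int_def)
qed (rule haus)

section \<open>The Weierstrass function of a square lattice\<close>

text \<open>One-dimensional majorant: a product of two of these series dominates the sum over the
  lattice. The shift by 1 keeps the term at 0 harmless.\<close>

lemma summable_on_int_powr:
  fixes s :: real
  assumes "s < -1"
  shows "(\<lambda>a::int. (1 + \<bar>of_int a\<bar>) powr s) summable_on UNIV"
proof -
  have "summable (\<lambda>n. real (Suc n) powr s)"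
    using assms by (subst summable_Suc_iff) (simp add: summable_real_powr_iff)
  then have nat: "(\<lambda>n::nat. (1 + real n) powr s) summable_on UNIV"
    by (subst summable_on_UNIV_nonneg_real_iff) (auto simp: add_ac)
  have "(\<lambda>a::int. (1 + \<bar>of_int a\<bar>) powr s) summable_on range int"
    using nat by (subst summable_on_reindex) (auto simp: o_def inj_on_def)
  moreover have "(\<lambda>a::int. (1 + \<bar>of_int a\<bar>) powr s) summable_on range (\<lambda>n. - int n)"
    using nat by (subst summable_on_reindex) (auto simp: o_def inj_on_def)
  moreover have "UNIV = range int \<union> range (\<lambda>n. - int n)"
    by (auto intro: int_cases2)
  ultimately show ?thesis using summable_on_union by metis
qed

section \<open>The lattice: symmetries, discreteness and a fundamental square\<close>

locale square_lattice =
  fixes \<omega> :: real and \<Lambda> :: "complex set"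
  assumes \<omega>_pos: "0 < \<omega>" and lattice_eq: "\<Lambda> = (\<lambda>w. of_real \<omega> * w) ` gaussian_integers"
begin

lemma lattice_iff: "l \<in> \<Lambda> \<longleftrightarrow> (\<exists>a b. l = of_real \<omega> * (of_int a + \<i> * of_int b))"
  by (auto simp: lattice_eq gaussian_integers_def)

lemma lattice_range: "\<Lambda> = range (\<lambda>(a, b). of_real \<omega> * (of_int a + \<i> * of_int b))"
proof (intro Set.set_eqI iffI)
  fix l assume "l \<in> \<Lambda>"
  then obtain a b where "l = of_real \<omega> * (of_int a + \<i> * of_int b)" unfolding lattice_iff by blast
  then show "l \<in> range (\<lambda>(a, b). of_real \<omega> * (of_int a + \<i> * of_int b))"
    by (intro range_eqI[of _ _ "(a, b)"]) (simp only: prod.case)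
next
  fix l assume "l \<in> range (\<lambda>(a, b). of_real \<omega> * (of_int a + \<i> * of_int b) :: complex)"
  then show "l \<in> \<Lambda>" unfolding lattice_iff by (elim imageE) (simp only: split_beta, blast)
qed

lemma lattice_0 [simp, intro]: "0 \<in> \<Lambda>"
  by (auto simp: lattice_iff intro: exI[of _ 0])

lemma lattice_add: "l \<in> \<Lambda> \<Longrightarrow> m \<in> \<Lambda> \<Longrightarrow> l + m \<in> \<Lambda>"
proof -
  assume "l \<in> \<Lambda>" "m \<in> \<Lambda>"
  then obtain a b c d where "l = of_real \<omega> * (of_int a + \<i> * of_int b)"
    "m = of_real \<omega> * (of_int c + \<i> * of_int d)" by (auto simp: lattice_iff)
  then have "l + m = of_real \<omega> * (of_int (a + c) + \<i> * of_int (b + d))"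
    by (simp add: algebra_simps)
  then show ?thesis unfolding lattice_iff by blast
qed

lemma lattice_times_ii: "l \<in> \<Lambda> \<Longrightarrow> \<i> * l \<in> \<Lambda>"
proof -
  assume "l \<in> \<Lambda>"
  then obtain a b where "l = of_real \<omega> * (of_int a + \<i> * of_int b)" by (auto simp: lattice_iff)
  then have "\<i> * l = of_real \<omega> * (of_int (- b) + \<i> * of_int a)" by (simp add: algebra_simps)
  then show ?thesis unfolding lattice_iff by blast
qed

lemma lattice_cnj: "l \<in> \<Lambda> \<Longrightarrow> cnj l \<in> \<Lambda>"
proof -
  assume "l \<in> \<Lambda>"
  then obtain a b where "l = of_real \<omega> * (of_int a + \<i> * of_int b)" by (auto simp: lattice_iff)
  then have "cnj l = of_real \<omega> * (of_int a + \<i> * of_int (- b))" by (simp add: algebra_simps)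
  then show ?thesis unfolding lattice_iff by blast
qed

lemma lattice_minus: "l \<in> \<Lambda> \<Longrightarrow> - l \<in> \<Lambda>"
  using lattice_times_ii[OF lattice_times_ii, of l] by (simp flip: mult.assoc)

lemma lattice_diff: "l \<in> \<Lambda> \<Longrightarrow> m \<in> \<Lambda> \<Longrightarrow> l - m \<in> \<Lambda>"
  using lattice_add[of l "- m"] lattice_minus by simp

lemma lattice_minus_iff [simp]: "- l \<in> \<Lambda> \<longleftrightarrow> l \<in> \<Lambda>"
  using lattice_minus[of l] lattice_minus[of "- l"] by auto

lemma lattice_times_ii_iff [simp]: "\<i> * l \<in> \<Lambda> \<longleftrightarrow> l \<in> \<Lambda>"
  using lattice_times_ii[of l] lattice_minus[OF lattice_times_ii[of "\<i> * l"]]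
  by (auto simp flip: mult.assoc)

lemma lattice_cnj_iff [simp]: "cnj l \<in> \<Lambda> \<longleftrightarrow> l \<in> \<Lambda>"
  using lattice_cnj[of l] lattice_cnj[of "cnj l"] by auto

lemma lattice_add_iff: "l \<in> \<Lambda> \<Longrightarrow> z + l \<in> \<Lambda> \<longleftrightarrow> z \<in> \<Lambda>"
  using lattice_add[of z l] lattice_diff[of "z + l" l] by auto

lemma lattice_norm_ge:
  assumes "l \<in> \<Lambda>" "l \<noteq> 0"
  shows "\<omega> \<le> norm l"
proof -
  obtain a b where l: "l = of_real \<omega> * (of_int a + \<i> * of_int b)"
    using assms by (auto simp: lattice_iff)
  then have "a \<noteq> 0 \<or> b \<noteq> 0" using assms(2) by auto
  then have "1 \<le> \<bar>a\<bar> \<or> 1 \<le> \<bar>b\<bar>" by linarith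
  then have "1 \<le> norm (of_int a + \<i> * of_int b :: complex)"
    using abs_Re_le_cmod[of "of_int a + \<i> * of_int b"] abs_Im_le_cmod[of "of_int a + \<i> * of_int b"]
    by fastforce
  then show ?thesis using \<omega>_pos by (simp add: l norm_mult)
qed

lemma lattice_ball: "l \<in> \<Lambda> \<Longrightarrow> l \<in> ball 0 \<omega> \<Longrightarrow> l = 0"
  using lattice_norm_ge[of l] by auto

lemma closed_lattice_subset: "S \<subseteq> \<Lambda> \<Longrightarrow> closed S"
proof (rule discrete_imp_closed[OF \<omega>_pos], intro ballI impI)
  fix x y assume "S \<subseteq> \<Lambda>" "x \<in> S" "y \<in> S" "dist y x < \<omega>"
  then show "y = x"
    using lattice_norm_ge[of "y - x"] lattice_diff[of y x] by (auto simp: dist_norm)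
qed

lemma open_compl_lattice: "open (- \<Lambda>)" and open_compl_lattice0: "open (- (\<Lambda> - {0}))"
  by (rule open_Compl, rule closed_lattice_subset, blast)+

lemma countable_lattice: "countable \<Lambda>"
proof -
  show ?thesis unfolding lattice_range by (rule countable_image) simp
qed

lemma lattice_translate:
  obtains l where "l \<in> \<Lambda>" "z - l \<in> cbox 0 (Complex \<omega> \<omega>)"
proof -
  define a where "a = \<lfloor>Re z / \<omega>\<rfloor>"
  define b where "b = \<lfloor>Im z / \<omega>\<rfloor>"
  define l where "l = of_real \<omega> * (of_int a + \<i> * of_int b)"
  have "of_int a \<le> Re z / \<omega>" "Re z / \<omega> < of_int a + 1" "of_int b \<le> Im z / \<omega>" "Im z / \<omega> < of_int b + 1"
    unfolding a_def b_def by linarith+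
  then have "z - l \<in> cbox 0 (Complex \<omega> \<omega>)"
    using \<omega>_pos by (simp add: in_cbox_complex_iff l_def field_simps)
  moreover have "l \<in> \<Lambda>" unfolding lattice_iff l_def by blast
  ultimately show ?thesis using that by blast
qed

section \<open>Convergence of the Weierstrass series\<close>

text \<open>Away from the origin (1 + |a|)(1 + |b|) \<le> 4 (a^2 + b^2), because |a| \<le> a^2 for
  integers. Raising to the power 3/2 bounds |l|^(-3) by a product of two convergent series; the
  constant 8 is 4 to the power 3/2. The term at l = 0 is 1/0 = 0.\<close>

lemma summable_inverse_cubes: "(\<lambda>l. 1 / norm l ^ 3) summable_on \<Lambda>"
proof -
  let ?j = "\<lambda>(a, b). of_real \<omega> * (of_int a + \<i> * of_int b) :: complex"
  let ?g = "\<lambda>a::int. (1 + \<bar>of_int a\<bar>) powr (- 3 / 2) :: real"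
  have bij: "bij_betw ?j UNIV \<Lambda>"
  proof -
    have "inj ?j" using \<omega>_pos by (auto simp: inj_on_def complex_eq_iff)
    then show ?thesis by (simp only: bij_betw_def lattice_range)
  qed
  have g: "?g summable_on UNIV" by (rule summable_on_int_powr) simp
  have "(\<lambda>(a, b). ?g a * ?g b) summable_on Sigma UNIV (\<lambda>_. UNIV)"
  proof (rule summable_on_SigmaI)
    show "((\<lambda>b. (\<lambda>(a, b). ?g a * ?g b) (a, b)) has_sum ?g a * infsum ?g UNIV) UNIV" for a
      using has_sum_cmult_right[OF has_sum_infsum[OF g], of "?g a"] by simp
    show "(\<lambda>a. ?g a * infsum ?g UNIV) summable_on UNIV"
      by (rule summable_on_cmult_left[OF g])
  qed auto
  then have "(\<lambda>p. 8 / \<omega> ^ 3 * (\<lambda>(a, b). ?g a * ?g b) p) summable_on UNIV"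
    by (intro summable_on_cmult_right) simp
  then have "(\<lambda>p. 1 / norm (?j p) ^ 3) summable_on UNIV"
  proof (rule summable_on_comparison_test)
    fix p :: "int \<times> int"
    obtain a b where p: "p = (a, b)" by fastforce
    show "1 / norm (?j p) ^ 3 \<le> 8 / \<omega> ^ 3 * (\<lambda>(a, b). ?g a * ?g b) p"
    proof (cases "p = (0, 0)")
      case False
      define s :: real where "s = (of_int a)\<^sup>2 + (of_int b)\<^sup>2"
      define A B :: real where "A = \<bar>of_int a\<bar>" and "B = \<bar>of_int b\<bar>"
      have "a\<^sup>2 + b\<^sup>2 \<ge> 1" using False p by (smt (verit) sum_power2_gt_zero_iff)
      then have s1: "1 \<le> s" unfolding s_def by (metis of_int_1_le_iff of_int_add of_int_power)
      have sq: "\<bar>of_int c :: real\<bar> \<le> \<bar>of_int c\<bar>\<^sup>2" for c :: int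
      proof (cases "c = 0")
        case False
        then have "1 \<le> \<bar>of_int c :: real\<bar>" by linarith
        then show ?thesis by (rule self_le_power) simp
      qed simp
      have "A \<le> A\<^sup>2" "B \<le> B\<^sup>2"
        unfolding A_def B_def by (rule sq)+
      moreover have "2 * (A * B) \<le> A\<^sup>2 + B\<^sup>2" using sum_squares_bound[of A B] by simp
      moreover have "s = A\<^sup>2 + B\<^sup>2" by (simp add: s_def A_def B_def)
      moreover have "(1 + A) * (1 + B) = 1 + A + B + A * B" by (simp add: algebra_simps)
      moreover have "0 \<le> A\<^sup>2" "0 \<le> B\<^sup>2" "0 \<le> A" "0 \<le> B" by (simp_all add: A_def B_def)
      ultimately have le: "(1 + A) * (1 + B) \<le> 4 * s" and AB: "0 \<le> A" "0 \<le> B" using s1 by linarith+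
      have nrm: "norm (?j p) ^ 3 = \<omega> ^ 3 * s powr (3 / 2)"
      proof -
        have "norm (of_int a + \<i> * of_int b :: complex) = sqrt s"
          by (simp add: cmod_def s_def)
        moreover have "sqrt s ^ 3 = s powr (3 / 2)"
          using s1 by (simp add: powr_half_sqrt[symmetric] powr_realpow[symmetric] powr_powr)
        ultimately show ?thesis using \<omega>_pos by (simp add: p norm_mult power_mult_distrib)
      qed
      have "((1 + A) * (1 + B)) powr (3 / 2) \<le> (4 * s) powr (3 / 2)"
        using le AB by (intro powr_mono2) auto
      also have "\<dots> = 8 * s powr (3 / 2)"
      proof -
        have "(4::real) powr (3 / 2) = (4 powr (1/2)) ^ 3" by (simp add: powr_powr flip: powr_realpow)
        then show ?thesis using s1 by (simp add: powr_mult powr_half_sqrt)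
      qed
      finally have "8 / (8 * s powr (3 / 2)) \<le> 8 / ((1 + A) * (1 + B)) powr (3 / 2)"
        using frac_le[of 8 8 "((1 + A) * (1 + B)) powr (3 / 2)" "8 * s powr (3 / 2)"] s1 AB
        by (simp add: add_pos_nonneg)
      also have "\<dots> = 8 * (?g a * ?g b)"
        using AB by (simp add: A_def B_def powr_mult powr_minus_divide)
      finally have "1 / s powr (3 / 2) \<le> 8 * (?g a * ?g b)" by simp
      from mult_left_mono[OF this, of "1 / \<omega> ^ 3"] \<omega>_pos
      show ?thesis using nrm unfolding p prod.case by simp
    qed (use \<omega>_pos in \<open>auto simp: p\<close>)
  qed auto
  then show ?thesis
    using summable_on_reindex_bij_betw[OF bij, of "\<lambda>l. 1 / norm l ^ 3"] by simp
qed

text \<open>For \<open>l = 0\<close> the convention \<open>1 / 0 = 0\<close> makes this the leading term \<open>1 / z\<^sup>2\<close>, so that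
  \<open>\<wp>\<close> is a single sum over the whole lattice.\<close>

abbreviation wterm :: "complex \<Rightarrow> complex \<Rightarrow> complex" where
  "wterm l z \<equiv> 1 / (z - l) ^ 2 - 1 / l ^ 2"

text \<open>Over a common denominator the term is z (2l - z) / ((z - l)^2 l^2), which gains one
  power of l over 1/l^2. The number d expresses that z - l is not small compared with l.\<close>

lemma norm_wterm_le:
  assumes z: "norm z \<le> R" and l: "l \<noteq> 0" and d: "0 < d" "d * norm l \<le> norm (z - l)"
  shows "norm (wterm l z) \<le> R * (1 / d\<^sup>2 + 1 / d) * (1 / norm l ^ 3)"
proof -
  define L D where "L = norm l" and "D = norm (z - l)"
  have L: "0 < L" using l by (simp add: L_def)
  have D: "0 < D" "d * L \<le> D"
    using d L mult_pos_pos[of d L] unfolding L_def D_def by linarith+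
  have R: "0 \<le> R" using z norm_ge_zero order_trans by blast
  have zl: "z - l \<noteq> 0" using D by (auto simp: D_def)
  have "wterm l z = z * (2 * l - z) / ((z - l)\<^sup>2 * l\<^sup>2)"
    using l zl by (simp add: divide_simps) (simp add: algebra_simps power2_eq_square)
  then have "norm (wterm l z) = norm z * norm (2 * l - z) / (D\<^sup>2 * L\<^sup>2)"
    by (simp add: norm_mult norm_divide norm_power L_def D_def)
  also have "\<dots> \<le> R * (L + D) / (D\<^sup>2 * L\<^sup>2)"
  proof (intro divide_right_mono mult_mono z R)
    have "2 * l - z = l - (z - l)" by simp
    then show "norm (2 * l - z) \<le> L + D" unfolding L_def D_def by (metis norm_triangle_ineq4)
  qed auto
  also have "\<dots> = R * (1 / (D\<^sup>2 * L) + 1 / (D * L\<^sup>2))"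
    using L D by (simp add: field_simps power2_eq_square)
  also have "\<dots> \<le> R * (1 / ((d * L)\<^sup>2 * L) + 1 / ((d * L) * L\<^sup>2))"
    using L D d(1) R by (intro mult_left_mono add_mono divide_left_mono mult_right_mono power_mono) auto
  also have "\<dots> = R * (1 / d\<^sup>2 + 1 / d) * (1 / L ^ 3)"
    using L d(1) by (simp add: field_simps power2_eq_square power3_eq_cube)
  finally show ?thesis by (simp add: L_def)
qed

lemma wterm_bound:
  assumes "z0 \<notin> \<Lambda> - {0}"
  obtains e C where "0 < e" "\<And>z l. z \<in> cball z0 e \<Longrightarrow> l \<in> \<Lambda> - {0} \<Longrightarrow> z \<noteq> l"
    "\<And>z l. z \<in> cball z0 e \<Longrightarrow> l \<in> \<Lambda> - {0} \<Longrightarrow> norm (wterm l z) \<le> C * (1 / norm l ^ 3)"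
proof -
  have "z0 \<in> - (\<Lambda> - {0})" using assms by blast
  then obtain e0 where e0: "0 < e0" "cball z0 e0 \<subseteq> - (\<Lambda> - {0})"
    using open_compl_lattice0 open_contains_cball by blast
  define e where "e = e0 / 2"
  define R where "R = norm z0 + e"
  \<comment> \<open>The value 1/2 serves lattice points with |l| \<ge> 2R, where |z - l| \<ge> |l| -
    R. For the others |z - l| \<ge> e, since the radius \<open>e0\<close> has been halved, and e /
    (2R) serves.\<close>
  define d where "d = min (1/2) (e / (2 * R))"
  have e: "0 < e" using e0 by (simp add: e_def)
  have R: "0 < R" using e by (simp add: R_def add_nonneg_pos)
  have d: "0 < d" using e R by (simp add: d_def)
  have bd: "norm z \<le> R \<and> d * norm l \<le> norm (z - l) \<and> z \<noteq> l"
    if z: "z \<in> cball z0 e" and l: "l \<in> \<Lambda> - {0}" for z l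
  proof -
    have "norm (z - z0) \<le> e" using z by (simp add: dist_norm norm_minus_commute)
    then have zR: "norm z \<le> R" unfolding R_def using norm_triangle_ineq2[of z z0] by linarith
    have "l \<notin> cball z0 e0" using e0 l by auto
    then have "e0 < norm (l - z0)" by (simp add: dist_norm norm_minus_commute)
    moreover have "norm (l - z0) \<le> norm (z - l) + norm (z - z0)"
      using norm_triangle_ineq4[of "z - z0" "z - l"] by (simp add: norm_minus_commute)
    ultimately have ge: "e \<le> norm (z - l)" using \<open>norm (z - z0) \<le> e\<close> by (simp add: e_def)
    have "d * norm l \<le> norm (z - l)"
    proof (cases "2 * R \<le> norm l")
      case True
      have "norm l \<le> norm (z - l) + norm z"
        using norm_triangle_ineq4[of z "z - l"] by simp
      moreover have "d * norm l \<le> 1/2 * norm l" by (intro mult_right_mono) (auto simp: d_def)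
      ultimately show ?thesis using True zR by linarith
    next
      case False
      have "d * norm l \<le> e / (2 * R) * (2 * R)"
        using False e R by (intro mult_mono) (auto simp: d_def)
      then show ?thesis using ge R by simp
    qed
    then show ?thesis using zR ge e by auto
  qed
  show ?thesis
  proof (rule that[OF e])
    show "z \<noteq> l" if "z \<in> cball z0 e" "l \<in> \<Lambda> - {0}" for z l using bd that by blast
    show "norm (wterm l z) \<le> R * (1 / d\<^sup>2 + 1 / d) * (1 / norm l ^ 3)"
      if "z \<in> cball z0 e" "l \<in> \<Lambda> - {0}" for z l
      using bd[OF that] that d by (intro norm_wterm_le) auto
  qed
qed

lemma summable_inverse_cubes': "(\<lambda>l. C * (1 / norm l ^ 3)) summable_on (\<Lambda> - {0})"
  by (intro summable_on_cmult_right summable_on_subset[OF summable_inverse_cubes]) auto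

text \<open>The regular part of \<wp> at 0. All expansions at the pole are read off from it and its
  derivatives.\<close>

definition wreg :: "complex \<Rightarrow> complex" where
  "wreg z = (\<Sum>\<^sub>\<infinity>l\<in>\<Lambda> - {0}. wterm l z)"

lemma wterm_summable:
  assumes "z \<notin> \<Lambda> - {0}"
  shows "(\<lambda>l. wterm l z) summable_on (\<Lambda> - {0})"
proof -
  obtain e C where "0 < e" "\<And>w l. w \<in> cball z e \<Longrightarrow> l \<in> \<Lambda> - {0} \<Longrightarrow> w \<noteq> l"
    "\<And>w l. w \<in> cball z e \<Longrightarrow> l \<in> \<Lambda> - {0} \<Longrightarrow> norm (wterm l w) \<le> C * (1 / norm l ^ 3)"
    using wterm_bound[OF assms] by metis
  then have "(\<lambda>l. norm (wterm l z)) summable_on (\<Lambda> - {0})"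
    by (intro Infinite_Sum.abs_summable_on_comparison_test'[OF summable_inverse_cubes'[of C]]) auto
  then show ?thesis by (rule abs_summable_summable)
qed

lemma wreg_holomorphic: "wreg holomorphic_on - (\<Lambda> - {0})"
proof -
  have "wreg field_differentiable at z0" if z0: "z0 \<in> - (\<Lambda> - {0})" for z0
  proof -
    have "z0 \<notin> \<Lambda> - {0}" using z0 by blast
    from wterm_bound[OF this] obtain e C where e: "0 < e"
      "\<And>z l. z \<in> cball z0 e \<Longrightarrow> l \<in> \<Lambda> - {0} \<Longrightarrow> z \<noteq> l"
      "\<And>z l. z \<in> cball z0 e \<Longrightarrow> l \<in> \<Lambda> - {0} \<Longrightarrow> norm (wterm l z) \<le> C * (1 / norm l ^ 3)"
      by blast
    have ul: "uniform_limit (cball z0 e) (\<lambda>X z. \<Sum>l\<in>X. wterm l z) wreg (finite_subsets_at_top (\<Lambda> - {0}))"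
      unfolding wreg_def using e(3) summable_inverse_cubes' by (intro Weierstrass_m_test_general) auto
    have "eventually (\<lambda>X. continuous_on (cball z0 e) (\<lambda>z. \<Sum>l\<in>X. wterm l z) \<and>
        (\<lambda>z. \<Sum>l\<in>X. wterm l z) holomorphic_on ball z0 e) (finite_subsets_at_top (\<Lambda> - {0}))"
    proof (rule eventually_finite_subsets_at_top_weakI)
      fix X assume X: "X \<subseteq> \<Lambda> - {0}"
      have "(\<lambda>z. \<Sum>l\<in>X. wterm l z) holomorphic_on cball z0 e"
        using X e(2) by (intro holomorphic_intros) (auto simp: subset_iff)
      then show "continuous_on (cball z0 e) (\<lambda>z. \<Sum>l\<in>X. wterm l z) \<and>
        (\<lambda>z. \<Sum>l\<in>X. wterm l z) holomorphic_on ball z0 e"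
        using ball_subset_cball holomorphic_on_imp_continuous_on holomorphic_on_subset by blast
    qed
    then have "wreg holomorphic_on ball z0 e"
      by (rule holomorphic_uniform_limit[OF _ ul]) auto
    then show ?thesis
      using e(1) holomorphic_on_imp_differentiable_at by (metis centre_in_ball open_ball)
  qed
  then show ?thesis
    by (simp add: holomorphic_on_def field_differentiable_at_within)
qed

section \<open>Periods, symmetries and derivatives\<close>

abbreviation wp :: "complex \<Rightarrow> complex" where "wp \<equiv> weierstrass_p \<Lambda>"

lemma wp_eq: "wp z = 1 / z ^ 2 + wreg z"
  by (simp add: weierstrass_p_def wreg_def)

lemma wp_has_sum:
  assumes "z \<notin> \<Lambda>"
  shows "((\<lambda>l. wterm l z) has_sum wp z) \<Lambda>"
proof -
  have "((\<lambda>l. wterm l z) has_sum wreg z) (\<Lambda> - {0})"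
    using wterm_summable[of z] assms by (auto simp: wreg_def intro: has_sum_infsum)
  moreover have "((\<lambda>l. wterm l z) has_sum 1 / z ^ 2) {0}"
    using has_sum_finite[of "{0}" "\<lambda>l. wterm l z"] by simp
  ultimately have "((\<lambda>l. wterm l z) has_sum (1 / z ^ 2 + wreg z)) ({0} \<union> (\<Lambda> - {0}))"
    by (intro has_sum_Un_disjoint) auto
  then show ?thesis by (simp add: wp_eq insert_absorb)
qed

text \<open>The shift \<open>\<wp>(z + m) - \<wp>(z)\<close> is a sum over \<open>l\<close> not involving \<open>z\<close>, and the substitution
  \<open>l \<mapsto> m - l\<close> changes its sign.\<close>

lemma wp_periodic:
  assumes z: "z \<notin> \<Lambda>" and m: "m \<in> \<Lambda>"
  shows "wp (z + m) = wp z"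
proof -
  have zm: "z + m \<notin> \<Lambda>" using z m lattice_add_iff by blast
  have "((\<lambda>l. 1 / (z + m - l) ^ 2 - 1 / (l - m) ^ 2) has_sum wp z) \<Lambda> \<longleftrightarrow> ((\<lambda>l. wterm l z) has_sum wp z) \<Lambda>"
    by (rule has_sum_reindex_bij_witness[where i = "\<lambda>l. l + m" and j = "\<lambda>l. l - m"])
       (use m in \<open>auto simp: lattice_add lattice_diff algebra_simps\<close>)
  then have "((\<lambda>l. 1 / (z + m - l) ^ 2 - 1 / (l - m) ^ 2) has_sum wp z) \<Lambda>"
    using wp_has_sum[OF z] by simp
  from has_sum_add[OF wp_has_sum[OF zm] has_sum_uminusI[OF this]]
  have c: "((\<lambda>l. 1 / (l - m) ^ 2 - 1 / l ^ 2) has_sum (wp (z + m) - wp z)) \<Lambda>" by simp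
  have "((\<lambda>l. - (1 / (l - m) ^ 2 - 1 / l ^ 2)) has_sum (wp (z + m) - wp z)) \<Lambda> \<longleftrightarrow>
      ((\<lambda>l. 1 / (l - m) ^ 2 - 1 / l ^ 2) has_sum (wp (z + m) - wp z)) \<Lambda>"
    by (rule has_sum_reindex_bij_witness[where i = "\<lambda>l. m - l" and j = "\<lambda>l. m - l"])
       (use m in \<open>auto simp: lattice_diff power2_commute\<close>)
  then have "((\<lambda>l. - (1 / (l - m) ^ 2 - 1 / l ^ 2)) has_sum (wp (z + m) - wp z)) \<Lambda>"
    using c by simp
  then have "wp (z + m) - wp z = - (wp (z + m) - wp z)"
    using has_sum_uminusI[OF c] has_sum_unique by blast
  then show ?thesis by simp
qed

text \<open>Multiplication by i permutes the lattice, and each term is homogeneous of degree -2 in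
  (l, z).\<close>

lemma wreg_times_ii: "wreg (\<i> * z) = - wreg z"
proof -
  have "wreg (\<i> * z) = (\<Sum>\<^sub>\<infinity>l\<in>\<Lambda> - {0}. wterm (\<i> * l) (\<i> * z))"
    unfolding wreg_def
  proof (rule infsum_reindex_bij_witness[symmetric, where i = "\<lambda>l. - \<i> * l" and j = "\<lambda>l. \<i> * l"])
  qed (use lattice_times_ii in \<open>auto simp flip: mult.assoc\<close>)
  also have "\<dots> = (\<Sum>\<^sub>\<infinity>l\<in>\<Lambda> - {0}. - wterm l z)"
    by (rule infsum_cong) (simp add: power_mult_distrib flip: right_diff_distrib)
  finally show ?thesis by (simp only: wreg_def infsum_uminus)
qed

lemma wreg_cnj: "wreg (cnj z) = cnj (wreg z)"
proof -
  have "wreg (cnj z) = (\<Sum>\<^sub>\<infinity>l\<in>\<Lambda> - {0}. wterm (cnj l) (cnj z))"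
    unfolding wreg_def
    by (rule infsum_reindex_bij_witness[symmetric, where i = cnj and j = cnj]) auto
  also have "\<dots> = (\<Sum>\<^sub>\<infinity>l\<in>\<Lambda> - {0}. cnj (wterm l z))"
    by (rule infsum_cong) simp
  finally show ?thesis unfolding infsum_cnj wreg_def .
qed

lemma wreg_0: "wreg 0 = 0"
  by (simp add: wreg_def)

lemma wp_times_ii: "wp (\<i> * z) = - wp z"
  by (simp add: wp_eq wreg_times_ii power_mult_distrib)

lemma wreg_minus: "wreg (- z) = wreg z"
  using wreg_times_ii[of "\<i> * z"] wreg_times_ii[of z] by (simp flip: mult.assoc)

lemma wp_minus: "wp (- z) = wp z"
  by (simp add: wp_eq wreg_minus)

lemma wp_cnj: "wp (cnj z) = cnj (wp z)"
  by (simp add: wp_eq wreg_cnj)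

lemma wp_holomorphic: "wp holomorphic_on - \<Lambda>"
proof -
  have "(\<lambda>z. 1 / z ^ 2 + wreg z) holomorphic_on - \<Lambda>"
    using wreg_holomorphic by (intro holomorphic_intros) (auto elim: holomorphic_on_subset)
  then show ?thesis by (simp add: wp_eq[abs_def])
qed

abbreviation wp' :: "complex \<Rightarrow> complex" where "wp' \<equiv> deriv wp"
abbreviation wp'' :: "complex \<Rightarrow> complex" where "wp'' \<equiv> deriv wp'"

lemma wp'_holomorphic: "wp' holomorphic_on - \<Lambda>"
  by (rule holomorphic_deriv[OF wp_holomorphic open_compl_lattice])

lemma wp_has_derivative [derivative_intros]:
  assumes "(g has_field_derivative g') (at z within S)" "g z \<notin> \<Lambda>"
  shows "((\<lambda>z. wp (g z)) has_field_derivative wp' (g z) * g') (at z within S)"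
  by (rule DERIV_chain2[OF holomorphic_derivI[OF wp_holomorphic open_compl_lattice] assms(1)])
     (use assms in auto)

lemma wp'_has_derivative [derivative_intros]:
  assumes "(g has_field_derivative g') (at z within S)" "g z \<notin> \<Lambda>"
  shows "((\<lambda>z. wp' (g z)) has_field_derivative wp'' (g z) * g') (at z within S)"
  by (rule DERIV_chain2[OF holomorphic_derivI[OF wp'_holomorphic open_compl_lattice] assms(1)])
     (use assms in auto)

text \<open>Allows functional equations valid off the lattice to be differentiated; this is how each
  symmetry of \<wp> passes to its derivatives.\<close>

lemma has_field_derivative_off_lattice_unique:
  assumes "(f has_field_derivative a) (at z)" "(g has_field_derivative b) (at z)"
    and "z \<notin> \<Lambda>" "\<And>u. u \<notin> \<Lambda> \<Longrightarrow> f u = g u"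
  shows "a = b"
proof -
  have "(g has_field_derivative a) (at z)"
    by (rule has_field_derivative_transform_within_open[OF assms(1) open_compl_lattice]) (use assms in auto)
  then show ?thesis using assms(2) DERIV_unique by blast
qed

lemma wreg_has_derivative:
  assumes "z \<notin> \<Lambda> - {0}"
  shows "(wreg has_field_derivative deriv wreg z) (at z)"
    "(deriv wreg has_field_derivative deriv (deriv wreg) z) (at z)"
  using assms holomorphic_derivI[OF wreg_holomorphic open_compl_lattice0, of z]
    holomorphic_derivI[OF holomorphic_deriv[OF wreg_holomorphic open_compl_lattice0] open_compl_lattice0, of z]
  by blast+

lemma wp'_eq:
  assumes z: "z \<notin> \<Lambda>"
  shows "wp' z = - 2 / z ^ 3 + deriv wreg z"
proof -
  have "z \<noteq> 0" "z \<notin> \<Lambda> - {0}" using z by auto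
  note wreg_has_derivative(1)[OF this(2)]
  then have "((\<lambda>z. 1 / z ^ 2 + wreg z) has_field_derivative (- 2 / z ^ 3 + deriv wreg z)) (at z)"
    using \<open>z \<noteq> 0\<close>
    by (auto intro!: derivative_eq_intros simp: field_simps power2_eq_square power3_eq_cube)
  then show ?thesis by (simp add: wp_eq[abs_def] DERIV_imp_deriv)
qed

lemma wp''_eq:
  assumes z: "z \<notin> \<Lambda>"
  shows "wp'' z = 6 / z ^ 4 + deriv (deriv wreg) z"
proof -
  have z0: "z \<noteq> 0" "z \<notin> \<Lambda> - {0}" using z by auto
  have A: "((\<lambda>z. - 2 / z ^ 3 + deriv wreg z) has_field_derivative (6 / z ^ 4 + deriv (deriv wreg) z)) (at z)"
    using wreg_has_derivative(2)[OF z0(2)] z0(1)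
    by (auto intro!: derivative_eq_intros simp: field_simps eval_nat_numeral)
  have B: "(wp' has_field_derivative wp'' z) (at z)"
    using z by (auto intro!: derivative_eq_intros)
  show ?thesis
    by (rule has_field_derivative_off_lattice_unique[OF B A z]) (rule wp'_eq)
qed

lemma wp'_periodic:
  assumes z: "z \<notin> \<Lambda>" and m: "m \<in> \<Lambda>"
  shows "wp' (z + m) = wp' z"
proof -
  have "((\<lambda>u. wp (u + m)) has_field_derivative wp' (z + m)) (at z)" "(wp has_field_derivative wp' z) (at z)"
    using z m by (auto intro!: derivative_eq_intros simp: lattice_add_iff)
  then show ?thesis
    by (rule has_field_derivative_off_lattice_unique[OF _ _ z]) (rule wp_periodic[OF _ m])
qed

lemma wp''_periodic:
  assumes z: "z \<notin> \<Lambda>" and m: "m \<in> \<Lambda>"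
  shows "wp'' (z + m) = wp'' z"
proof -
  have "((\<lambda>u. wp' (u + m)) has_field_derivative wp'' (z + m)) (at z)" "(wp' has_field_derivative wp'' z) (at z)"
    using z m by (auto intro!: derivative_eq_intros simp: lattice_add_iff)
  then show ?thesis
    by (rule has_field_derivative_off_lattice_unique[OF _ _ z]) (rule wp'_periodic[OF _ m])
qed

lemma wp'_minus:
  assumes z: "z \<notin> \<Lambda>"
  shows "wp' (- z) = - wp' z"
proof -
  have "((\<lambda>u. wp (- u)) has_field_derivative - wp' (- z)) (at z)" "(wp has_field_derivative wp' z) (at z)"
    using z by (auto intro!: derivative_eq_intros)
  then have "- wp' (- z) = wp' z"
    by (rule has_field_derivative_off_lattice_unique[OF _ _ z]) (rule wp_minus)
  then show ?thesis by (simp add: minus_equation_iff)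
qed

lemma wp'_times_ii: "z \<notin> \<Lambda> \<Longrightarrow> wp' (\<i> * z) = \<i> * wp' z"
proof -
  assume z: "z \<notin> \<Lambda>"
  have "((\<lambda>u. wp (\<i> * u)) has_field_derivative wp' (\<i> * z) * \<i>) (at z)"
    "((\<lambda>u. - wp u) has_field_derivative - wp' z) (at z)"
    using z by (auto intro!: derivative_eq_intros)
  then have "wp' (\<i> * z) * \<i> = - wp' z"
    by (rule has_field_derivative_off_lattice_unique[OF _ _ z]) (rule wp_times_ii)
  then show ?thesis by (simp add: complex_eq_iff)
qed

section \<open>Liouville's theorem for the torus and the differential equations\<close>

lemma eventually_not_lattice: "eventually (\<lambda>z. z \<notin> \<Lambda>) (at 0)"
  using lattice_ball \<omega>_pos by (auto simp: eventually_at_topological intro!: exI[of _ "ball 0 \<omega>"])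

text \<open>A limit at 0 makes the singularity there removable, and periodicity carries this to
  every lattice point. The extension is bounded by its values on one closed square. The limit also
  identifies the constant.\<close>

lemma elliptic_function_constant:
  assumes hol: "f holomorphic_on - \<Lambda>"
    and per: "\<And>z m. z \<notin> \<Lambda> \<Longrightarrow> m \<in> \<Lambda> \<Longrightarrow> f (z + m) = f z"
    and lim: "(f \<longlongrightarrow> L) (at 0)" and z: "z \<notin> \<Lambda>"
  shows "f z = L"
proof -
  have sub: "ball 0 \<omega> - {0} \<subseteq> - \<Lambda>" using lattice_ball by auto
  have "((\<lambda>z. (z - 0) * f z) \<longlongrightarrow> (0 - 0) * L) (at 0)" by (intro tendsto_intros lim)
  then obtain g where g: "g holomorphic_on ball 0 \<omega>" "\<And>z. z \<in> ball 0 \<omega> - {0} \<Longrightarrow> g z = f z"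
    using holomorphic_on_extend_lim[of f "ball 0 \<omega>" 0] holomorphic_on_subset[OF hol sub] \<omega>_pos
    by (auto simp: interior_open)
  \<comment> \<open>The values of \<open>f\<close> on the lattice are arbitrary; they are replaced
    by the one that continues \<open>f\<close> holomorphically.\<close>
  define F where "F = (\<lambda>z. if z \<in> \<Lambda> then g 0 else f z)"
  have Fper: "F (u + m) = F u" if "m \<in> \<Lambda>" for u m
    using that per by (simp add: F_def lattice_add_iff)
  have Fg: "F u = g u" if "u \<in> ball 0 \<omega>" for u
    using that g(2)[of u] lattice_ball[of u] by (cases "u = 0") (auto simp: F_def)
  have diff: "F field_differentiable at u" for u
  proof (cases "u \<in> \<Lambda>")
    case True
    have "(\<lambda>v. g (v - u)) holomorphic_on ball u \<omega>"
      by (rule holomorphic_on_compose_gen[OF _ g(1), of "\<lambda>v. v - u", unfolded o_def])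
         (intro holomorphic_intros, auto simp: dist_norm norm_minus_commute)
    moreover have "g (v - u) = F v" if "v \<in> ball u \<omega>" for v
      using that Fg[of "v - u"] Fper[of u "v - u"] True by (auto simp: dist_norm norm_minus_commute)
    ultimately have "F holomorphic_on ball u \<omega>" by (rule holomorphic_transform)
    then show ?thesis using \<omega>_pos holomorphic_on_imp_differentiable_at by (metis centre_in_ball open_ball)
  next
    case False
    have "F holomorphic_on - \<Lambda>" using hol by (rule holomorphic_transform) (simp add: F_def)
    then show ?thesis using False holomorphic_on_imp_differentiable_at open_compl_lattice by blast
  qed
  then have "F holomorphic_on UNIV" by (simp add: holomorphic_on_def)
  moreover have "bounded (range F)"
  proof -
    have "range F \<subseteq> F ` cbox 0 (Complex \<omega> \<omega>)"
    proof clarify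
      fix u obtain l where "l \<in> \<Lambda>" "u - l \<in> cbox 0 (Complex \<omega> \<omega>)" by (rule lattice_translate)
      then show "F u \<in> F ` cbox 0 (Complex \<omega> \<omega>)" using Fper[of l "u - l"] by force
    qed
    moreover have "continuous_on (cbox 0 (Complex \<omega> \<omega>)) F"
      using diff by (simp add: continuous_at_imp_continuous_on field_differentiable_imp_continuous_at)
    then have "bounded (F ` cbox 0 (Complex \<omega> \<omega>))"
      by (intro compact_imp_bounded compact_continuous_image) auto
    ultimately show ?thesis using bounded_subset by blast
  qed
  ultimately obtain c where c: "\<And>u. F u = c"
    using Liouville_theorem by (auto simp: constant_on_def)
  have fc: "f u = c" if "u \<notin> \<Lambda>" for u using c[of u] that by (simp add: F_def)
  then have "(f \<longlongrightarrow> c) (at 0)"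
    by (intro tendsto_eventually eventually_mono[OF eventually_not_lattice])
  then have "c = L" using lim LIM_unique by blast
  then show ?thesis using fc z by simp
qed

text \<open>An even function vanishing at 0 has zero derivative there, so two divided differences
  can be taken. Consequently the cross term 12 \<open>wreg\<close> / z^2 in 6 \<wp>^2 has no
  pole.\<close>

lemma wreg_factor:
  obtains m where "m holomorphic_on ball 0 \<omega>" "\<And>z. z \<in> ball 0 \<omega> \<Longrightarrow> wreg z = z ^ 2 * m z"
proof -
  have in0: "0 \<in> interior (ball 0 \<omega>)" using \<omega>_pos by (simp add: interior_open)
  have "ball 0 \<omega> \<subseteq> - (\<Lambda> - {0})" using lattice_ball by auto
  then have h: "wreg holomorphic_on ball 0 \<omega>" by (rule holomorphic_on_subset[OF wreg_holomorphic])
  define k where "k = (\<lambda>z. if z = 0 then deriv wreg 0 else (wreg z - wreg 0) / (z - 0))"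
  have k: "k holomorphic_on ball 0 \<omega>" unfolding k_def by (rule pole_lemma[OF h in0])
  define m where "m = (\<lambda>z. if z = 0 then deriv k 0 else (k z - k 0) / (z - 0))"
  have m: "m holomorphic_on ball 0 \<omega>" unfolding m_def by (rule pole_lemma[OF k in0])
  have d: "(wreg has_field_derivative deriv wreg 0) (at 0)" by (rule wreg_has_derivative) simp
  have "((\<lambda>z. wreg (- z)) has_field_derivative deriv wreg 0 * (- 1)) (at 0)"
    by (rule DERIV_chain2[of wreg]) (use d in \<open>auto intro!: derivative_eq_intros\<close>)
  then have "(wreg has_field_derivative - deriv wreg 0) (at 0)" by (simp add: wreg_minus)
  then have "deriv wreg 0 = - deriv wreg 0" using d DERIV_unique by blast
  then have "deriv wreg 0 = 0" by simp
  have "wreg z = z ^ 2 * m z" for z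
    by (cases "z = 0") (simp_all add: m_def k_def wreg_0 power2_eq_square \<open>deriv wreg 0 = 0\<close>)
  then show ?thesis using m that by blast
qed

lemma half_period_notin [simp]:
  "of_real (\<omega> / 2) \<notin> \<Lambda>" "\<i> * of_real (\<omega> / 2) \<notin> \<Lambda>" "(1 + \<i>) * of_real (\<omega> / 2) \<notin> \<Lambda>"
proof -
  have n: "norm (of_real (\<omega> / 2) :: complex) = \<omega> / 2"
    using \<omega>_pos by (simp only: norm_of_real)
  show 1: "of_real (\<omega> / 2) \<notin> \<Lambda>"
    using lattice_norm_ge[of "of_real (\<omega> / 2)"] n \<omega>_pos by fastforce
  then show "\<i> * of_real (\<omega> / 2) \<notin> \<Lambda>" unfolding lattice_times_ii_iff .
  have "norm ((1 + \<i>) * of_real (\<omega> / 2)) = sqrt 2 * (\<omega> / 2)"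
    by (simp only: norm_mult n) (simp add: cmod_def)
  moreover have "sqrt 2 * (\<omega> / 2) < 2 * (\<omega> / 2)" using \<omega>_pos real_sqrt_less_iff[of 2 4]
    by (intro mult_strict_right_mono) auto
  moreover have "1 + \<i> \<noteq> 0" by (simp add: complex_eq_iff)
  ultimately show "(1 + \<i>) * of_real (\<omega> / 2) \<notin> \<Lambda>"
    using lattice_norm_ge[of "(1 + \<i>) * of_real (\<omega> / 2)"] \<omega>_pos by fastforce
qed

text \<open>This is -g2/2 in the usual notation. It is defined by evaluation at a half period, since
  the equation that makes it a constant is still to be proved.\<close>

definition wpC :: complex where
  "wpC = wp'' (of_real (\<omega> / 2)) - 6 * wp (of_real (\<omega> / 2)) ^ 2"

lemma tendsto_of_holomorphic:
  "f holomorphic_on ball 0 \<omega> \<Longrightarrow> (f \<longlongrightarrow> f 0) (at 0)"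
  using \<omega>_pos holomorphic_on_imp_continuous_on[of f "ball 0 \<omega>"]
  by (simp add: continuous_on_eq_continuous_at isCont_def)

lemma wreg_holomorphic_ball:
  "wreg holomorphic_on ball 0 \<omega>" "deriv wreg holomorphic_on ball 0 \<omega>"
  "deriv (deriv wreg) holomorphic_on ball 0 \<omega>"
proof -
  have "ball 0 \<omega> \<subseteq> - (\<Lambda> - {0})" using lattice_ball by auto
  then show h: "wreg holomorphic_on ball 0 \<omega>" by (rule holomorphic_on_subset[OF wreg_holomorphic])
  then show "deriv wreg holomorphic_on ball 0 \<omega>" by (rule holomorphic_deriv) auto
  then show "deriv (deriv wreg) holomorphic_on ball 0 \<omega>" by (rule holomorphic_deriv) auto
qed

lemma eventually_ball: "eventually (\<lambda>z. z \<in> ball 0 \<omega> \<and> z \<noteq> 0) (at 0)"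
  using \<omega>_pos by (auto simp: eventually_at_topological intro!: exI[of _ "ball 0 \<omega>"])

text \<open>Both \<wp>'' and 6 \<wp>^2 have the principal part 6/z^4 at 0, so their difference is
  elliptic with a finite limit there.\<close>

lemma wp_second_order:
  assumes "z \<notin> \<Lambda>"
  shows "wp'' z = 6 * wp z ^ 2 + wpC"
proof -
  let ?f = "\<lambda>z. wp'' z - 6 * wp z ^ 2"
  obtain m where m: "m holomorphic_on ball 0 \<omega>" "\<And>z. z \<in> ball 0 \<omega> \<Longrightarrow> wreg z = z ^ 2 * m z"
    using wreg_factor by blast
  let ?G = "\<lambda>z. deriv (deriv wreg) z - 12 * m z - 6 * wreg z ^ 2"
  have "?G holomorphic_on ball 0 \<omega>"
    using m(1) wreg_holomorphic_ball by (intro holomorphic_intros) auto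
  then have G: "(?G \<longlongrightarrow> ?G 0) (at 0)" by (rule tendsto_of_holomorphic)
  have "eventually (\<lambda>z. ?G z = ?f z) (at 0)"
    using eventually_ball
  proof eventually_elim
    case (elim z)
    then have "z \<notin> \<Lambda>" using lattice_ball by blast
    moreover have "6 * (1 / z ^ 2 + wreg z) ^ 2 = 6 / z ^ 4 + 12 * m z + 6 * wreg z ^ 2"
      using elim m(2)[of z] by (simp add: field_simps eval_nat_numeral)
    ultimately show ?case by (simp add: wp''_eq wp_eq)
  qed
  then have lim: "(?f \<longlongrightarrow> ?G 0) (at 0)" using G by (rule Lim_transform_eventually[rotated])
  have hol: "?f holomorphic_on - \<Lambda>"
    by (intro holomorphic_intros holomorphic_deriv[OF wp'_holomorphic] wp_holomorphic open_compl_lattice)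
  have per: "\<And>z m. z \<notin> \<Lambda> \<Longrightarrow> m \<in> \<Lambda> \<Longrightarrow> ?f (z + m) = ?f z"
    by (simp add: wp''_periodic wp_periodic)
  \<comment> \<open>Evaluation at \<omega>/2 identifies the limit at 0 with
    \<open>wpC\<close>.\<close>
  from elliptic_function_constant[OF hol per lim half_period_notin(1)]
  have "?G 0 = wpC" unfolding wpC_def by simp
  with elliptic_function_constant[OF hol per lim assms] have "?f z = wpC" by simp
  then show ?thesis by (simp add: algebra_simps)
qed

lemma connected_diff_lattice: "connected (- \<Lambda>)"
  using connected_open_diff_countable[of "UNIV :: complex set" \<Lambda>] countable_lattice
  by (simp add: Compl_eq_Diff_UNIV connected_UNIV)

text \<open>The derivative of \<open>?f\<close> is 2 \<wp>' (\<wp>'' - 6 \<wp>^2 - C) = 0. The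
  constant of integration, usually g3, is zero because z \<mapsto> iz changes the sign of
  \<open>?f\<close>.\<close>

lemma wp_first_order:
  assumes z: "z \<notin> \<Lambda>"
  shows "wp' z ^ 2 = 4 * wp z ^ 3 + 2 * wpC * wp z"
proof -
  let ?f = "\<lambda>z. wp' z ^ 2 - 4 * wp z ^ 3 - 2 * wpC * wp z"
  have "DERIV ?f z :> 0" if "z \<notin> \<Lambda>" for z
  proof -
    have "DERIV ?f z :> 2 * wp' z * wp'' z - 12 * wp z ^ 2 * wp' z - 2 * wpC * wp' z"
      using that by (auto intro!: derivative_eq_intros)
    then show ?thesis by (simp add: wp_second_order[OF that] algebra_simps)
  qed
  then have D: "\<forall>x\<in>- \<Lambda> - {}. DERIV ?f x :> 0" "continuous_on (- \<Lambda>) ?f"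
    by (auto intro!: continuous_at_imp_continuous_on DERIV_isCont)
  obtain c where c: "\<And>x. x \<in> - \<Lambda> \<Longrightarrow> ?f x = c"
    by (rule DERIV_zero_connected_constant[OF connected_diff_lattice open_compl_lattice finite.emptyI D(2,1)])
       (rule that)
  have "?f (\<i> * z) = - ?f z"
    by (simp add: wp'_times_ii z wp_times_ii power_mult_distrib)
  moreover have "?f (\<i> * z) = c" "?f z = c"
    using z by (auto intro!: c simp del: diff_diff_eq)
  ultimately have "c = - c" by (simp only:)
  then have "c = 0" by simp
  with \<open>?f z = c\<close> have "wp' z ^ 2 - (4 * wp z ^ 3 + 2 * wpC * wp z) = 0" by (simp only: diff_diff_eq)
  then show ?thesis by (simp only: right_minus_eq)
qed

lemma wp_lim: "((\<lambda>t. t ^ 2 * wp t) \<longlongrightarrow> 1) (at 0)"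
proof -
  have "((\<lambda>t. 1 + t ^ 2 * wreg t) \<longlongrightarrow> 1 + 0 ^ 2 * wreg 0) (at 0)"
    by (intro tendsto_intros tendsto_of_holomorphic wreg_holomorphic_ball)
  moreover have "eventually (\<lambda>t. 1 + t ^ 2 * wreg t = t ^ 2 * wp t) (at 0)"
    using eventually_ball by eventually_elim (simp add: wp_eq field_simps)
  ultimately show ?thesis using Lim_transform_eventually by fastforce
qed

lemma wp'_lim: "((\<lambda>t. t ^ 3 * wp' t) \<longlongrightarrow> - 2) (at 0)"
proof -
  have "((\<lambda>t. - 2 + t ^ 3 * deriv wreg t) \<longlongrightarrow> - 2 + 0 ^ 3 * deriv wreg 0) (at 0)"
    by (intro tendsto_intros tendsto_of_holomorphic wreg_holomorphic_ball)
  moreover have "eventually (\<lambda>t. - 2 + t ^ 3 * deriv wreg t = t ^ 3 * wp' t) (at 0)"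
    using eventually_ball
  proof eventually_elim
    case (elim t)
    then have "t \<notin> \<Lambda>" using lattice_ball by blast
    with elim show ?case by (simp add: wp'_eq field_simps)
  qed
  ultimately show ?thesis using Lim_transform_eventually by fastforce
qed

section \<open>Values of the function: surjectivity, injectivity, half periods\<close>

text \<open>If c were omitted, 1/(\<wp> - c) would be elliptic and tend to 0 at the pole of \<wp>,
  hence vanish identically.\<close>

lemma wp_surj: "\<exists>z. z \<notin> \<Lambda> \<and> wp z = c"
proof (rule ccontr)
  assume "\<not> ?thesis"
  then have ne: "\<And>z. z \<notin> \<Lambda> \<Longrightarrow> wp z \<noteq> c" by blast
  let ?f = "\<lambda>z. 1 / (wp z - c)"
  have hol: "?f holomorphic_on - \<Lambda>"
    using ne by (intro holomorphic_intros wp_holomorphic) auto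
  have per: "\<And>z m. z \<notin> \<Lambda> \<Longrightarrow> m \<in> \<Lambda> \<Longrightarrow> ?f (z + m) = ?f z"
    by (simp add: wp_periodic)
  have "((\<lambda>t. t ^ 2 / (t ^ 2 * wp t - t ^ 2 * c)) \<longlongrightarrow> 0 ^ 2 / (1 - 0 ^ 2 * c)) (at 0)"
    by (intro tendsto_intros wp_lim) auto
  moreover have "eventually (\<lambda>t. t ^ 2 / (t ^ 2 * wp t - t ^ 2 * c) = ?f t) (at 0)"
    using eventually_ball by eventually_elim (simp flip: right_diff_distrib)
  ultimately have lim: "(?f \<longlongrightarrow> 0) (at 0)" using Lim_transform_eventually by fastforce
  have "?f (of_real (\<omega> / 2)) = 0"
    by (rule elliptic_function_constant[OF hol per lim half_period_notin(1)])
  then show False using ne[OF half_period_notin(1)] by simp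
qed

lemma connected_compl_countable: "countable S \<Longrightarrow> connected (- S :: complex set)"
  using connected_open_diff_countable[of "UNIV :: complex set" S]
  by (simp add: Compl_eq_Diff_UNIV connected_UNIV)

lemma open_affine_off_lattice: "open {u. a * u + b \<notin> \<Lambda>}"
proof -
  have "open ((\<lambda>u. a * u + b) -` (- \<Lambda>))"
    by (intro open_vimage open_compl_lattice continuous_intros)
  then show ?thesis by (simp add: vimage_def)
qed

lemma eventually_affine_off_lattice:
  "a * z + b \<notin> \<Lambda> \<Longrightarrow> eventually (\<lambda>u. a * u + b \<notin> \<Lambda>) (at z)"
  using eventually_at_in_open'[OF open_affine_off_lattice[of a b], of z] by simp

lemma isCont_wp:
  assumes "isCont g z" "g z \<notin> \<Lambda>"
  shows "isCont (\<lambda>u. wp (g u)) z" "isCont (\<lambda>u. wp' (g u)) z"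
proof -
  have "isCont wp (g z)" "isCont wp' (g z)"
    using assms(2) wp_has_derivative[OF DERIV_ident, of "g z" UNIV] wp'_has_derivative[OF DERIV_ident, of "g z" UNIV]
    by (auto intro: DERIV_isCont)
  then show "isCont (\<lambda>u. wp (g u)) z" "isCont (\<lambda>u. wp' (g u)) z"
    using assms(1) by (auto intro: isCont_o2)
qed

text \<open>Both translates solve \<open>\<wp>'' = 6\<wp>\<^sup>2 + C\<close> with the same initial values, so all derivatives of their
  difference vanish at \<open>0\<close> and \<open>z - w\<close> is a period.\<close>

lemma wp_inj:
  assumes z: "z \<notin> \<Lambda>" and w: "w \<notin> \<Lambda>" and eq: "wp z = wp w" "wp' z = wp' w"
  shows "z - w \<in> \<Lambda>"
proof (rule ccontr)
  assume v: "z - w \<notin> \<Lambda>"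
  \<comment> \<open>The common domain of both translates: the plane without a countable set, so
    connected.\<close>
  define S where "S = {u. z + u \<notin> \<Lambda> \<and> w + u \<notin> \<Lambda>}"
  have "open S"
    using open_Int[OF open_affine_off_lattice[of 1 z] open_affine_off_lattice[of 1 w]]
    by (simp add: S_def Int_def add.commute)
  have "connected S"
  proof -
    have "S = - ((\<lambda>l. l - z) ` \<Lambda> \<union> (\<lambda>l. l - w) ` \<Lambda>)"
      by (force simp: S_def image_iff)
    then show ?thesis
      using countable_lattice by (metis connected_compl_countable countable_Un countable_image)
  qed
  have "0 \<in> S" using z w by (simp add: S_def)
  define d where "d = (\<lambda>u. wp (z + u) - wp (w + u))"
  \<comment> \<open>Factoring 6 (x^2 - y^2) turns the equation for the difference into the linear
    one d'' = A d.\<close>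
  define A where "A = (\<lambda>u. 6 * (wp (z + u) + wp (w + u)))"
  have d1: "(d has_field_derivative wp' (z + u) - wp' (w + u)) (at u)" if "u \<in> S" for u
    unfolding d_def using that by (auto simp: S_def intro!: derivative_eq_intros)
  have d1': "deriv d u = wp' (z + u) - wp' (w + u)" if "u \<in> S" for u
    using d1[OF that] by (rule DERIV_imp_deriv)
  have d2: "deriv (deriv d) u = A u * d u" if u: "u \<in> S" for u
  proof -
    have "((\<lambda>u. wp' (z + u) - wp' (w + u)) has_field_derivative wp'' (z + u) - wp'' (w + u)) (at u)"
      using that by (auto simp: S_def intro!: derivative_eq_intros)
    then have "(deriv d has_field_derivative wp'' (z + u) - wp'' (w + u)) (at u)"
      by (rule has_field_derivative_transform_within_open[OF _ \<open>open S\<close> u]) (simp add: d1')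
    moreover have "wp'' (z + u) - wp'' (w + u) = A u * d u"
      using u by (simp add: S_def A_def d_def wp_second_order algebra_simps power2_eq_square)
    ultimately show ?thesis by (metis DERIV_imp_deriv)
  qed
  have dhol: "d holomorphic_on S"
    unfolding holomorphic_on_open[OF \<open>open S\<close>] using d1 by blast
  have Ahol: "A holomorphic_on S"
    unfolding holomorphic_on_open[OF \<open>open S\<close>]
  proof
    fix u assume "u \<in> S"
    then have "(A has_field_derivative 6 * (wp' (z + u) + wp' (w + u))) (at u)"
      unfolding A_def by (auto simp: S_def intro!: derivative_eq_intros)
    then show "\<exists>f'. (A has_field_derivative f') (at u)" by blast
  qed
  \<comment> \<open>By Leibniz the n-th derivative involves all derivatives of d up to order n - 2,
    hence strong induction.\<close>
  have der0: "(deriv ^^ n) d 0 = 0" for n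
  proof (induction n rule: less_induct)
    case (less n)
    consider "n = 0" | "n = 1" | k where "n = Suc (Suc k)"
      by (metis One_nat_def not0_implies_Suc)
    then show ?case
    proof cases
      case 1 then show ?thesis using eq by (simp add: d_def)
    next
      case 2 then show ?thesis using d1'[OF \<open>0 \<in> S\<close>] eq by simp
    next
      case 3
      have "(deriv ^^ n) d 0 = (deriv ^^ k) (deriv (deriv d)) 0"
        by (simp add: 3 funpow_swap1)
      also have "\<dots> = (deriv ^^ k) (\<lambda>u. A u * d u) 0"
        by (rule higher_deriv_transform_within_open[OF _ _ \<open>open S\<close> \<open>0 \<in> S\<close>])
           (use d2 in \<open>auto intro!: holomorphic_intros holomorphic_deriv dhol Ahol \<open>open S\<close>\<close>)
      also have "\<dots> = (\<Sum>i = 0..k. of_nat (k choose i) * (deriv ^^ i) A 0 * (deriv ^^ (k - i)) d 0)"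
        by (rule higher_deriv_mult[OF Ahol dhol \<open>open S\<close> \<open>0 \<in> S\<close>])
      also have "\<dots> = 0"
        using less 3 by (intro sum.neutral) auto
      finally show ?thesis .
    qed
  qed
  have zero: "wp (z + u) = wp (w + u)" if "u \<in> S" for u
    using holomorphic_fun_eq_0_on_connected[OF dhol \<open>open S\<close> \<open>connected S\<close> der0 \<open>0 \<in> S\<close> that]
    by (simp add: d_def)
  \<comment> \<open>With u = t - w the identity says \<wp>(z - w + t) = \<wp>(t). As t \<rightarrow>
    0 the left side stays bounded while the right side has a double pole.\<close>
  have "eventually (\<lambda>t. t \<in> {t. 1 * t + (z - w) \<notin> \<Lambda>}) (at 0)"
    using v by (intro eventually_at_in_open' open_affine_off_lattice) auto
  then have "eventually (\<lambda>t. t ^ 2 * wp (z - w + t) = t ^ 2 * wp t) (at 0)"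
    using eventually_not_lattice
  proof eventually_elim
    case (elim t)
    then have "t - w \<in> S" by (simp add: S_def algebra_simps)
    from zero[OF this] show ?case by (simp add: algebra_simps)
  qed
  moreover have "((\<lambda>t. t ^ 2 * wp (z - w + t)) \<longlongrightarrow> 0 ^ 2 * wp (z - w + 0)) (at 0)"
  proof (intro tendsto_intros)
    have "isCont (\<lambda>t. wp (z - w + t)) 0"
      using v by (intro isCont_wp) auto
    then show "((\<lambda>t. wp (z - w + t)) \<longlongrightarrow> wp (z - w + 0)) (at 0)" by (simp add: isCont_def)
  qed
  ultimately have "((\<lambda>t. t ^ 2 * wp t) \<longlongrightarrow> 0 ^ 2 * wp (z - w + 0)) (at 0)"
    by (rule Lim_transform_eventually[rotated])
  with wp_lim show False using LIM_unique by fastforce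
qed

lemma wp_eq_cases:
  assumes z: "z \<notin> \<Lambda>" and w: "w \<notin> \<Lambda>" and eq: "wp z = wp w"
  shows "z - w \<in> \<Lambda> \<or> z + w \<in> \<Lambda>"
proof -
  have "wp' z ^ 2 = wp' w ^ 2" using wp_first_order z w eq by simp
  then consider "wp' z = wp' w" | "wp' z = - wp' w" by (auto simp: power2_eq_iff)
  then show ?thesis
  proof cases
    case 1 then show ?thesis using wp_inj z w eq by blast
  next
    case 2 then show ?thesis using wp_inj[of z "- w"] z w eq by (simp add: wp_minus wp'_minus)
  qed
qed

text \<open>At a zero of the odd function \<wp>' the points z and -z have the same coordinates, so
  injectivity makes 2z a period.\<close>

lemma wp'_eq_0_iff:
  assumes z: "z \<notin> \<Lambda>"
  shows "wp' z = 0 \<longleftrightarrow> 2 * z \<in> \<Lambda>"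
proof
  assume "wp' z = 0"
  then show "2 * z \<in> \<Lambda>" using wp_inj[of z "- z"] z by (simp add: wp_minus wp'_minus)
next
  assume "2 * z \<in> \<Lambda>"
  then have "wp' (- z) = wp' z" using wp'_periodic[of "- z" "2 * z"] z by simp
  then show "wp' z = 0" using wp'_minus[OF z] by simp
qed

text \<open>Multiplication by i moves the centre h of the square by a period: ih = h -
  \<omega>.\<close>

lemma wp_half_third: "wp ((1 + \<i>) * of_real (\<omega> / 2)) = 0"
proof -
  define h where "h = (1 + \<i>) * of_real (\<omega> / 2)"
  have h: "h \<notin> \<Lambda>" unfolding h_def by (rule half_period_notin)
  have "of_real \<omega> \<in> \<Lambda>" unfolding lattice_iff by (intro exI[of _ 1] exI[of _ 0]) simp
  then have "wp (h + (- of_real \<omega>)) = wp h" using h by (intro wp_periodic) auto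
  moreover have "h + (- of_real \<omega>) = \<i> * h" by (simp add: h_def complex_eq_iff)
  ultimately have "wp h = - wp h" using wp_times_ii[of h] by (simp only:)
  then show ?thesis unfolding h_def[symmetric] by simp
qed

definition e1 :: complex where "e1 = wp (of_real (\<omega> / 2))"

text \<open>Otherwise \<omega>/2 and the centre of the square would share the value 0, and their sum
  or difference would be a period.\<close>

lemma e1_nonzero: "e1 \<noteq> 0"
proof
  assume "e1 = 0"
  then have "wp (of_real (\<omega> / 2)) = wp ((1 + \<i>) * of_real (\<omega> / 2))" by (simp only: wp_half_third e1_def[symmetric])
  from wp_eq_cases[OF half_period_notin(1,3) this]
  have "\<i> * of_real (\<omega> / 2) \<in> \<Lambda>"
  proof
    assume "of_real (\<omega> / 2) - (1 + \<i>) * of_real (\<omega> / 2) \<in> \<Lambda>"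
    moreover have "of_real (\<omega> / 2) - (1 + \<i>) * of_real (\<omega> / 2) = - (\<i> * of_real (\<omega> / 2))"
      by (simp add: algebra_simps)
    ultimately show ?thesis by (simp only: lattice_minus_iff)
  next
    assume a: "of_real (\<omega> / 2) + (1 + \<i>) * of_real (\<omega> / 2) \<in> \<Lambda>"
    have "of_real \<omega> \<in> \<Lambda>" unfolding lattice_iff by (intro exI[of _ 1] exI[of _ 0]) simp
    from lattice_diff[OF a this]
    moreover have "of_real (\<omega> / 2) + (1 + \<i>) * of_real (\<omega> / 2) - of_real \<omega> = \<i> * of_real (\<omega> / 2)"
      by (simp add: complex_eq_iff)
    ultimately show ?thesis by (simp only:)
  qed
  then show False using half_period_notin(2) by blast
qed

lemma wpC_eq: "wpC = - 2 * e1 ^ 2"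
proof -
  have "of_real \<omega> \<in> \<Lambda>" unfolding lattice_iff by (intro exI[of _ 1] exI[of _ 0]) simp
  then have "wp' (of_real (\<omega> / 2)) = 0" by (subst wp'_eq_0_iff[OF half_period_notin(1)]) simp
  from wp_first_order[OF half_period_notin(1), unfolded this]
  have "e1 * (2 * (2 * e1 ^ 2 + wpC)) = 0" by (simp add: e1_def algebra_simps eval_nat_numeral)
  then have "2 * e1 ^ 2 + wpC = 0" using e1_nonzero by (metis mult_eq_0_iff zero_neq_numeral)
  then show ?thesis by (simp add: eq_neg_iff_add_eq_0 add.commute)
qed

text \<open>The roots 0, e, -e of the cubic are simple. This makes y a local coordinate at the
  points of order two, where x fails to be one.\<close>

lemma wp''_nonzero:
  assumes z: "z \<notin> \<Lambda>" "wp' z = 0"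
  shows "wp'' z \<noteq> 0"
proof
  assume "wp'' z = 0"
  then have 1: "6 * wp z ^ 2 = 2 * e1 ^ 2" using wp_second_order[OF z(1)] by (simp add: wpC_eq)
  have "4 * wp z * (wp z ^ 2 - e1 ^ 2) = wp' z ^ 2"
    unfolding wp_first_order[OF z(1)] wpC_eq by algebra
  then have "wp z = 0 \<or> wp z ^ 2 = e1 ^ 2" using z(2) by (metis mult_eq_0_iff right_minus_eq zero_neq_numeral zero_power2)
  then show False using 1 e1_nonzero by auto
qed

section \<open>The addition theorem\<close>

text \<open>The quotient is the slope of the chord through the points with parameters t and s - t;
  the factor 2 reflects y = \<wp>'/2. Its simple derivative makes slope^2 - x1 - x2
  stationary.\<close>

lemma addition_slope_derivative:
  assumes s: "t \<notin> \<Lambda>" "s - t \<notin> \<Lambda>" "wp t \<noteq> wp (s - t)"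
  shows "((\<lambda>t. (wp' t - wp' (s - t)) / (2 * (wp t - wp (s - t)))) has_field_derivative
    wp t - wp (s - t)) (at t)"
proof -
  define x1 x2 y1 y2 where "x1 = wp t" and "x2 = wp (s - t)" and "y1 = wp' t" and "y2 = wp' (s - t)"
  have ne: "x1 - x2 \<noteq> 0" using s by (simp add: x1_def x2_def)
  have y: "y1 ^ 2 = 4 * x1 ^ 3 + 2 * wpC * x1" "y2 ^ 2 = 4 * x2 ^ 3 + 2 * wpC * x2"
    using wp_first_order s by (auto simp: x1_def x2_def y1_def y2_def)
  have "((\<lambda>t. (wp' t - wp' (s - t)) / (2 * (wp t - wp (s - t)))) has_field_derivative
     ((wp'' t + wp'' (s - t)) * (2 * (x1 - x2)) - (y1 - y2) * (2 * (y1 + y2))) / ((2 * (x1 - x2)) * (2 * (x1 - x2)))) (at t)"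
    unfolding x1_def x2_def y1_def y2_def
    using s by (auto intro!: derivative_eq_intros)
  moreover have "(wp'' t + wp'' (s - t)) * (2 * (x1 - x2)) - (y1 - y2) * (2 * (y1 + y2)) =
      (x1 - x2) * ((2 * (x1 - x2)) * (2 * (x1 - x2)))"
    unfolding wp_second_order[OF s(1)] wp_second_order[OF s(2)] x1_def[symmetric] x2_def[symmetric]
    using y by algebra
  ultimately show ?thesis using ne by (simp add: x1_def x2_def)
qed

text \<open>By the differential equations the derivative in \<open>t\<close> vanishes; the constant is found by letting
  \<open>t \<rightarrow> 0\<close>, after clearing the pole in \<open>\<Psi>\<close>.\<close>

lemma addition_x_const:
  assumes s: "s \<notin> \<Lambda>" and t: "t \<notin> \<Lambda>" "s - t \<notin> \<Lambda>" "2 * t - s \<notin> \<Lambda>"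
  shows "((wp' t - wp' (s - t)) / (2 * (wp t - wp (s - t)))) ^ 2 - wp t - wp (s - t) = wp s"
proof -
  \<comment> \<open>The third condition excludes points where t and s - t agree modulo the lattice;
    together with s \<notin> \<Lambda> it keeps the two abscissae distinct.\<close>
  define T where "T = {t. t \<notin> \<Lambda> \<and> s - t \<notin> \<Lambda> \<and> 2 * t - s \<notin> \<Lambda>}"
  define m where "m = (\<lambda>t. (wp' t - wp' (s - t)) / (2 * (wp t - wp (s - t))))"
  define \<Phi> where "\<Phi> = (\<lambda>t. m t ^ 2 - wp t - wp (s - t))"
  have ne: "wp t \<noteq> wp (s - t)" if "t \<in> T" for t
    using wp_eq_cases[of t "s - t"] that s by (auto simp: T_def algebra_simps)
  have "open T"
    using open_Int[OF open_compl_lattice open_Int[OF open_affine_off_lattice[of "-1" s] open_affine_off_lattice[of 2 "- s"]]]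
    by (simp add: T_def Collect_conj_eq Compl_eq)
  have "connected T"
  proof -
    have "T = - (\<Lambda> \<union> (\<lambda>l. s - l) ` \<Lambda> \<union> (\<lambda>l. (l + s) / 2) ` \<Lambda>)"
    proof -
      have "t \<in> (\<lambda>l. s - l) ` \<Lambda> \<longleftrightarrow> s - t \<in> \<Lambda>" for t
        by (auto intro!: image_eqI[of _ _ "s - t"])
      moreover have "t = (l + s) / 2 \<longleftrightarrow> 2 * t - s = l" for t l by (auto simp: field_simps)
      then have "t \<in> (\<lambda>l. (l + s) / 2) ` \<Lambda> \<longleftrightarrow> 2 * t - s \<in> \<Lambda>" for t
        unfolding image_iff by simp
      ultimately show ?thesis unfolding T_def by blast
    qed
    then show ?thesis
      using countable_lattice by (metis connected_compl_countable countable_Un countable_image)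
  qed
  have D: "(\<Phi> has_field_derivative 0) (at t)" if "t \<in> T" for t
  proof -
    have t: "t \<notin> \<Lambda>" "s - t \<notin> \<Lambda>" using that by (auto simp: T_def)
    have "(\<Phi> has_field_derivative 2 * m t * (wp t - wp (s - t)) - wp' t + wp' (s - t)) (at t)"
      unfolding \<Phi>_def
      using addition_slope_derivative[OF t ne[OF that], folded m_def] t
      by (auto intro!: derivative_eq_intros)
    moreover have "2 * m t * (wp t - wp (s - t)) = m t * (2 * (wp t - wp (s - t)))" by simp
    then have "2 * m t * (wp t - wp (s - t)) = wp' t - wp' (s - t)"
      using ne[OF that] by (simp only: m_def) simp
    ultimately show ?thesis by simp
  qed
  have D1: "\<forall>x\<in>T - {}. DERIV \<Phi> x :> 0" and D2: "continuous_on T \<Phi>"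
    using D by (auto intro!: continuous_at_imp_continuous_on DERIV_isCont)
  obtain c where c: "\<And>t. t \<in> T \<Longrightarrow> \<Phi> t = c"
    by (rule DERIV_zero_connected_constant[OF \<open>connected T\<close> \<open>open T\<close> finite.emptyI D2 D1]) (rule that)
  define X Y where "X = (\<lambda>t. wp (s - t))" and "Y = (\<lambda>t. wp' (s - t))"
  define P R where "P = (\<lambda>t. t ^ 2 * wp t)" and "R = (\<lambda>t. t ^ 3 * wp' t)"
  \<comment> \<open>Substitute \<wp>(t) = P/t^2 and \<wp>'(t) = R/t^3 in slope^2 - x1 - x2. The
    first-order equation for \<wp>'(t)^2 cancels the cubic terms in \<wp>(t), and multiplying
    through by t^4 leaves finite limits. With P \<rightarrow> 1 the value at 0 is 8 X(0) / 4 - X(0)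
    = X(0) = \<wp>(s).\<close>
  define \<Psi> where "\<Psi> = (\<lambda>t. (2 * wpC * (t ^ 2 * P t) - 2 * (t * R t * Y t) + t ^ 4 * (Y t) ^ 2
      + 8 * (P t) ^ 2 * X t - 4 * (t ^ 2 * P t * (X t) ^ 2)) / (4 * (P t - t ^ 2 * X t) ^ 2) - X t)"
  have X: "(X \<longlongrightarrow> X 0) (at 0)" and Y: "(Y \<longlongrightarrow> Y 0) (at 0)"
  proof -
    have "isCont X 0" "isCont Y 0" unfolding X_def Y_def
      by (rule isCont_wp; use s in simp)+
    then show "(X \<longlongrightarrow> X 0) (at 0)" "(Y \<longlongrightarrow> Y 0) (at 0)" by (auto simp: isCont_def)
  qed
  have "(\<Psi> \<longlongrightarrow> (2 * wpC * (0 ^ 2 * 1) - 2 * (0 * (- 2) * Y 0) + 0 ^ 4 * (Y 0) ^ 2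
      + 8 * 1 ^ 2 * X 0 - 4 * (0 ^ 2 * 1 * (X 0) ^ 2)) / (4 * (1 - 0 ^ 2 * X 0) ^ 2) - X 0) (at 0)"
    unfolding \<Psi>_def using X Y wp_lim[folded P_def] wp'_lim[folded R_def]
    by (intro tendsto_intros) auto
  then have lim: "(\<Psi> \<longlongrightarrow> wp s) (at 0)" by (simp add: X_def)
  have "eventually (\<lambda>t. (-1) * t + s \<notin> \<Lambda>) (at 0)" "eventually (\<lambda>t. 2 * t + (- s) \<notin> \<Lambda>) (at 0)"
    by (rule eventually_affine_off_lattice; use s in simp)+
  then have "eventually (\<lambda>t. \<Psi> t = c) (at 0)"
    using eventually_not_lattice
  proof eventually_elim
    case (elim t)
    then have T: "t \<in> T" by (simp add: T_def)
    have t0: "t \<noteq> 0" using elim by auto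
    define x1 x2 y1 y2 where "x1 = wp t" and "x2 = wp (s - t)" and "y1 = wp' t" and "y2 = wp' (s - t)"
    have nz: "x1 - x2 \<noteq> 0" using ne[OF T] by (simp add: x1_def x2_def)
    have y1: "y1 ^ 2 = 4 * x1 ^ 3 + 2 * wpC * x1"
      using wp_first_order T by (auto simp: T_def x1_def y1_def)
    have "\<Psi> t = (t ^ 4 * (2 * wpC * x1 - 2 * y1 * y2 + y2 ^ 2 + 8 * x1 ^ 2 * x2 - 4 * x1 * x2 ^ 2)) /
        (t ^ 4 * (4 * (x1 - x2) ^ 2)) - x2"
      unfolding \<Psi>_def P_def R_def X_def Y_def x1_def[symmetric] x2_def[symmetric] y1_def[symmetric] y2_def[symmetric]
      by (intro arg_cong2[of _ _ _ _ "(-)"] arg_cong2[of _ _ _ _ "(/)"] refl; algebra)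
    also have "\<dots> = (2 * wpC * x1 - 2 * y1 * y2 + y2 ^ 2 + 8 * x1 ^ 2 * x2 - 4 * x1 * x2 ^ 2) /
        (4 * (x1 - x2) ^ 2) - x2"
      using t0 by simp
    also have "2 * wpC * x1 - 2 * y1 * y2 + y2 ^ 2 + 8 * x1 ^ 2 * x2 - 4 * x1 * x2 ^ 2 =
        (y1 - y2) ^ 2 - x1 * (4 * (x1 - x2) ^ 2)"
      using y1 by algebra
    also have "((y1 - y2) ^ 2 - x1 * (4 * (x1 - x2) ^ 2)) / (4 * (x1 - x2) ^ 2) - x2 =
        (y1 - y2) ^ 2 / (4 * (x1 - x2) ^ 2) - x1 - x2"
      using nz by (simp add: diff_divide_distrib)
    also have "\<dots> = \<Phi> t"
      by (simp only: \<Phi>_def m_def x1_def x2_def y1_def y2_def power_divide power_mult_distrib) simp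
    finally show ?case using c[OF T] by simp
  qed
  with lim have "((\<lambda>_::complex. c) \<longlongrightarrow> wp s) (at 0)" by (rule Lim_transform_eventually)
  then have "c = wp s" using LIM_unique tendsto_const by blast
  moreover have "t \<in> T" using t by (simp add: T_def)
  ultimately show ?thesis using c[of t] by (simp add: \<Phi>_def m_def)
qed

text \<open>The formula for \<wp>' is the z-derivative of the one for \<wp> with w fixed, where the
  slope has derivative \<wp>(z) - \<wp>(z + w).\<close>

lemma wp_addition:
  assumes zw: "z \<notin> \<Lambda>" "w \<notin> \<Lambda>" "z + w \<notin> \<Lambda>" "z - w \<notin> \<Lambda>"
  defines "m \<equiv> (wp' z - wp' w) / (2 * (wp z - wp w))"
  shows "wp (z + w) = m ^ 2 - wp z - wp w"
    and "wp' (z + w) = 2 * m * (wp z - wp (z + w)) - wp' z"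
proof -
  have add: "wp (z + w) = ((wp' z - wp' w) / (2 * (wp z - wp w))) ^ 2 - wp z - wp w"
    if "z \<notin> \<Lambda>" "z + w \<notin> \<Lambda>" "z - w \<notin> \<Lambda>" for z
    using addition_x_const[of "z + w" z] that zw(2) by simp
  then show X: "wp (z + w) = m ^ 2 - wp z - wp w" using zw by (simp add: m_def)
  have ne: "wp z \<noteq> wp w" using wp_eq_cases zw by blast
  define x1 x2 y1 y2 where "x1 = wp z" and "x2 = wp w" and "y1 = wp' z" and "y2 = wp' w"
  have nz: "x1 - x2 \<noteq> 0" using ne by (simp add: x1_def x2_def)
  have y: "y1 ^ 2 = 4 * x1 ^ 3 + 2 * wpC * x1" "y2 ^ 2 = 4 * x2 ^ 3 + 2 * wpC * x2"
    using wp_first_order zw by (auto simp: x1_def x2_def y1_def y2_def)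
  have "((\<lambda>z. (wp' z - wp' w) / (2 * (wp z - wp w))) has_field_derivative
     (wp'' z * (2 * (x1 - x2)) - (y1 - y2) * (2 * y1)) / ((2 * (x1 - x2)) * (2 * (x1 - x2)))) (at z)"
    unfolding x1_def x2_def y1_def y2_def using zw ne by (auto intro!: derivative_eq_intros)
  moreover have "(wp'' z * (2 * (x1 - x2)) - (y1 - y2) * (2 * y1)) / ((2 * (x1 - x2)) * (2 * (x1 - x2))) =
      x1 - wp (z + w)"
  proof -
    have "wp'' z * (2 * (x1 - x2)) - (y1 - y2) * (2 * y1) =
        (2 * x1 + x2) * ((2 * (x1 - x2)) * (2 * (x1 - x2))) - (y1 - y2) ^ 2"
      unfolding wp_second_order[OF zw(1)] x1_def[symmetric] using y by algebra
    moreover have quot: "(a * (E * E) - b ^ 2) / (E * E) = a - (b / E) ^ 2" if "E \<noteq> 0" for a b E :: complex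
      using that by (simp add: field_simps power2_eq_square)
    ultimately show ?thesis
      unfolding X m_def x1_def[symmetric] x2_def[symmetric] y1_def[symmetric] y2_def[symmetric]
      using nz quot[of "2 * (x1 - x2)" "2 * x1 + x2" "y1 - y2"] by (simp only: mult_eq_0_iff) simp
  qed
  ultimately have m': "((\<lambda>z. (wp' z - wp' w) / (2 * (wp z - wp w))) has_field_derivative x1 - wp (z + w)) (at z)"
    by (simp only:)
  define \<mu> where "\<mu> = (\<lambda>z. (wp' z - wp' w) / (2 * (wp z - wp w)))"
  have \<mu>z: "\<mu> z = m" by (simp add: \<mu>_def m_def)
  have R: "((\<lambda>z. \<mu> z ^ 2 - wp z - wp w) has_field_derivative 2 * m * (x1 - wp (z + w)) - y1) (at z)"
    using m'[folded \<mu>_def] zw(1) by (auto intro!: derivative_eq_intros simp: \<mu>z y1_def)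
  have L: "((\<lambda>z. wp (z + w)) has_field_derivative wp' (z + w)) (at z)"
    using zw by (auto intro!: derivative_eq_intros)
  define U where "U = {z. z \<notin> \<Lambda> \<and> z + w \<notin> \<Lambda> \<and> z - w \<notin> \<Lambda>}"
  have "open U"
    using open_Int[OF open_compl_lattice open_Int[OF open_affine_off_lattice[of 1 w] open_affine_off_lattice[of 1 "- w"]]]
    by (simp add: U_def Collect_conj_eq Compl_eq)
  moreover have "z \<in> U" using zw by (simp add: U_def)
  ultimately have "((\<lambda>z. wp (z + w)) has_field_derivative 2 * m * (x1 - wp (z + w)) - y1) (at z)"
    by (rule has_field_derivative_transform_within_open[OF R]) (simp add: U_def add \<mu>_def)
  then show "wp' (z + w) = 2 * m * (wp z - wp (z + w)) - wp' z"
    using L DERIV_unique unfolding x1_def y1_def by blast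
qed

text \<open>Tangents are limits of chords: as w \<rightarrow> z the slope is a quotient of two
  difference quotients and tends to \<wp>'' / (2 \<wp>').\<close>

lemma wp_duplication:
  assumes z: "z \<notin> \<Lambda>" "2 * z \<notin> \<Lambda>"
  defines "m \<equiv> wp'' z / (2 * wp' z)"
  shows "wp (2 * z) = m ^ 2 - wp z - wp z"
    and "wp' (2 * z) = 2 * m * (wp z - wp (2 * z)) - wp' z"
proof -
  define \<mu> where "\<mu> = (\<lambda>w. (wp' z - wp' w) / (2 * (wp z - wp w)))"
  have nz: "wp' z \<noteq> 0" using wp'_eq_0_iff z by blast
  have D: "(wp has_field_derivative wp' z) (at z)" "(wp' has_field_derivative wp'' z) (at z)"
    using z by (auto intro!: derivative_eq_intros)
  have c: "(wp \<longlongrightarrow> wp z) (at z)"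
    using DERIV_isCont[OF D(1)] by (simp add: isCont_def)
  have "isCont (\<lambda>w. wp (z + w)) z" "isCont (\<lambda>w. wp' (z + w)) z"
    by (intro isCont_wp continuous_intros, use z(2) in \<open>simp only: mult_2 not_False_eq_True\<close>)+
  then have c2: "((\<lambda>w. wp (z + w)) \<longlongrightarrow> wp (2 * z)) (at z)" "((\<lambda>w. wp' (z + w)) \<longlongrightarrow> wp' (2 * z)) (at z)"
    by (simp_all only: isCont_def mult_2)
  have "((\<lambda>w. ((wp' w - wp' z) / (w - z)) / (2 * ((wp w - wp z) / (w - z)))) \<longlongrightarrow> m) (at z)"
    unfolding m_def using D nz by (intro tendsto_intros) (auto simp: has_field_derivative_iff)
  moreover have "eventually (\<lambda>w. ((wp' w - wp' z) / (w - z)) / (2 * ((wp w - wp z) / (w - z))) = \<mu> w) (at z)"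
  proof -
    have "((wp' w - wp' z) / (w - z)) / (2 * ((wp w - wp z) / (w - z))) = \<mu> w" if "w \<noteq> z" for w
    proof -
      have "((wp' w - wp' z) / (w - z)) / (2 * ((wp w - wp z) / (w - z))) = (- (wp' z - wp' w)) / (- (2 * (wp z - wp w)))"
        using that by simp
      then show ?thesis by (simp only: minus_divide_left[symmetric] minus_divide_right[symmetric] minus_minus \<mu>_def)
    qed
    then show ?thesis by (auto simp: eventually_at_filter)
  qed
  ultimately have \<mu>: "(\<mu> \<longlongrightarrow> m) (at z)" by (rule Lim_transform_eventually)
  have "eventually (\<lambda>w. 1 * w + 0 \<notin> \<Lambda>) (at z)" "eventually (\<lambda>w. 1 * w + z \<notin> \<Lambda>) (at z)"
    by (rule eventually_affine_off_lattice; use z in simp)+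
  moreover have "eventually (\<lambda>w. z - w \<notin> \<Lambda>) (at z)"
    unfolding eventually_at_to_0[of _ z]
    using eventually_not_lattice by eventually_elim simp
  ultimately have ev: "eventually (\<lambda>w. w \<notin> \<Lambda> \<and> z + w \<notin> \<Lambda> \<and> z - w \<notin> \<Lambda>) (at z)"
    by eventually_elim (simp add: add.commute)
  have "eventually (\<lambda>w. \<mu> w ^ 2 - wp z - wp w = wp (z + w)) (at z)"
    using ev by eventually_elim (use wp_addition(1)[OF z(1)] in \<open>simp add: \<mu>_def\<close>)
  moreover have "((\<lambda>w. \<mu> w ^ 2 - wp z - wp w) \<longlongrightarrow> m ^ 2 - wp z - wp z) (at z)"
    by (intro tendsto_intros \<mu> c)
  ultimately have "((\<lambda>w. wp (z + w)) \<longlongrightarrow> m ^ 2 - wp z - wp z) (at z)"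
    by (rule Lim_transform_eventually[rotated])
  then show "wp (2 * z) = m ^ 2 - wp z - wp z" using c2(1) LIM_unique by blast
  have "eventually (\<lambda>w. 2 * \<mu> w * (wp z - wp (z + w)) - wp' z = wp' (z + w)) (at z)"
    using ev by eventually_elim (use wp_addition(2)[OF z(1)] in \<open>simp add: \<mu>_def\<close>)
  moreover have "((\<lambda>w. 2 * \<mu> w * (wp z - wp (z + w)) - wp' z) \<longlongrightarrow> 2 * m * (wp z - wp (2 * z)) - wp' z) (at z)"
    by (intro tendsto_intros \<mu> c2)
  ultimately have "((\<lambda>w. wp' (z + w)) \<longlongrightarrow> 2 * m * (wp z - wp (2 * z)) - wp' z) (at z)"
    by (rule Lim_transform_eventually[rotated])
  then show "wp' (2 * z) = 2 * m * (wp z - wp (2 * z)) - wp' z" using c2(2) LIM_unique by blast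
qed

section \<open>The real period\<close>

definition rp :: "real \<Rightarrow> real" where "rp t = Re (wp (of_real t))"
definition rp' :: "real \<Rightarrow> real" where "rp' t = Re (wp' (of_real t))"

lemma wp_of_real: "wp (of_real t) = of_real (rp t)"
  using wp_cnj[of "of_real t"] by (simp add: rp_def complex_eq_iff)

lemma of_real_notin: "0 < t \<Longrightarrow> t < \<omega> \<Longrightarrow> of_real t \<notin> \<Lambda>"
  using lattice_norm_ge[of "of_real t"] by auto

lemma rp_derivatives:
  assumes "of_real t \<notin> \<Lambda>"
  shows "(rp has_real_derivative rp' t) (at t)" "wp' (of_real t) = of_real (rp' t)" "isCont rp' t"
proof -
  have "((\<lambda>t. wp (of_real t)) has_vector_derivative wp' (of_real t)) (at t)"
    using has_vector_derivative_real_field[of wp "wp' (of_real t)" t UNIV]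
      wp_has_derivative[OF DERIV_ident, of "of_real t" UNIV] assms by simp
  note V = this
  have D: "(rp has_real_derivative rp' t) (at t)"
    using bounded_linear.has_vector_derivative[OF bounded_linear_Re V]
    by (simp add: has_real_derivative_iff_has_vector_derivative rp_def[abs_def] rp'_def)
  \<comment> \<open>On the real axis the imaginary part of \<wp> is constantly 0, so its derivative
    is too.\<close>
  have D0: "((\<lambda>t. 0) has_real_derivative Im (wp' (of_real t))) (at t)"
    using bounded_linear.has_vector_derivative[OF bounded_linear_Im V]
    by (simp add: has_real_derivative_iff_has_vector_derivative wp_of_real)
  show "(rp has_real_derivative rp' t) (at t)" by (rule D)
  have "Im (wp' (of_real t)) = 0" using D0 DERIV_unique DERIV_const by blast
  then show "wp' (of_real t) = of_real (rp' t)" by (simp add: rp'_def complex_eq_iff)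
  have "isCont (\<lambda>t. wp' (of_real t)) t"
    by (rule isCont_wp(2)) (use assms in simp_all)
  then show "isCont rp' t" unfolding rp'_def[abs_def] by (intro isCont_Re) auto
qed

definition re1 :: real where "re1 = rp (\<omega> / 2)"

lemma e1_real: "e1 = of_real re1"
  by (simp only: e1_def re1_def wp_of_real)

lemma rp_first_order:
  assumes "of_real t \<notin> \<Lambda>"
  shows "rp' t ^ 2 = 4 * rp t * (rp t - re1) * (rp t + re1)"
proof -
  have "(of_real (rp' t ^ 2) :: complex) = of_real (4 * rp t * (rp t - re1) * (rp t + re1))"
    using wp_first_order[OF assms]
    by (simp add: rp_derivatives[OF assms] wp_of_real wpC_eq e1_real) (simp add: algebra_simps eval_nat_numeral)
  then show ?thesis by (simp only: of_real_eq_iff)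
qed

lemma rp_at_0: "filterlim rp at_top (at_right 0)"
proof -
  have "((\<lambda>t::real. (of_real t :: complex)) \<longlongrightarrow> of_real 0) (at_right 0)" by (intro tendsto_intros)
  then have "filterlim (of_real :: real \<Rightarrow> complex) (at 0) (at_right 0)"
    by (auto simp: filterlim_at eventually_at_filter)
  from filterlim_compose[OF wp_lim this]
  have "((\<lambda>t. of_real (t ^ 2 * rp t) :: complex) \<longlongrightarrow> of_real 1) (at_right 0)"
    by (simp add: wp_of_real)
  then have 1: "((\<lambda>t. t ^ 2 * rp t) \<longlongrightarrow> 1) (at_right 0)" by (simp only: tendsto_of_real_iff)
  have 2: "filterlim (\<lambda>t::real. 1 / t ^ 2) at_top (at_right 0)" by real_asymp
  have "filterlim (\<lambda>t. t ^ 2 * rp t * (1 / t ^ 2)) at_top (at_right 0)"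
    by (rule filterlim_tendsto_pos_mult_at_top[OF 1 _ 2]) simp
  then show ?thesis
    by (rule filterlim_mono_eventually) (auto simp: eventually_at_filter)
qed

text \<open>There are no half periods strictly between 0 and \<omega>/2, so \<wp>' has no zero
  there. If it were positive at t, it would be positive on (0, t], against \<wp> \<rightarrow>
  +infinity at 0.\<close>

lemma rp'_neg:
  assumes t: "0 < t" "t < \<omega> / 2"
  shows "rp' t < 0"
proof (rule ccontr)
  assume "\<not> rp' t < 0"
  have notin: "of_real s \<notin> \<Lambda>" "of_real (2 * s) \<notin> \<Lambda>" if "0 < s" "s < \<omega> / 2" for s
    using that \<omega>_pos by (intro of_real_notin; linarith)+
  have nz: "rp' s \<noteq> 0" if "0 < s" "s < \<omega> / 2" for s
    using notin[OF that] wp'_eq_0_iff[of "of_real s"] rp_derivatives(2)[of s] by auto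
  have pos: "0 < rp' s" if s: "0 < s" "s \<le> t" for s
  proof (rule ccontr)
    assume "\<not> 0 < rp' s"
    then have "rp' s \<le> 0" "0 \<le> rp' t" using \<open>\<not> rp' t < 0\<close> by auto
    then have "\<exists>x. s \<le> x \<and> x \<le> t \<and> rp' x = 0"
      using s t by (intro IVT) (auto intro!: rp_derivatives(3)[OF notin(1)])
    then show False using nz s t by force
  qed
  have "eventually (\<lambda>s. rp s > rp t) (at_right 0)" using rp_at_0 by (simp add: filterlim_at_top_dense)
  then obtain b where b: "0 < b" "\<forall>s>0. s < b \<longrightarrow> rp s > rp t"
    unfolding eventually_at_right[OF t(1)] by blast
  define s where "s = min b t / 2"
  have s: "0 < s" "s < b" "s < t" using b(1) t by (auto simp: s_def)
  have "rp s < rp t"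
    using s t pos
    by (intro DERIV_pos_imp_increasing[of s t rp]) (auto intro!: exI[of _ "rp' _"] rp_derivatives(1)[OF notin(1)])
  then show False using b(2) s by force
qed

text \<open>Were e negative, \<wp> would vanish somewhere in (0, \<omega>/2). By the first-order
  equation \<wp>' would vanish at the same point.\<close>

lemma re1_pos: "0 < re1" and rp_gt: "\<And>t. 0 < t \<Longrightarrow> t < \<omega> / 2 \<Longrightarrow> re1 < rp t"
proof -
  have notin: "of_real s \<notin> \<Lambda>" if "0 < s" "s \<le> \<omega> / 2" for s
    using that \<omega>_pos by (intro of_real_notin) auto
  show gt: "re1 < rp t" if t: "0 < t" "t < \<omega> / 2" for t
    unfolding re1_def
  proof (rule DERIV_neg_imp_decreasing_open[OF t(2)])
    show "\<exists>y. (rp has_real_derivative y) (at x) \<and> y < 0" if "t < x" "x < \<omega> / 2" for x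
      using that t rp'_neg[of x] rp_derivatives(1)[OF notin[of x]] by auto
    show "continuous_on {t..\<omega> / 2} rp"
      using t by (intro continuous_at_imp_continuous_on ballI DERIV_isCont[OF rp_derivatives(1)] notin) auto
  qed
  have "re1 \<noteq> 0" using e1_nonzero by (simp add: e1_real)
  moreover have "\<not> re1 < 0"
  proof
    assume neg: "re1 < 0"
    have h: "0 < \<omega> / 2" using \<omega>_pos by simp
    have "eventually (\<lambda>s. rp s > 0) (at_right 0)" using rp_at_0 by (simp add: filterlim_at_top_dense)
    then obtain b where b: "0 < b" "\<forall>s>0. s < b \<longrightarrow> rp s > 0"
      unfolding eventually_at_right[OF h] by blast
    define s where "s = min b (\<omega> / 2) / 2"
    have s: "0 < s" "s < b" "s < \<omega> / 2" using b(1) h by (auto simp: s_def)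
    have "\<exists>x. s \<le> x \<and> x \<le> \<omega> / 2 \<and> rp x = 0"
      using s b(2) neg
      by (intro IVT2) (auto simp: re1_def intro!: DERIV_isCont[OF rp_derivatives(1)[OF notin]])
    then obtain x where x: "s \<le> x" "x \<le> \<omega> / 2" "rp x = 0" by blast
    then have "x < \<omega> / 2" using neg by (cases "x = \<omega> / 2") (auto simp: re1_def)
    then show False
      using rp_first_order[OF notin[of x]] rp'_neg[of x] x s by simp
  qed
  ultimately show "0 < re1" by simp
qed

theorem period_agm: "\<omega> * sqrt re1 = pi * gauss_constant"
proof -
  define a b where "a = sqrt (2 * re1)" and "b = sqrt re1"
  have ab: "0 < b" "b \<le> a" "0 < a" using re1_pos by (auto simp: a_def b_def)
  define x where "x = (\<lambda>t. sqrt (rp t - re1))"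
  have notin: "of_real s \<notin> \<Lambda>" if "0 < s" "s \<le> \<omega> / 2" for s
    using that \<omega>_pos by (intro of_real_notin) auto
  have h: "0 < \<omega> / 2" using \<omega>_pos by simp
  have xpos: "0 < x t" if "0 < t" "t < \<omega> / 2" for t
    using rp_gt[OF that] by (simp add: x_def)
  \<comment> \<open>The factor is -1 because x falls from +infinity to 0.\<close>
  have x': "(x has_real_derivative (- 1) * sqrt (((x t)\<^sup>2 + a\<^sup>2) * ((x t)\<^sup>2 + b\<^sup>2))) (at t)"
    if t: "0 < t" "t < \<omega> / 2" for t
  proof -
    have x2: "(x t)\<^sup>2 = rp t - re1" using rp_gt[OF t] by (simp add: x_def)
    have "(x has_real_derivative (inverse (sqrt (rp t - re1)) / 2) * rp' t) (at t)"
      unfolding x_def using rp_gt[OF t] rp_derivatives(1)[OF notin[of t]] t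
      by (auto intro!: derivative_eq_intros)
    moreover have "rp' t = - (2 * (x t * sqrt (((x t)\<^sup>2 + a\<^sup>2) * ((x t)\<^sup>2 + b\<^sup>2))))"
    proof -
      have "(- rp' t) ^ 2 = 4 * rp t * (rp t - re1) * (rp t + re1)"
        using rp_first_order[OF notin[of t]] t by simp
      also have "\<dots> = 4 * ((x t)\<^sup>2 * (((x t)\<^sup>2 + a\<^sup>2) * ((x t)\<^sup>2 + b\<^sup>2)))"
        unfolding x2 using re1_pos by (simp add: a_def b_def)
      finally have "sqrt ((- rp' t) ^ 2) = 2 * (x t * sqrt (((x t)\<^sup>2 + a\<^sup>2) * ((x t)\<^sup>2 + b\<^sup>2)))"
        using xpos[OF t] by (simp only: real_sqrt_mult real_sqrt_abs) simp
      then show ?thesis using rp'_neg[OF t] by simp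
    qed
    moreover have "sqrt (rp t - re1) = x t" by (simp add: x_def)
    ultimately show ?thesis using xpos[OF t] by (simp flip: mult.assoc)
  qed
  have xtop: "filterlim x at_top (at_right 0)"
    unfolding x_def
  proof (rule filterlim_compose[OF sqrt_at_top])
    show "filterlim (\<lambda>t. rp t - re1) at_top (at_right 0)"
    proof -
      have "(\<lambda>t. rp t - re1) = (\<lambda>t. - re1 + rp t)" by auto
      then show ?thesis by (simp only: filterlim_tendsto_add_at_top[OF tendsto_const rp_at_0])
    qed
  qed
  have xzero: "filterlim x (at_right 0) (at_left (\<omega> / 2))"
  proof -
    have "isCont rp (\<omega> / 2)" using h by (intro DERIV_isCont[OF rp_derivatives(1)] notin) auto
    then have "(rp \<longlongrightarrow> re1) (at (\<omega> / 2))" by (simp add: isCont_def re1_def)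
    then have "(x \<longlongrightarrow> sqrt (re1 - re1)) (at (\<omega> / 2))" unfolding x_def by (intro tendsto_intros)
    then have lim: "(x \<longlongrightarrow> 0) (at (\<omega> / 2))" by simp
    have "(x \<longlongrightarrow> 0) (at_left (\<omega> / 2))" by (rule tendsto_mono[OF at_le[OF subset_UNIV] lim])
    moreover have "eventually (\<lambda>t. x t \<in> {0<..} \<and> x t \<noteq> 0) (at_left (\<omega> / 2))"
      unfolding eventually_at_left[OF h] using xpos h by (intro exI[of _ 0]) force
    ultimately show ?thesis by (simp add: filterlim_at)
  qed
  \<comment> \<open>As x falls to 0, u falls from +infinity to -infinity. Its negative therefore
    satisfies \<open>agm_flow\<close> with c = 2 on (0, \<omega>/2), and c times the length is
    \<omega>.\<close>
  define u where "u = (\<lambda>t. (x t - a * b / x t) / 2)"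
  have d: "0 < a * b" using ab by simp
  have "agm_flow ((a + b) / 2) (sqrt (a * b)) 2 (\<lambda>t. - u t) 0 (\<omega> / 2)"
    unfolding agm_flow_def
  proof (intro conjI ballI h)
    fix t assume "t \<in> {0<..<\<omega> / 2}"
    then have t: "0 < t" "t < \<omega> / 2" by auto
    have "x t \<noteq> 0" using xpos[OF t] by simp
    from DERIV_minus[OF landen_derivative[OF x'[OF t] this ab(3,1)]]
    show "((\<lambda>t. - u t) has_real_derivative
      2 * sqrt (((- u t)\<^sup>2 + ((a + b) / 2)\<^sup>2) * ((- u t)\<^sup>2 + (sqrt (a * b))\<^sup>2))) (at t)"
      by (simp add: u_def)
  next
    show "filterlim (\<lambda>t. - u t) at_bot (at_right 0)"
      unfolding u_def filterlim_uminus_at_bot[symmetric] using landen_limits(1)[OF d xtop]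
      by (simp only: filterlim_uminus_at_bot minus_minus)
    show "filterlim (\<lambda>t. - u t) at_top (at_left (\<omega> / 2))"
      unfolding u_def using landen_limits(3)[OF d xzero] by (simp only: filterlim_uminus_at_bot)
  qed
  from agm_flow_period[OF this gm_le_am(3,2)[OF ab(1,2)]]
  have "\<omega> * agm ((a + b) / 2) (sqrt (a * b)) = pi" by simp
  then have "\<omega> * agm a b = pi" using agm_step[OF ab(1,2)] by simp
  moreover have "agm a b = sqrt re1 * agm (sqrt 2) 1"
    using agm_scale[of 1 "sqrt 2" "sqrt re1"] re1_pos by (simp add: a_def b_def real_sqrt_mult mult.commute)
  moreover have "0 < agm (sqrt 2) 1" by (rule agm_pos) auto
  ultimately show ?thesis by (simp add: gauss_constant_def field_simps)
qed

end

section \<open>The Lie group isomorphism\<close>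

lemma openin_ec_affine:
  assumes "open B"
  shows "openin (ec_topology a b) {P \<in> ec_points a b. \<exists>x y. P = Some (x, y) \<and> (x, y) \<in> B}" (is "openin _ ?V")
proof -
  define T where "T = {p :: complex \<times> complex \<times> complex. snd (snd p) \<noteq> 0} \<inter>
    (\<lambda>p. (fst p / snd (snd p), fst (snd p) / snd (snd p))) -` B"
  have "continuous_on {p :: complex \<times> complex \<times> complex. snd (snd p) \<noteq> 0}
      (\<lambda>p. (fst p / snd (snd p), fst (snd p) / snd (snd p)))"
    by (intro continuous_intros) auto
  moreover have "open {p :: complex \<times> complex \<times> complex. snd (snd p) \<noteq> 0}"
    by (intro open_Collect_neq continuous_intros)
  ultimately have "open T" unfolding T_def using assms by (rule continuous_open_preimage)
  moreover have "{p \<in> ec_cone a b. ec_proj p \<in> ?V} = ec_cone a b \<inter> T"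
  proof -
    have "ec_proj p \<in> ?V \<longleftrightarrow> p \<in> T" if "p \<in> ec_cone a b" for p
    proof -
      have "ec_proj p \<in> ec_proj ` topspace (top_of_set (ec_cone a b))" using that by simp
      then have "ec_proj p \<in> ec_points a b"
        using topspace_ec_topology[of a b] unfolding ec_topology_def topspace_quotient_topology by blast
      then show ?thesis by (cases p) (auto simp: T_def)
    qed
    then show ?thesis by blast
  qed
  moreover have "?V \<subseteq> ec_proj ` topspace (top_of_set (ec_cone a b))"
    using topspace_ec_topology[of a b] unfolding ec_topology_def topspace_quotient_topology by blast
  ultimately show ?thesis
    unfolding ec_topology_def openin_quotient_topology by (auto simp: openin_open)
qed

text \<open>Neighbourhoods of infinity. On the cone the condition reads r |Z| < |Y|, which is open
  and also holds at Z = 0, where X = 0 and hence Y is nonzero.\<close>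

lemma openin_ec_infinity:
  assumes "0 \<le> r"
  shows "openin (ec_topology a b) {P \<in> ec_points a b. P = None \<or> r < norm (ec_y P)}" (is "openin _ ?V")
proof -
  define T where "T = {p :: complex \<times> complex \<times> complex. r * norm (snd (snd p)) < norm (fst (snd p))}"
  have "open T" unfolding T_def by (intro open_Collect_less continuous_intros)
  moreover have "{p \<in> ec_cone a b. ec_proj p \<in> ?V} = ec_cone a b \<inter> T"
  proof -
    have "ec_proj p \<in> ?V \<longleftrightarrow> p \<in> T" if "p \<in> ec_cone a b" for p
    proof -
      have "ec_proj p \<in> ec_proj ` topspace (top_of_set (ec_cone a b))" using that by simp
      then have "ec_proj p \<in> ec_points a b"
        using topspace_ec_topology[of a b] unfolding ec_topology_def topspace_quotient_topology by blast
      then show ?thesis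
        using that by (cases p) (auto simp: T_def ec_cone_def norm_divide field_simps)
    qed
    then show ?thesis by blast
  qed
  moreover have "?V \<subseteq> ec_proj ` topspace (top_of_set (ec_cone a b))"
    using topspace_ec_topology[of a b] unfolding ec_topology_def topspace_quotient_topology by blast
  ultimately show ?thesis
    unfolding ec_topology_def openin_quotient_topology by (auto simp: openin_open)
qed

lemma Hausdorff_ec_topology: "Hausdorff_space (ec_topology a b)"
proof -
  let ?E = "ec_points a b"
  let ?A = "\<lambda>B. {P \<in> ?E. \<exists>x y. P = Some (x, y) \<and> (x, y) \<in> B}"
  let ?I = "\<lambda>r. {P \<in> ?E. P = None \<or> r < norm (ec_y P)}"
  have inf: "\<exists>U V. openin (ec_topology a b) U \<and> openin (ec_topology a b) V \<and> None \<in> U \<and> Some (x, y) \<in> V \<and> disjnt U V"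
    if P: "Some (x, y) \<in> ?E" for x y
  proof -
    define r where "r = norm y + 1"
    have "open {p :: complex \<times> complex. norm (snd p) < r}"
      by (intro open_Collect_less continuous_intros)
    from openin_ec_affine[OF this] have "openin (ec_topology a b) (?A {p. norm (snd p) < r})" .
    moreover have "openin (ec_topology a b) (?I r)" by (rule openin_ec_infinity) (simp add: r_def)
    moreover have "None \<in> ?I r" by (simp add: ec_points_def)
    moreover have "Some (x, y) \<in> ?A {p. norm (snd p) < r}" using P by (simp add: r_def)
    moreover have "disjnt (?I r) (?A {p. norm (snd p) < r})" by (auto simp: disjnt_def)
    ultimately show ?thesis by blast
  qed
  show ?thesis
    unfolding Hausdorff_space_def topspace_ec_topology
  proof (intro allI impI, elim conjE)
    fix P Q assume PQ: "P \<in> ?E" "Q \<in> ?E" "P \<noteq> Q"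
    show "\<exists>U V. openin (ec_topology a b) U \<and> openin (ec_topology a b) V \<and> P \<in> U \<and> Q \<in> V \<and> disjnt U V"
    proof (cases P)
      case None
      then show ?thesis using inf PQ by (cases Q) auto
    next
      case (Some p)
      show ?thesis
      proof (cases Q)
        case None
        obtain x y where "P = Some (x, y)" using Some by (cases p) auto
        then obtain U V where "openin (ec_topology a b) U" "openin (ec_topology a b) V" "None \<in> U" "P \<in> V" "disjnt U V"
          using inf PQ(1) by blast
        then show ?thesis using None disjnt_sym by blast
      next
        case (Some q)
        then obtain B C where BC: "open B" "open C" "p \<in> B" "q \<in> C" "B \<inter> C = {}"
          using separation_t2[of p q] PQ(3) \<open>P = Some p\<close> by auto
        moreover have "P \<in> ?A B" using BC \<open>P = Some p\<close> PQ by (cases p) auto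
        moreover have "Q \<in> ?A C" using BC Some PQ by (cases q) auto
        moreover have "disjnt (?A B) (?A C)" using BC(5) by (auto simp: disjnt_def)
        ultimately show ?thesis
          by (intro exI[of _ "?A B"] exI[of _ "?A C"] conjI openin_ec_affine)
      qed
    qed
  qed
qed

text \<open>Continuity into the curve is tested by lifting to homogeneous coordinates.\<close>

lemma open_preimage_ec_proj:
  assumes D: "open D" and g: "continuous_on D g" "\<And>z. z \<in> D \<Longrightarrow> g z \<in> ec_cone a b"
    and V: "openin (ec_topology a b) V"
  shows "open {z \<in> D. ec_proj (g z) \<in> V}"
proof -
  have "openin (top_of_set (ec_cone a b)) {p \<in> ec_cone a b. ec_proj p \<in> V}"
    using V unfolding ec_topology_def openin_quotient_topology by simp
  then obtain T where T: "open T" "{p \<in> ec_cone a b. ec_proj p \<in> V} = ec_cone a b \<inter> T"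
    by (auto simp: openin_open)
  have "{z \<in> D. ec_proj (g z) \<in> V} = D \<inter> g -` T" using g(2) T(2) by blast
  then show ?thesis using continuous_open_preimage[OF g(1) D T(1)] by simp
qed

lemma group_complex_add: "group complex_add_group"
proof (rule groupI)
  fix x assume "x \<in> carrier complex_add_group"
  have "- x \<in> carrier complex_add_group \<and> - x \<otimes>\<^bsub>complex_add_group\<^esub> x = \<one>\<^bsub>complex_add_group\<^esub>"
    by (simp add: complex_add_group_def)
  then show "\<exists>y\<in>carrier complex_add_group. y \<otimes>\<^bsub>complex_add_group\<^esub> x = \<one>\<^bsub>complex_add_group\<^esub>" by blast
qed (simp_all add: complex_add_group_def)

lemma group_monoid_extend:
  assumes "group G"
  shows "group (monoid.extend G r)"
proof -
  interpret group G by (rule assms)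
  have eq: "carrier (monoid.extend G r) = carrier G" "mult (monoid.extend G r) = mult G"
    "one (monoid.extend G r) = one G"
    by (simp_all add: monoid.defs)
  show ?thesis
    by (rule groupI) (simp_all only: eq m_closed one_closed m_assoc l_one l_inv_ex)
qed

context square_lattice
begin

section \<open>The parametrization of the curve by the plane\<close>

abbreviation a_coeff :: complex where "a_coeff \<equiv> wpC / 2"

text \<open>The Weierstrass map with y halved, still on the plane. Addition and charts are treated
  for it before anything descends to cosets.\<close>

definition W :: "complex \<Rightarrow> ec_point" where
  "W z = (if z \<in> \<Lambda> then None else Some (wp z, wp' z / 2))"

lemma W_eq: "(halve_y \<circ> weierstrass_map \<Lambda>) z = W z"
  by (simp add: W_def halve_y_def weierstrass_map_def)

lemma W_on_curve: "W z \<in> ec_points a_coeff 0"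
proof (cases "z \<in> \<Lambda>")
  case False
  then have "(wp' z / 2) ^ 2 = wp z ^ 3 + a_coeff * wp z + 0"
    by (simp add: wp_first_order power_divide)
  then show ?thesis unfolding ec_points_def using False by (simp only: W_def if_False) blast
qed (simp add: W_def ec_points_def)

lemma W_periodic: "m \<in> \<Lambda> \<Longrightarrow> W (z + m) = W z"
  by (simp add: W_def lattice_add_iff wp_periodic wp'_periodic)

lemma W_eq_iff: "W z = W w \<longleftrightarrow> z - w \<in> \<Lambda>"
proof
  assume eq: "W z = W w"
  show "z - w \<in> \<Lambda>"
  proof (cases "z \<in> \<Lambda>")
    case True
    then have "w \<in> \<Lambda>" using eq by (simp add: W_def split: if_splits)
    then show ?thesis using True lattice_diff by blast
  next
    case False
    then have "w \<notin> \<Lambda>" using eq by (auto simp: W_def split: if_splits)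
    then show ?thesis using eq False wp_inj[of z w] by (simp add: W_def)
  qed
next
  assume "z - w \<in> \<Lambda>"
  from W_periodic[OF this, of w] show "W z = W w" by simp
qed

lemma W_surj: "range W = ec_points a_coeff 0"
proof
  show "range W \<subseteq> ec_points a_coeff 0" using W_on_curve by auto
  show "ec_points a_coeff 0 \<subseteq> range W"
  proof
    fix P assume P: "P \<in> ec_points a_coeff 0"
    show "P \<in> range W"
    proof (cases P)
      case None
      then have "P = W 0" by (simp add: W_def)
      then show ?thesis by blast
    next
      case (Some q)
      then obtain x y where q: "P = Some (x, y)" "y ^ 2 = x ^ 3 + a_coeff * x"
        using P by (auto simp: ec_points_def)
      obtain z where z: "z \<notin> \<Lambda>" "wp z = x" using wp_surj by blast
      have "(wp' z / 2) ^ 2 = y ^ 2"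
        using wp_first_order[OF z(1)] q(2) z(2) by (simp add: power_divide)
      then have "y = wp' z / 2 \<or> y = - (wp' z / 2)" by (metis power2_eq_iff)
      then have "P = W z \<or> P = W (- z)"
        using q z by (auto simp: W_def wp_minus wp'_minus)
      then show ?thesis by blast
    qed
  qed
qed

text \<open>The cases follow the branches of \<open>ec_add\<close>: opposite points, equal points
  (tangent) and distinct abscissae (chord).\<close>

lemma W_add: "W (z + w) = ec_add a_coeff (W z) (W w)"
proof (cases "z \<in> \<Lambda> \<or> w \<in> \<Lambda>")
  case True
  then show ?thesis
  proof
    assume z: "z \<in> \<Lambda>"
    then show ?thesis using W_periodic[OF z, of w] by (simp add: add.commute) (simp add: W_def)
  next
    assume w: "w \<in> \<Lambda>"
    then have "W w = None" by (simp add: W_def)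
    then show ?thesis using W_periodic[OF w, of z] by (cases "W z") auto
  qed
next
  case False
  then have zw: "z \<notin> \<Lambda>" "w \<notin> \<Lambda>" by auto
  then have Wz: "W z = Some (wp z, wp' z / 2)" and Ww: "W w = Some (wp w, wp' w / 2)"
    by (auto simp: W_def)
  consider "z + w \<in> \<Lambda>" | "z + w \<notin> \<Lambda>" "z - w \<in> \<Lambda>" | "z + w \<notin> \<Lambda>" "z - w \<notin> \<Lambda>" by blast
  then show ?thesis
  proof cases
    case 1
    then have "W z = W (- w)" by (simp add: W_eq_iff)
    then have "wp z = wp w" "wp' z = - wp' w" using zw by (auto simp: W_def wp_minus wp'_minus)
    then show ?thesis using 1 by (simp add: Wz Ww) (simp add: W_def)
  next
    case 2
    then have eq: "W w = W z" by (simp add: W_eq_iff[of z w, symmetric])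
    have "W (z + w) = W (z + z)"
      using 2(2) by (subst W_eq_iff) (metis add_diff_cancel_left lattice_minus minus_diff_eq)
    then have W2: "W (z + w) = W (2 * z)" by (simp only: mult_2)
    have z2: "2 * z \<notin> \<Lambda>"
    proof
      assume "2 * z \<in> \<Lambda>"
      from lattice_diff[OF this 2(2)] have "z + w \<in> \<Lambda>" by simp
      then show False using 2(1) by blast
    qed
    have nz: "wp' z \<noteq> 0" using wp'_eq_0_iff zw(1) z2 by blast
    define m where "m = wp'' z / (2 * wp' z)"
    \<comment> \<open>With y = \<wp>'/2 and a = C/2 the tangent slope is (3 \<wp>^2 + C/2) / \<wp>',
      half of \<wp>'' / \<wp>'.\<close>
    have slope: "(3 * wp z ^ 2 + a_coeff) / (2 * (wp' z / 2)) = m"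
      unfolding m_def wp_second_order[OF zw(1)] using nz by (simp add: field_simps)
    note dup = wp_duplication[OF zw(1) z2, folded m_def]
    have "\<not> wp' z / 2 = - (wp' z / 2)" using nz by simp
    then have "ec_add a_coeff (W z) (W z) =
        (let x3 = m ^ 2 - wp z - wp z in Some (x3, m * (wp z - x3) - wp' z / 2))"
      unfolding Wz using slope by simp
    also have "\<dots> = Some (wp (2 * z), m * (wp z - wp (2 * z)) - wp' z / 2)"
      by (simp add: dup(1) Let_def)
    also have "m * (wp z - wp (2 * z)) - wp' z / 2 = wp' (2 * z) / 2"
      unfolding dup(2) by (simp add: field_simps)
    finally show ?thesis using z2 by (simp add: W2 eq) (simp add: W_def)
  next
    case 3
    define m where "m = (wp' z - wp' w) / (2 * (wp z - wp w))"
    note add = wp_addition[OF zw 3, folded m_def]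
    have ne: "wp z \<noteq> wp w" using wp_eq_cases zw 3 by blast
    have slope: "(wp' w / 2 - wp' z / 2) / (wp w - wp z) = m"
    proof -
      have "(wp' w / 2 - wp' z / 2) / (wp w - wp z) = (- (wp' z - wp' w) / 2) / (- (wp z - wp w))"
        by (simp add: diff_divide_distrib)
      also have "\<dots> = m" unfolding m_def by (simp only: minus_divide_left[symmetric] minus_divide_right[symmetric] minus_minus) simp
      finally show ?thesis .
    qed
    have "ec_add a_coeff (W z) (W w) =
        (let x3 = m ^ 2 - wp z - wp w in Some (x3, m * (wp z - x3) - wp' z / 2))"
      unfolding Wz Ww using slope ne by simp
    also have "\<dots> = Some (wp (z + w), m * (wp z - wp (z + w)) - wp' z / 2)"
      by (simp add: add(1) Let_def)
    also have "m * (wp z - wp (z + w)) - wp' z / 2 = wp' (z + w) / 2"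
      unfolding add(2) by (simp add: field_simps)
    finally show ?thesis using 3 by (simp add: W_def)
  qed
qed

text \<open>Local lifts to the cone: (\<wp>, \<wp>'/2, 1) off the lattice, and the same triple times
  s^3 near a lattice point, where s is the displacement. The scaling removes the poles and gives (0,
  -1, 0) at s = 0.\<close>

lemma W_continuous: "continuous_map euclidean (ec_topology a_coeff 0) W"
proof -
  have loc: "\<exists>N. open N \<and> z0 \<in> N \<and> (\<forall>V. openin (ec_topology a_coeff 0) V \<longrightarrow> open {z \<in> N. W z \<in> V})" for z0
  proof (cases "z0 \<in> \<Lambda>")
    case False
    define g where "g = (\<lambda>z. (wp z, wp' z / 2, 1 :: complex))"
    have "continuous_on (- \<Lambda>) g" unfolding g_def
      by (intro continuous_intros holomorphic_on_imp_continuous_on wp_holomorphic wp'_holomorphic) auto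
    moreover have "g z \<in> ec_cone a_coeff 0" if "z \<in> - \<Lambda>" for z
      using wp_first_order[of z] that by (simp add: g_def ec_cone_def power_divide)
    ultimately have "open {z \<in> - \<Lambda>. ec_proj (g z) \<in> V}" if "openin (ec_topology a_coeff 0) V" for V
      using open_preimage_ec_proj[OF open_compl_lattice _ _ that] by blast
    moreover have "{z \<in> - \<Lambda>. ec_proj (g z) \<in> V} = {z \<in> - \<Lambda>. W z \<in> V}" for V
      by (auto simp: g_def W_def)
    ultimately show ?thesis using False open_compl_lattice by (intro exI[of _ "- \<Lambda>"]) auto
  next
    case True
    define g where "g = (\<lambda>z. let s = z - z0 in
      (s + s ^ 3 * wreg s, - 1 + s ^ 3 * deriv wreg s / 2, s ^ 3))"
    have gW: "g z \<in> ec_cone a_coeff 0 \<and> ec_proj (g z) = W z" if z: "z \<in> ball z0 \<omega>" for z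
    proof (cases "z = z0")
      case True
      then show ?thesis using \<open>z0 \<in> \<Lambda>\<close> by (simp add: g_def ec_cone_def W_def)
    next
      case False
      define s where "s = z - z0"
      have s: "s \<noteq> 0" "s \<in> ball 0 \<omega>" using False z by (auto simp: s_def dist_norm norm_minus_commute)
      then have sl: "s \<notin> \<Lambda>" using lattice_ball by blast
      have X: "s + s ^ 3 * wreg s = s ^ 3 * wp s" and Y: "- 1 + s ^ 3 * deriv wreg s / 2 = s ^ 3 * (wp' s / 2)"
        using s by (simp_all add: wp_eq wp'_eq[OF sl] field_simps eval_nat_numeral)
      have g: "g z = (s ^ 3 * wp s, s ^ 3 * (wp' s / 2), s ^ 3)"
        by (simp only: g_def Let_def s_def[symmetric] X Y)
      have "W z = W s" using W_eq_iff[of z s] \<open>z0 \<in> \<Lambda>\<close> by (simp add: s_def)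
      moreover have "g z \<in> ec_cone a_coeff 0"
      proof -
        have "(s ^ 3 * (wp' s / 2)) ^ 2 * s ^ 3 = (s ^ 3) ^ 3 * (wp' s ^ 2 / 4)"
          by (simp add: power_mult_distrib power_divide eval_nat_numeral)
        also have "\<dots> = (s ^ 3 * wp s) ^ 3 + a_coeff * (s ^ 3 * wp s) * (s ^ 3) ^ 2"
          unfolding wp_first_order[OF sl] by (simp add: field_simps eval_nat_numeral)
        finally show ?thesis using s by (simp add: g ec_cone_def)
      qed
      ultimately show ?thesis using s sl by (simp add: g W_def)
    qed
    have "continuous_on (ball z0 \<omega>) g"
    proof -
      have "wreg holomorphic_on ball 0 \<omega>" "deriv wreg holomorphic_on ball 0 \<omega>" by (rule wreg_holomorphic_ball)+
      then have "continuous_on (ball 0 \<omega>) wreg" "continuous_on (ball 0 \<omega>) (deriv wreg)"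
        using holomorphic_on_imp_continuous_on by blast+
      then have "continuous_on (ball z0 \<omega>) (\<lambda>z. wreg (z - z0))" "continuous_on (ball z0 \<omega>) (\<lambda>z. deriv wreg (z - z0))"
        by (auto intro!: continuous_on_compose2[of "ball 0 \<omega>" _ "ball z0 \<omega>" "\<lambda>z. z - z0"] continuous_intros
            simp: dist_norm norm_minus_commute)
      then show ?thesis unfolding g_def Let_def by (intro continuous_intros) auto
    qed
    then have "open {z \<in> ball z0 \<omega>. ec_proj (g z) \<in> V}" if "openin (ec_topology a_coeff 0) V" for V
      using open_preimage_ec_proj[OF open_ball _ _ that] gW by blast
    moreover have "{z \<in> ball z0 \<omega>. ec_proj (g z) \<in> V} = {z \<in> ball z0 \<omega>. W z \<in> V}" for V
      using gW by auto
    ultimately show ?thesis using \<omega>_pos by (intro exI[of _ "ball z0 \<omega>"]) auto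
  qed
  have "open {z. W z \<in> V}" if V: "openin (ec_topology a_coeff 0) V" for V
  proof (subst open_subopen, intro ballI)
    fix z0 assume z0: "z0 \<in> {z. W z \<in> V}"
    obtain N where "open N" "z0 \<in> N" "open {z \<in> N. W z \<in> V}" using loc[of z0] V by blast
    then show "\<exists>T. open T \<and> z0 \<in> T \<and> T \<subseteq> {z. W z \<in> V}"
      using z0 by (intro exI[of _ "{z \<in> N. W z \<in> V}"]) auto
  qed
  then show ?thesis
    using W_on_curve by (simp add: continuous_map_def topspace_ec_topology)
qed

section \<open>The torus and the induced homeomorphism\<close>

abbreviation pr :: "complex \<Rightarrow> complex set" where "pr \<equiv> torus_proj \<Lambda>"
abbreviation torus_top :: "complex set topology" where "torus_top \<equiv> quotient_topology euclidean pr"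

lemma pr_eq: "pr z = (\<lambda>l. l + z) ` \<Lambda>"
  by (auto simp: torus_proj_def r_coset_def complex_add_group_def)

lemma pr_eq_iff: "pr z = pr w \<longleftrightarrow> z - w \<in> \<Lambda>"
proof
  assume "pr z = pr w"
  moreover have "z \<in> pr z" unfolding pr_eq by (rule image_eqI[of _ _ 0]) auto
  ultimately obtain l where "l \<in> \<Lambda>" "z = l + w" by (auto simp: pr_eq)
  then show "z - w \<in> \<Lambda>" by simp
next
  assume zw: "z - w \<in> \<Lambda>"
  have "x \<in> pr z \<longleftrightarrow> x \<in> pr w" for x
  proof -
    have mem: "x \<in> pr u \<longleftrightarrow> x - u \<in> \<Lambda>" for u
      by (auto simp: pr_eq intro!: image_eqI[of _ _ "x - u"])
    show ?thesis unfolding mem using lattice_add[OF _ zw, of "x - z"] lattice_diff[OF _ zw, of "x - w"] by auto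
  qed
  then show "pr z = pr w" by blast
qed

lemma topspace_torus: "topspace torus_top = range pr"
  by (simp add: topspace_quotient_topology)

lemma pr_continuous: "continuous_map euclidean torus_top pr"
  by (simp add: continuous_map_def topspace_torus openin_quotient_topology)

lemma pr_open: "open_map euclidean torus_top pr"
  unfolding open_map_def
proof (intro allI impI)
  fix B :: "complex set" assume "openin euclidean B"
  then have B: "open B" by simp
  have "{z. pr z \<in> pr ` B} = (\<Union>l\<in>\<Lambda>. (\<lambda>z. l + z) ` B)"
  proof (intro Set.set_eqI iffI)
    fix z assume "z \<in> {z. pr z \<in> pr ` B}"
    then obtain b where "b \<in> B" "z - b \<in> \<Lambda>" by (auto simp: pr_eq_iff)
    then show "z \<in> (\<Union>l\<in>\<Lambda>. (\<lambda>z. l + z) ` B)" by (intro UN_I[of "z - b"]) auto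
  next
    fix z assume "z \<in> (\<Union>l\<in>\<Lambda>. (\<lambda>z. l + z) ` B)"
    then obtain l b where "l \<in> \<Lambda>" "b \<in> B" "z = l + b" by blast
    then have "pr z = pr b" by (simp add: pr_eq_iff)
    then show "z \<in> {z. pr z \<in> pr ` B}" using \<open>b \<in> B\<close> by simp
  qed
  moreover have "open (\<Union>l\<in>\<Lambda>. (\<lambda>z. l + z) ` B)" using B by (intro open_UN ballI open_translation)
  ultimately show "openin torus_top (pr ` B)" by (auto simp: openin_quotient_topology)
qed

abbreviation tmap :: "complex set \<Rightarrow> ec_point" where "tmap \<equiv> weierstrass_torus_map \<Lambda>"

lemma tmap_pr: "tmap (pr z) = W z"
proof -
  have "(halve_y \<circ> weierstrass_map \<Lambda>) ` pr z = {W z}"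
  proof -
    have "W (l + z) = W z" if "l \<in> \<Lambda>" for l using W_periodic[OF that, of z] by (simp add: add.commute)
    then have "W ` pr z = {W z}" unfolding pr_eq image_image using lattice_0 by auto
    then show ?thesis by (simp only: W_eq image_def)
  qed
  then show ?thesis by (simp add: weierstrass_torus_map_def)
qed

lemma tmap_inj: "inj_on tmap (range pr)"
  by (auto simp: inj_on_def tmap_pr W_eq_iff pr_eq_iff)

lemma tmap_continuous: "continuous_map torus_top (ec_topology a_coeff 0) tmap"
proof -
  have "openin torus_top {x \<in> range pr. tmap x \<in> V}" if "openin (ec_topology a_coeff 0) V" for V
  proof -
    have "{z. pr z \<in> {x \<in> range pr. tmap x \<in> V}} = {z. W z \<in> V}" by (auto simp: tmap_pr)
    then show ?thesis
      using open_preimage_continuous_map[OF W_continuous that] by (auto simp: openin_quotient_topology)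
  qed
  then show ?thesis
    using W_on_curve by (auto simp: continuous_map_def topspace_torus topspace_ec_topology tmap_pr)
qed

lemma tmap_image: "tmap ` range pr = ec_points a_coeff 0"
  by (simp add: image_image tmap_pr W_surj)

lemma compact_torus: "compact_space torus_top"
proof -
  have "compactin torus_top (pr ` cbox 0 (Complex \<omega> \<omega>))"
    by (rule image_compactin[OF _ pr_continuous]) simp
  moreover have "pr ` cbox 0 (Complex \<omega> \<omega>) = range pr"
  proof -
    have "pr z \<in> pr ` cbox 0 (Complex \<omega> \<omega>)" for z
    proof -
      obtain l where l: "l \<in> \<Lambda>" "z - l \<in> cbox 0 (Complex \<omega> \<omega>)" by (rule lattice_translate)
      then have "pr z = pr (z - l)" by (simp add: pr_eq_iff)
      then show ?thesis using l(2) by blast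
    qed
    then show ?thesis by blast
  qed
  ultimately show ?thesis by (simp add: compact_space_def topspace_torus)
qed

lemma tmap_homeomorphic: "homeomorphic_map torus_top (ec_topology a_coeff 0) tmap"
  by (intro continuous_imp_homeomorphic_map compact_torus Hausdorff_ec_topology tmap_continuous)
     (simp_all add: topspace_torus topspace_ec_topology tmap_image tmap_inj)

text \<open>Inherited from the curve through the injective continuous map, instead of separating
  cosets by hand.\<close>

lemma Hausdorff_torus: "Hausdorff_space torus_top"
  using Hausdorff_space_injective_preimage[OF Hausdorff_ec_topology tmap_continuous] tmap_inj
  by (simp add: topspace_torus)

text \<open>Required for charts on the curve built from the plane. It is obtained through the torus:
  the projection is open and the induced map is a homeomorphism.\<close>

lemma W_open: "open_map euclidean (ec_topology a_coeff 0) W"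
  using open_map_compose[OF pr_open homeomorphic_imp_open_map[OF tmap_homeomorphic]]
  by (simp add: o_def tmap_pr)

lemma tmap_inverse_continuous:
  "continuous_map (ec_topology a_coeff 0) torus_top (inv_into (range pr) tmap)"
  unfolding continuous_map_def topspace_torus topspace_ec_topology
proof (intro conjI allI impI)
  show "inv_into (range pr) tmap \<in> ec_points a_coeff 0 \<rightarrow> range pr"
    using inv_into_into[of _ tmap "range pr"] tmap_image by auto
  fix V assume V: "openin torus_top V"
  then have sub: "V \<subseteq> range pr" using openin_subset topspace_torus by blast
  have "{P \<in> ec_points a_coeff 0. inv_into (range pr) tmap P \<in> V} = tmap ` V"
  proof (intro Set.set_eqI iffI)
    fix P assume "P \<in> {P \<in> ec_points a_coeff 0. inv_into (range pr) tmap P \<in> V}"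
    then show "P \<in> tmap ` V"
      using f_inv_into_f[of P tmap "range pr"] tmap_image by (auto intro!: image_eqI[of P tmap])
  next
    fix P assume "P \<in> tmap ` V"
    then show "P \<in> {P \<in> ec_points a_coeff 0. inv_into (range pr) tmap P \<in> V}"
      using sub tmap_image tmap_inj by (auto simp: inv_into_f_f subset_iff)
  qed
  then show "openin (ec_topology a_coeff 0) {P \<in> ec_points a_coeff 0. inv_into (range pr) tmap P \<in> V}"
    using homeomorphic_imp_open_map[OF tmap_homeomorphic] V by (simp add: open_map_def)
qed

lemma inv_tmap: "inv_into (range pr) tmap (W z) = pr z"
  using inv_into_f_f[OF tmap_inj, of "pr z"] by (simp add: tmap_pr)

section \<open>Complex structures on both sides\<close>

lemma inj_on_half_ball:
  assumes "u \<in> ball z (\<omega> / 2)" "v \<in> ball z (\<omega> / 2)" "u - v \<in> \<Lambda>"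
  shows "u = v"
proof -
  have "dist u v < \<omega>" using assms(1,2) dist_triangle[of u v z] by (simp add: dist_commute)
  then show ?thesis using lattice_norm_ge[OF assms(3)] by (force simp: dist_norm)
qed

definition torus_atlas :: "(complex set set \<times> (complex set \<Rightarrow> complex)) set" where
  "torus_atlas = {(pr ` D, inv_into D pr) | D. open D \<and> inj_on pr D}"

lemma uniformizes_torus: "uniformizes pr torus_top torus_atlas"
  unfolding uniformizes_def
proof (intro conjI allI ballI, safe)
  show "\<exists>D. open D \<and> z \<in> D \<and> inj_on pr D" for z
    using inj_on_half_ball \<omega>_pos
    by (intro exI[of _ "ball z (\<omega> / 2)"]) (auto simp: inj_on_def pr_eq_iff)
next
  fix U \<phi> assume "(U, \<phi>) \<in> torus_atlas"
  then obtain D where D: "U = pr ` D" "\<phi> = inv_into D pr" "open D" "inj_on pr D"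
    by (auto simp: torus_atlas_def)
  have id: "(\<phi> \<circ> pr) z = z" if "z \<in> D" for z using that D by (simp add: inv_into_f_f)
  have "inj_on (\<phi> \<circ> pr) D" using id by (auto simp: inj_on_def)
  moreover have "(\<phi> \<circ> pr) holomorphic_on D"
    by (rule holomorphic_transform[of "\<lambda>z. z"]) (simp_all only: id holomorphic_on_ident)
  ultimately show "complex_chart torus_top U \<phi>"
    unfolding D(1) by (intro complex_chart_of_holomorphic pr_continuous pr_open D)
  have "(\<phi> \<circ> pr) field_differentiable at z0" if z0: "pr z0 \<in> U" for z0
  proof -
    obtain d where d: "d \<in> D" "pr z0 = pr d" using z0 D(1) by auto
    \<comment> \<open>Near z0 the chart after projection is translation by this lattice
      vector.\<close>
    define l where "l = d - z0"
    have l: "l \<in> \<Lambda>" using d(2) by (metis l_def pr_eq_iff)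
    have "open ((\<lambda>z. z + l) -` D)" using D(3) by (intro open_vimage continuous_intros)
    moreover have "z0 \<in> (\<lambda>z. z + l) -` D" using d by (simp add: l_def)
    moreover have "z + l = (\<phi> \<circ> pr) z" if "z \<in> (\<lambda>z. z + l) -` D" for z
    proof -
      have "pr z = pr (z + l)" using l by (simp add: pr_eq_iff)
      then show ?thesis using id[of "z + l"] that by simp
    qed
    moreover have "((\<lambda>z. z + l) has_field_derivative 1) (at z0)" by (auto intro!: derivative_eq_intros)
    ultimately have "((\<phi> \<circ> pr) has_field_derivative 1) (at z0)"
      using has_field_derivative_transform_within_open by blast
    then show ?thesis by (auto simp: field_differentiable_def)
  qed
  then show "(\<phi> \<circ> pr) holomorphic_on {z. pr z \<in> U}"
    by (simp add: holomorphic_on_def field_differentiable_at_within)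
qed (auto simp: pr_continuous topspace_torus)

lemma riemann_surface_torus: "riemann_surface torus_top torus_atlas"
proof (rule riemann_surface_uniformized[OF uniformizes_torus Hausdorff_torus])
  fix z
  have "inj_on pr (ball z (\<omega> / 2))" using inj_on_half_ball by (auto simp: inj_on_def pr_eq_iff)
  then have "(pr ` ball z (\<omega> / 2), inv_into (ball z (\<omega> / 2)) pr) \<in> torus_atlas"
    by (auto simp: torus_atlas_def)
  moreover have "pr z \<in> pr ` ball z (\<omega> / 2)" using \<omega>_pos by simp
  ultimately show "\<exists>(U, \<phi>)\<in>torus_atlas. pr z \<in> U" by blast
qed

text \<open>Near a lattice point u = x/y = 2 \<wp>/\<wp>' behaves like -t. The convention
  \<open>ec_u None = 0\<close> is the right value at infinity, so u is a local coordinate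
  there.\<close>

lemma ec_u_W_derivative_lattice:
  assumes z0: "z0 \<in> \<Lambda>"
  shows "((ec_u \<circ> W) has_field_derivative - 1) (at z0)"
  unfolding DERIV_def
proof -
  have "((\<lambda>t. 2 * (t ^ 2 * wp t) / (t ^ 3 * wp' t)) \<longlongrightarrow> 2 * 1 / (- 2)) (at 0)"
    by (intro tendsto_intros wp_lim wp'_lim) auto
  then have "((\<lambda>t. 2 * (t ^ 2 * wp t) / (t ^ 3 * wp' t)) \<longlongrightarrow> - 1) (at 0)" by simp
  moreover have "eventually (\<lambda>t. 2 * (t ^ 2 * wp t) / (t ^ 3 * wp' t) =
      ((ec_u \<circ> W) (z0 + t) - (ec_u \<circ> W) z0) / t) (at 0)"
    using eventually_not_lattice
  proof eventually_elim
    case (elim t)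
    then have "t \<noteq> 0" by auto
    have "W (z0 + t) = W t" using W_periodic[OF z0, of t] by (simp add: add.commute)
    then have "((ec_u \<circ> W) (z0 + t) - (ec_u \<circ> W) z0) / t = wp t / (wp' t / 2) / t"
      using elim z0 by (simp add: W_def)
    then show ?case using \<open>t \<noteq> 0\<close> by (simp add: eval_nat_numeral mult_ac)
  qed
  ultimately show "((\<lambda>t. ((ec_u \<circ> W) (z0 + t) - (ec_u \<circ> W) z0) / t) \<longlongrightarrow> - 1) (at 0)"
    by (rule Lim_transform_eventually)
qed

lemma ec_coordinates_holomorphic:
  "(ec_x \<circ> W) holomorphic_on - \<Lambda>" "(ec_y \<circ> W) holomorphic_on - \<Lambda>"
  "open N \<Longrightarrow> (\<And>z. z \<in> N \<Longrightarrow> z \<notin> \<Lambda> \<Longrightarrow> wp' z \<noteq> 0) \<Longrightarrow> (ec_u \<circ> W) holomorphic_on N"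
proof -
  show "(ec_x \<circ> W) holomorphic_on - \<Lambda>"
    by (rule holomorphic_transform[OF wp_holomorphic]) (simp add: W_def)
  have "(\<lambda>z. wp' z / 2) holomorphic_on - \<Lambda>" by (intro holomorphic_intros wp'_holomorphic) auto
  then show "(ec_y \<circ> W) holomorphic_on - \<Lambda>"
    by (rule holomorphic_transform) (simp add: W_def)
  assume N: "open N" and nz: "\<And>z. z \<in> N \<Longrightarrow> z \<notin> \<Lambda> \<Longrightarrow> wp' z \<noteq> 0"
  have "(\<lambda>z. wp z / (wp' z / 2)) holomorphic_on N - \<Lambda>"
    using nz by (intro holomorphic_intros holomorphic_on_subset[OF wp_holomorphic] holomorphic_on_subset[OF wp'_holomorphic]) auto
  then have off: "(ec_u \<circ> W) holomorphic_on N - \<Lambda>"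
    by (rule holomorphic_transform) (simp add: W_def)
  have "open (N - \<Lambda>)" using N open_compl_lattice by (simp add: Diff_eq open_Int)
  have "(ec_u \<circ> W) field_differentiable at z" if "z \<in> N" for z
  proof (cases "z \<in> \<Lambda>")
    case True
    then show ?thesis using ec_u_W_derivative_lattice by (auto simp: field_differentiable_def)
  next
    case False
    then show ?thesis using off \<open>open (N - \<Lambda>)\<close> that holomorphic_on_imp_differentiable_at by blast
  qed
  then show "(ec_u \<circ> W) holomorphic_on N" by (simp add: holomorphic_on_def field_differentiable_at_within)
qed

lemma uniformizes_curve: "uniformizes W (ec_topology a_coeff 0) (ec_atlas a_coeff 0)"
  unfolding uniformizes_def
proof (intro conjI allI ballI, safe)
  show "\<exists>D. open D \<and> z \<in> D \<and> inj_on W D" for z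
    using inj_on_half_ball \<omega>_pos
    by (intro exI[of _ "ball z (\<omega> / 2)"]) (auto simp: inj_on_def W_eq_iff)
next
  fix U \<phi> assume "(U, \<phi>) \<in> ec_atlas a_coeff 0"
  then show ch: "complex_chart (ec_topology a_coeff 0) U \<phi>" by (simp add: ec_atlas_def)
  have op: "open {z. W z \<in> U}"
    by (rule open_preimage_continuous_map[OF W_continuous complex_chartD(1)[OF ch]])
  have "\<phi> = ec_x \<and> None \<notin> U \<or> \<phi> = ec_y \<and> None \<notin> U \<or> \<phi> = ec_u \<and> (\<forall>x. Some (x, 0) \<notin> U)"
    using \<open>(U, \<phi>) \<in> ec_atlas a_coeff 0\<close> by (simp add: ec_atlas_def)
  then show "(\<phi> \<circ> W) holomorphic_on {z. W z \<in> U}"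
  proof (elim disjE conjE)
    assume "\<phi> = ec_u" and U: "\<forall>x. Some (x, 0) \<notin> U"
    have "wp' z \<noteq> 0" if "z \<in> {z. W z \<in> U}" "z \<notin> \<Lambda>" for z
      using that U by (auto simp: W_def)
    then show ?thesis unfolding \<open>\<phi> = ec_u\<close> by (rule ec_coordinates_holomorphic(3)[OF op])
  qed (auto intro!: holomorphic_on_subset[OF ec_coordinates_holomorphic(1)]
        holomorphic_on_subset[OF ec_coordinates_holomorphic(2)] simp: W_def)
qed (simp_all add: W_continuous topspace_ec_topology W_surj W_on_curve)

lemma curve_chart_at:
  assumes N: "open N" "z0 \<in> N" "(\<phi> \<circ> W) holomorphic_on N" and d: "deriv (\<phi> \<circ> W) z0 \<noteq> 0"
  obtains D where "z0 \<in> D" "D \<subseteq> N" "complex_chart (ec_topology a_coeff 0) (W ` D) \<phi>"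
proof -
  obtain r where r: "r > 0" "ball z0 r \<subseteq> N" "inj_on (\<phi> \<circ> W) (ball z0 r)"
    using has_complex_derivative_locally_injective[OF N(3,2,1) d] by blast
  then have "complex_chart (ec_topology a_coeff 0) (W ` ball z0 r) \<phi>"
    using N(3) by (intro complex_chart_of_holomorphic W_continuous W_open) (auto intro: holomorphic_on_subset)
  then show ?thesis using r that[of "ball z0 r"] by simp
qed

text \<open>Every point lies in a chart: u at infinity, x where y is nonzero, and y at the points of
  order two.\<close>

lemma riemann_surface_curve: "riemann_surface (ec_topology a_coeff 0) (ec_atlas a_coeff 0)"
proof (rule riemann_surface_uniformized[OF uniformizes_curve Hausdorff_ec_topology])
  fix z0
  have off: "z \<notin> \<Lambda> \<Longrightarrow> (wp has_field_derivative wp' z) (at z)" "z \<notin> \<Lambda> \<Longrightarrow> (wp' has_field_derivative wp'' z) (at z)" for z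
    by (auto intro!: derivative_eq_intros)
  consider "z0 \<in> \<Lambda>" | "z0 \<notin> \<Lambda>" "wp' z0 \<noteq> 0" | "z0 \<notin> \<Lambda>" "wp' z0 = 0" by blast
  then show "\<exists>(U, \<phi>)\<in>ec_atlas a_coeff 0. W z0 \<in> U"
  proof cases
    case 1
    \<comment> \<open>A zero z of \<wp>' in this ball would make 2(z - z0) a lattice vector shorter
      than \<omega>, hence zero; this explains the radius \<omega>/2.\<close>
    have nz: "wp' z \<noteq> 0" if "z \<in> ball z0 (\<omega> / 2)" "z \<notin> \<Lambda>" for z
    proof
      assume "wp' z = 0"
      then have "2 * z \<in> \<Lambda>" using wp'_eq_0_iff that by blast
      then have "2 * z - z0 - z0 \<in> \<Lambda>" using 1 lattice_diff by blast
      moreover have "norm (2 * z - z0 - z0) < \<omega>"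
      proof -
        have "2 * z - z0 - z0 = 2 * (z - z0)" by (simp add: algebra_simps)
        then have "norm (2 * z - z0 - z0) = 2 * norm (z - z0)" by (simp only: norm_mult norm_numeral)
        then show ?thesis using that(1) by (simp add: dist_norm norm_minus_commute)
      qed
      ultimately have "2 * z - z0 - z0 = 0" by (intro lattice_ball) simp_all
      then have "z = z0" by (simp add: algebra_simps)
      then show False using that 1 by blast
    qed
    have "deriv (ec_u \<circ> W) z0 = - 1" using ec_u_W_derivative_lattice[OF 1] by (rule DERIV_imp_deriv)
    then have d: "deriv (ec_u \<circ> W) z0 \<noteq> 0" by simp
    have c: "z0 \<in> ball z0 (\<omega> / 2)" using \<omega>_pos by simp
    have hol: "(ec_u \<circ> W) holomorphic_on ball z0 (\<omega> / 2)"
      using nz by (rule ec_coordinates_holomorphic(3)[OF open_ball])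
    obtain D where D: "z0 \<in> D" "D \<subseteq> ball z0 (\<omega> / 2)" "complex_chart (ec_topology a_coeff 0) (W ` D) ec_u"
      by (rule curve_chart_at[OF open_ball c hol d]) (rule that)
    moreover have "Some (x, 0) \<notin> W ` D" for x
      using D(2) nz by (auto simp: W_def split: if_splits)
    ultimately have "(W ` D, ec_u) \<in> ec_atlas a_coeff 0" by (simp add: ec_atlas_def)
    then show ?thesis using D(1) by blast
  next
    case 2
    have "((ec_x \<circ> W) has_field_derivative wp' z0) (at z0)"
      by (rule has_field_derivative_transform_within_open[OF off(1) open_compl_lattice]) (use 2 in \<open>auto simp: W_def\<close>)
    then have d: "deriv (ec_x \<circ> W) z0 \<noteq> 0" using 2(2) DERIV_imp_deriv by metis
    have "z0 \<in> - \<Lambda>" using 2 by simp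
    obtain D where D: "z0 \<in> D" "D \<subseteq> - \<Lambda>" "complex_chart (ec_topology a_coeff 0) (W ` D) ec_x"
      by (rule curve_chart_at[OF open_compl_lattice \<open>z0 \<in> - \<Lambda>\<close> ec_coordinates_holomorphic(1) d]) (rule that)
    moreover have "None \<notin> W ` D" using D(2) by (auto simp: W_def split: if_splits)
    ultimately have "(W ` D, ec_x) \<in> ec_atlas a_coeff 0" by (simp add: ec_atlas_def)
    then show ?thesis using D(1) by blast
  next
    case 3
    have "((\<lambda>z. wp' z / 2) has_field_derivative wp'' z0 / 2) (at z0)"
      using 3 by (auto intro!: derivative_eq_intros)
    then have "((ec_y \<circ> W) has_field_derivative wp'' z0 / 2) (at z0)"
      by (rule has_field_derivative_transform_within_open[OF _ open_compl_lattice]) (use 3 in \<open>auto simp: W_def\<close>)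
    then have "deriv (ec_y \<circ> W) z0 = wp'' z0 / 2" by (rule DERIV_imp_deriv)
    then have d: "deriv (ec_y \<circ> W) z0 \<noteq> 0" using wp''_nonzero[OF 3] by auto
    have "z0 \<in> - \<Lambda>" using 3 by simp
    obtain D where D: "z0 \<in> D" "D \<subseteq> - \<Lambda>" "complex_chart (ec_topology a_coeff 0) (W ` D) ec_y"
      by (rule curve_chart_at[OF open_compl_lattice \<open>z0 \<in> - \<Lambda>\<close> ec_coordinates_holomorphic(2) d]) (rule that)
    moreover have "None \<notin> W ` D" using D(2) by (auto simp: W_def split: if_splits)
    ultimately have "(W ` D, ec_y) \<in> ec_atlas a_coeff 0" by (simp add: ec_atlas_def)
    then show ?thesis using D(1) by blast
  qed
qed

section \<open>Group structures and the isomorphism\<close>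

lemma normal_lattice: "normal \<Lambda> complex_add_group"
proof -
  interpret G: group complex_add_group by (rule group_complex_add)
  have inv: "inv\<^bsub>complex_add_group\<^esub> x = - x" for x
    by (rule G.inv_equality) (auto simp: complex_add_group_def)
  have "subgroup \<Lambda> complex_add_group"
    by (rule G.subgroupI) (auto simp: inv, auto simp: complex_add_group_def lattice_add)
  moreover have "comm_group complex_add_group"
    by (rule G.group_comm_groupI) (auto simp: complex_add_group_def)
  ultimately show ?thesis using comm_group.normal_iff_subgroup by blast
qed

lemma torus_simps:
  "carrier (complex_torus \<Lambda>) = range pr" "one (complex_torus \<Lambda>) = pr 0"
  "curve_topology (complex_torus \<Lambda>) = torus_top" "curve_atlas (complex_torus \<Lambda>) = torus_atlas"
  "mult (complex_torus \<Lambda>) (pr z) (pr w) = pr (z + w)"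
proof -
  interpret normal \<Lambda> complex_add_group by (rule normal_lattice)
  show "carrier (complex_torus \<Lambda>) = range pr"
    by (auto simp: complex_torus_def monoid.defs FactGroup_def RCOSETS_def torus_proj_def complex_add_group_def)
  show "one (complex_torus \<Lambda>) = pr 0"
    by (simp add: complex_torus_def monoid.defs FactGroup_def pr_eq)
  show "curve_topology (complex_torus \<Lambda>) = torus_top"
    by (simp add: complex_torus_def monoid.defs)
  show "curve_atlas (complex_torus \<Lambda>) = torus_atlas"
    by (simp add: complex_torus_def monoid.defs torus_atlas_def)
  have "set_mult complex_add_group (pr z) (pr w) = pr (mult complex_add_group z w)"
    unfolding torus_proj_def by (rule rcos_sum) (auto simp: complex_add_group_def)
  then show "mult (complex_torus \<Lambda>) (pr z) (pr w) = pr (z + w)"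
    by (simp add: complex_torus_def monoid.defs FactGroup_def) (simp add: complex_add_group_def)
qed

lemma group_torus: "group (complex_torus \<Lambda>)"
  unfolding complex_torus_def by (intro group_monoid_extend normal.factorgroup_is_group normal_lattice)

lemma curve_simps:
  "carrier (elliptic_curve a b) = ec_points a b" "mult (elliptic_curve a b) = ec_add a"
  "one (elliptic_curve a b) = None" "curve_topology (elliptic_curve a b) = ec_topology a b"
  "curve_atlas (elliptic_curve a b) = ec_atlas a b"
  by (simp_all add: elliptic_curve_def)

lemma tmap_iso: "tmap \<in> iso (complex_torus \<Lambda>) (elliptic_curve a_coeff 0)"
proof -
  have "tmap (mult (complex_torus \<Lambda>) Z Y) = ec_add a_coeff (tmap Z) (tmap Y)"
    if "Z \<in> range pr" "Y \<in> range pr" for Z Y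
    using that by (auto simp: torus_simps tmap_pr W_add)
  then have "tmap \<in> hom (complex_torus \<Lambda>) (elliptic_curve a_coeff 0)"
    using tmap_image by (auto simp: hom_def torus_simps(1) curve_simps)
  moreover have "bij_betw tmap (range pr) (ec_points a_coeff 0)"
    using tmap_inj tmap_image by (simp add: bij_betw_def)
  ultimately show ?thesis by (simp add: iso_def torus_simps(1) curve_simps)
qed

lemma group_curve: "group (elliptic_curve a_coeff 0)"
proof -
  \<comment> \<open>Transport along an isomorphism yields a group whose unit is the image of the
    unit; this identifies it with the point at infinity.\<close>
  have "tmap (one (complex_torus \<Lambda>)) = one (elliptic_curve a_coeff 0)"
    by (simp add: torus_simps(2) tmap_pr curve_simps) (simp add: W_def)
  then show ?thesis
    using group.iso_imp_img_group[OF group_torus tmap_iso] by (simp add: elliptic_curve_def)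
qed

theorem weierstrass_lie_iso: "complex_lie_iso (complex_torus \<Lambda>) (elliptic_curve a_coeff 0) tmap"
  unfolding complex_lie_iso_def torus_simps(1,3,4) curve_simps
  by (intro conjI group_torus group_curve topspace_torus topspace_ec_topology riemann_surface_torus
      riemann_surface_curve tmap_iso
      holomorphic_map_uniformized[OF uniformizes_torus uniformizes_curve tmap_continuous]
      holomorphic_map_uniformized[OF uniformizes_curve uniformizes_torus tmap_inverse_continuous]
      tmap_pr inv_tmap)

end

theorem theorem4p3:
  fixes n :: nat and \<Lambda> :: "complex set"
  assumes "n > 0"
    and "\<Lambda> = (\<lambda>w. complex_of_real (pi / sqrt (real n) * gauss_constant) * w) ` gaussian_integers"
  shows "complex_lie_iso (complex_torus \<Lambda>) (elliptic_curve (- (of_nat n ^ 2)) 0)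
           (weierstrass_torus_map \<Lambda>) \<and>
         0.8346268 \<le> gauss_constant \<and> gauss_constant < 0.8346269"
proof -
  define \<omega> where "\<omega> = pi / sqrt (real n) * gauss_constant"
  have G: "0 < gauss_constant" using gauss_constant_bounds by linarith
  then have pos: "0 < \<omega>" using assms(1) by (simp add: \<omega>_def)
  interpret square_lattice \<omega> \<Lambda>
    by standard (use pos assms(2) in \<open>auto simp: \<omega>_def\<close>)
  \<comment> \<open>The period relation with \<omega> = \<pi>G / sqrt n inserted. Positivity of G
    permits cancellation.\<close>
  have "pi * gauss_constant * sqrt re1 = pi * gauss_constant * sqrt (real n)"
    using period_agm assms(1) by (simp add: \<omega>_def field_simps)
  then have "sqrt re1 = sqrt (real n)" using G by simp
  then have "re1 = real n" by simp
  then have "wpC / 2 = - (of_nat n ^ 2)" by (simp add: wpC_eq e1_real)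
  then show ?thesis using weierstrass_lie_iso gauss_constant_bounds by simp
qed

end
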